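(* Let $\mathbf{k}$ be a field or $\mathbb{Z}$, and let $\Delta$ be a balanced simplicial complex of dimension $d-1$ that is 2-CM over $\mathbf{k}$. If $d\ge 3$, then $$2h_2(\Delta)\ge (d-1)h_1(\Delta).$$ In particular, if $d\ge 2$ and $f_0(\Delta)=n$, then $j\cdot f_{j-1}(\Delta)\ge\psi_{j-1}(n,d-1)$ for all $2\le j\le d$, where $$\psi_{j-1}(n,d-1)=\begin{cases}(2^j-1)\binom{d-1}{j-1}(n-d)+d\binom{d-1}{j-1}, & 1\le j\le d-1,\\ (2^d-2)(n-d)+2d, & j=d.\end{cases}$$
   Context: A simplicial complex $\Delta$ on a finite vertex set $V$ is a collection of subsets of $V$ (faces) closed under inclusion and containing all singletons. For a face $F$, $\dim F=|F|-1$; $\dim\Delta$ is the maximal dimension of a face. A $(d-1)$-dimensional complex $\Delta$ is balanced if there is a coloring $\kappa:V\to[d]=\{1,\dots,d\}$ such that $\kappa(v)\ne\kappa(w)$ for every face $F\in\Delta$ and all distinct $v,w\in F$. If $\dim\Delta=d-1$, $f_j(\Delta)$ is the number of $j$-dimensional faces ($f_{-1}=1$), $f(\Delta,x)=\sum_{j=0}^{d}f_{j-1}x^j$, and the $h$-numbers $h_0,\dots,h_d$ are defined by $\sum_{j=0}^d h_jx^j=(1-x)^d f\left(\Delta,\frac{x}{1-x}\right)$. The link of $F\in\Delta$ is $\mathrm{lk}\,F=\{G\in\Delta: F\cup G\in\Delta, F\cap G=\emptyset\}$. A $(d-1)$-dimensional complex $\Delta$ is Cohen–Macaulay (CM) over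 $\mathbf{k}$ if the reduced simplicial homology $\tilde H_m(\mathrm{lk}\,F;\mathbf{k})$ vanishes for all $F\in\Delta$ (including $F=\emptyset$) and all $m<d-|F|-1$. For $W\subseteq V$, $\Delta_{-W}=\{F\in\Delta: F\subseteq V\setminus W\}$. $\Delta$ is 2-CM over $\mathbf{k}$ if for all $W\subset V$ with $|W|\le 1$, $\Delta_{-W}$ is CM over $\mathbf{k}$ and has the same dimension as $\Delta$. *)

theory Defs
  imports
    "HOL-Algebra.Elementary_Groups"
    "HOL-Computational_Algebra.Polynomial"
begin

section \<open>Simplicial complexes\<close>

definition simplicial_complex :: "'v set \<Rightarrow> 'v set set \<Rightarrow> bool" where
  "simplicial_complex V \<Delta> \<longleftrightarrow>
     finite V \<and> \<Delta> \<subseteq> Pow V \<and> {} \<in> \<Delta> \<and>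
     (\<forall>F\<in>\<Delta>. \<forall>G. G \<subseteq> F \<longrightarrow> G \<in> \<Delta>) \<and> (\<forall>v\<in>V. {v} \<in> \<Delta>)"

text \<open>Dimensions are integers, as \<^term>\<open>{}\<close> has dimension \<open>-1\<close>.\<close>

definition face_dim :: "'v set \<Rightarrow> int" where
  "face_dim F = int (card F) - 1"

definition complex_dim :: "'v set set \<Rightarrow> int" where
  "complex_dim \<Delta> = Max (face_dim ` \<Delta>)"

definition link :: "'v set set \<Rightarrow> 'v set \<Rightarrow> 'v set set" where
  "link \<Delta> F = {G \<in> \<Delta>. F \<union> G \<in> \<Delta> \<and> F \<inter> G = {}}"

definition deletion :: "'v set \<Rightarrow> 'v set set \<Rightarrow> 'v set \<Rightarrow> 'v set set" where
  "deletion V \<Delta> W = {F \<in> \<Delta>. F \<subseteq> V - W}"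

definition balanced :: "'v set \<Rightarrow> 'v set set \<Rightarrow> bool" where
  "balanced V \<Delta> \<longleftrightarrow>
     (\<exists>\<kappa> :: 'v \<Rightarrow> nat. \<kappa> ` V \<subseteq> {1..nat (complex_dim \<Delta> + 1)} \<and>
        (\<forall>F\<in>\<Delta>. \<forall>v\<in>F. \<forall>w\<in>F. v \<noteq> w \<longrightarrow> \<kappa> v \<noteq> \<kappa> w))"

section \<open>Face numbers and h-numbers\<close>

definition f_num :: "'v set set \<Rightarrow> int \<Rightarrow> nat" where
  "f_num \<Delta> j = card {F \<in> \<Delta>. face_dim F = j}"

definition f_poly :: "'v set set \<Rightarrow> int poly" where
  "f_poly \<Delta> = (\<Sum>j\<le>nat (complex_dim \<Delta> + 1). monom (int (f_num \<Delta> (int j - 1))) j)"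

text \<open>
  This is \<open>(1 - x)^d * f(\<Delta>, x / (1 - x))\<close> with denominators cleared;
  see \<open>poly_h_poly\<close> below.
\<close>

definition h_poly :: "'v set set \<Rightarrow> int poly" where
  "h_poly \<Delta> = (let d = nat (complex_dim \<Delta> + 1) in
     \<Sum>j\<le>d. monom (int (f_num \<Delta> (int j - 1))) j * [:1, -1:] ^ (d - j))"

definition h_num :: "'v set set \<Rightarrow> nat \<Rightarrow> int" where
  "h_num \<Delta> j = coeff (h_poly \<Delta>) j"

lemma poly_h_poly:
  fixes x :: "'a :: field_char_0"
  assumes "x \<noteq> 1"
  shows "poly (map_poly of_int (h_poly \<Delta>)) x =
    (1 - x) ^ nat (complex_dim \<Delta> + 1) * poly (map_poly of_int (f_poly \<Delta>)) (x / (1 - x))"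
proof -
  define d where "d = nat (complex_dim \<Delta> + 1)"
  define f where "f = (\<lambda>j. int (f_num \<Delta> (int j - 1)))"
  have hom_sum: "map_poly (of_int :: int \<Rightarrow> 'a) (sum g A) = (\<Sum>j\<in>A. map_poly of_int (g j))"
    for g :: "nat \<Rightarrow> int poly" and A
    by (rule poly_eqI) (simp add: coeff_map_poly coeff_sum)
  have hom_mult: "map_poly (of_int :: int \<Rightarrow> 'a) (p * q) = map_poly of_int p * map_poly of_int q"
    for p q by (rule poly_eqI) (simp add: coeff_map_poly coeff_mult)
  have hom_pow: "map_poly (of_int :: int \<Rightarrow> 'a) (p ^ n) = map_poly of_int p ^ n" for p n
    by (induction n) (simp_all add: hom_mult)
  have hom_monom: "map_poly (of_int :: int \<Rightarrow> 'a) (monom a n) = monom (of_int a) n" for a n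
    by (rule poly_eqI) (simp add: coeff_map_poly)
  have lin: "map_poly (of_int :: int \<Rightarrow> 'a) [:1, -1:] = [:1, -1:]"
    by (simp add: map_poly_pCons)
  have "poly (map_poly of_int (h_poly \<Delta>)) x = (\<Sum>j\<le>d. of_int (f j) * x ^ j * (1 - x) ^ (d - j))"
    unfolding h_poly_def Let_def d_def[symmetric]
    by (simp add: hom_sum hom_mult hom_pow hom_monom lin poly_sum poly_monom f_def)
  also have "\<dots> = (\<Sum>j\<le>d. (1 - x) ^ d * (of_int (f j) * (x / (1 - x)) ^ j))"
    using assms by (intro sum.cong) (auto simp: power_diff power_divide field_simps)
  also have "\<dots> = (1 - x) ^ d * poly (map_poly of_int (f_poly \<Delta>)) (x / (1 - x))"
    unfolding f_poly_def d_def[symmetric]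
    by (simp add: hom_sum hom_monom poly_sum poly_monom sum_distrib_left f_def)
  finally show ?thesis by (simp only: d_def)
qed

section \<open>Reduced simplicial homology\<close>

text \<open>
  Oriented chains. The coefficient of a chain \<open>c\<close> at the oriented simplex
  \<open>[v\<^sub>0, \<dots>, v\<^sub>m]\<close> is the value of \<open>c\<close> at that list, so \<open>c\<close> is
  alternating: permuting the list multiplies the coefficient by the sign of the permutation.
  Distinctness is required separately for the sake of characteristic 2. The empty list
  is the generator in degree \<open>-1\<close>.
\<close>

definition oriented_chains :: "'k::comm_ring_1 itself \<Rightarrow> 'v set set \<Rightarrow> int \<Rightarrow> ('v list \<Rightarrow> 'k) set" where
  "oriented_chains k \<Delta> m = {c.
     (\<forall>xs. c xs \<noteq> 0 \<longrightarrow> distinct xs \<and> set xs \<in> \<Delta> \<and> face_dim (set xs) = m) \<and>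
     (\<forall>xs x y ys. c (xs @ x # y # ys) = - c (xs @ y # x # ys))}"

definition chain_group :: "'k::comm_ring_1 itself \<Rightarrow> 'v set set \<Rightarrow> int \<Rightarrow> ('v list \<Rightarrow> 'k) monoid" where
  "chain_group k \<Delta> m =
     \<lparr>carrier = oriented_chains k \<Delta> m, monoid.mult = (\<lambda>c c' xs. c xs + c' xs), monoid.one = (\<lambda>_. 0)\<rparr>"

text \<open>
  The usual \<open>\<partial>[v\<^sub>0, \<dots>, v\<^sub>m] = (\<Sum>i. (-1)^i [v\<^sub>0, \<dots>, v\<^sub>i\<^sub>-\<^sub>1, v\<^sub>i\<^sub>+\<^sub>1, \<dots>, v\<^sub>m])\<close>,
  read off on coefficients: \<open>[v, x\<^sub>1, \<dots>, x\<^sub>m]\<close> contributes \<open>+[x\<^sub>1, \<dots>, x\<^sub>m]\<close>, and every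
  oriented simplex having the vertices \<open>x\<^sub>i\<close> and \<open>v\<close> can be brought to this form.
  Every chain of degree \<open>-1\<close> is a cycle.
\<close>

definition boundary_map :: "'v set set \<Rightarrow> ('v list \<Rightarrow> 'k::comm_ring_1) \<Rightarrow> 'v list \<Rightarrow> 'k" where
  "boundary_map \<Delta> c xs = (\<Sum>v\<in>\<Union>\<Delta>. c (v # xs))"

definition cycle_group :: "'k::comm_ring_1 itself \<Rightarrow> 'v set set \<Rightarrow> int \<Rightarrow> ('v list \<Rightarrow> 'k) monoid" where
  "cycle_group k \<Delta> m = (chain_group k \<Delta> m)
     \<lparr>carrier := kernel (chain_group k \<Delta> m) (chain_group k \<Delta> (m - 1)) (boundary_map \<Delta>)\<rparr>"

definition reduced_homology :: "'k::comm_ring_1 itself \<Rightarrow> 'v set set \<Rightarrow> int \<Rightarrow> ('v list \<Rightarrow> 'k) set monoid" where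
  "reduced_homology k \<Delta> m = cycle_group k \<Delta> m Mod (boundary_map \<Delta> ` oriented_chains k \<Delta> (m + 1))"

lemma sum_alternating_eq_0:
  fixes a :: "'v \<Rightarrow> 'v \<Rightarrow> 'k::comm_ring_1"
  assumes "finite A" "\<And>v. a v v = 0" "\<And>v w. a v w = - a w v"
  shows "(\<Sum>v\<in>A. \<Sum>w\<in>A. a v w) = 0"
  using assms(1)
proof (induction A)
  case (insert u A)
  have "(\<Sum>v\<in>A. a v u) = - (\<Sum>w\<in>A. a u w)"
    by (subst assms(3)) (simp add: sum_negf)
  with insert show ?case by (simp add: assms(2) sum.distrib)
qed simp

lemma oriented_chainsI:
  assumes "\<And>xs. c xs \<noteq> 0 \<Longrightarrow> distinct xs \<and> set xs \<in> \<Delta> \<and> face_dim (set xs) = m"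
    and "\<And>xs x y ys. c (xs @ x # y # ys) = - c (xs @ y # x # ys)"
  shows "c \<in> oriented_chains k \<Delta> m"
  unfolding oriented_chains_def mem_Collect_eq by (intro conjI allI impI assms)

lemma oriented_chains_support:
  "c \<in> oriented_chains k \<Delta> m \<Longrightarrow> c xs \<noteq> 0 \<Longrightarrow>
     distinct xs \<and> set xs \<in> \<Delta> \<and> face_dim (set xs) = m"
  unfolding oriented_chains_def by blast

lemma oriented_chains_swap:
  "c \<in> oriented_chains k \<Delta> m \<Longrightarrow> c (xs @ x # y # ys) = - c (xs @ y # x # ys)"
  unfolding oriented_chains_def by blast

lemma boundary_map_in_chains:
  fixes k :: "'k::comm_ring_1 itself"
  assumes "simplicial_complex V \<Delta>" "c \<in> oriented_chains k \<Delta> m"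
  shows "boundary_map \<Delta> c \<in> oriented_chains k \<Delta> (m - 1)"
proof -
  have "distinct xs \<and> set xs \<in> \<Delta> \<and> face_dim (set xs) = m - 1"
    if nonzero: "boundary_map \<Delta> c xs \<noteq> 0" for xs
  proof -
    obtain v where "c (v # xs) \<noteq> 0"
      using nonzero unfolding boundary_map_def by (elim sum.not_neutral_contains_not_neutral)
    then have *: "distinct (v # xs)" "insert v (set xs) \<in> \<Delta>" "face_dim (insert v (set xs)) = m"
      using oriented_chains_support[OF assms(2), of "v # xs"] by auto
    have "set xs \<in> \<Delta>"
      using assms(1) *(2) subset_insertI[of "set xs" v] unfolding simplicial_complex_def by metis
    with * show ?thesis by (auto simp: face_dim_def)
  qed
  moreover have "boundary_map \<Delta> c (xs @ x # y # ys) = - boundary_map \<Delta> c (xs @ y # x # ys)"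
    for xs x y ys
  proof -
    have "c (v # xs @ x # y # ys) = - c (v # xs @ y # x # ys)" for v
      using oriented_chains_swap[OF assms(2), of "v # xs" x y ys] by simp
    then show ?thesis by (simp only: boundary_map_def append_Cons sum_negf)
  qed
  ultimately show ?thesis by (rule oriented_chainsI)
qed

lemma boundary_map_boundary_map:
  fixes k :: "'k::comm_ring_1 itself"
  assumes "simplicial_complex V \<Delta>" "c \<in> oriented_chains k \<Delta> m"
  shows "boundary_map \<Delta> (boundary_map \<Delta> c) = (\<lambda>_. 0)"
proof
  fix xs
  have fin: "finite (\<Union>\<Delta>)"
    using assms(1) by (intro finite_subset[of "\<Union>\<Delta>" V]) (auto simp: simplicial_complex_def)
  have "c (v # v # xs) = 0" for v
    using oriented_chains_support[OF assms(2), of "v # v # xs"] by auto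
  moreover have "c (v # w # xs) = - c (w # v # xs)" for v w
    using oriented_chains_swap[OF assms(2), of "[]" v w xs] by simp
  ultimately have "(\<Sum>v\<in>\<Union>\<Delta>. \<Sum>w\<in>\<Union>\<Delta>. c (w # v # xs)) = 0"
    by (rule sum_alternating_eq_0[OF fin, where a = "\<lambda>v w. c (w # v # xs)"])
  then show "boundary_map \<Delta> (boundary_map \<Delta> c) xs = 0"
    by (simp add: boundary_map_def)
qed

lemma boundary_map_add:
  "boundary_map \<Delta> (\<lambda>xs. c xs + c' xs) = (\<lambda>xs. boundary_map \<Delta> c xs + boundary_map \<Delta> c' xs)"
  by (simp add: boundary_map_def fun_eq_iff sum.distrib)

lemma boundary_map_minus: "boundary_map \<Delta> (\<lambda>xs. - c xs) = (\<lambda>xs. - boundary_map \<Delta> c xs)"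
  by (simp add: boundary_map_def fun_eq_iff sum_negf)

lemma oriented_chains_zero: "(\<lambda>_. 0) \<in> oriented_chains k \<Delta> m"
  by (simp add: oriented_chains_def)

lemma oriented_chains_minus:
  assumes "c \<in> oriented_chains k \<Delta> m"
  shows "(\<lambda>xs. - c xs) \<in> oriented_chains k \<Delta> m"
proof (rule oriented_chainsI)
  show "- c (xs @ x # y # ys) = - (- c (xs @ y # x # ys))" for xs x y ys
    using oriented_chains_swap[OF assms, of xs x y ys] by simp
qed (use oriented_chains_support[OF assms] in simp)

lemma oriented_chains_add:
  assumes "c \<in> oriented_chains k \<Delta> m" "c' \<in> oriented_chains k \<Delta> m"
  shows "(\<lambda>xs. c xs + c' xs) \<in> oriented_chains k \<Delta> m"
proof (rule oriented_chainsI)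
  fix xs assume "c xs + c' xs \<noteq> 0"
  then have "c xs \<noteq> 0 \<or> c' xs \<noteq> 0" by auto
  then show "distinct xs \<and> set xs \<in> \<Delta> \<and> face_dim (set xs) = m"
    using assms[THEN oriented_chains_support] by blast
next
  show "c (xs @ x # y # ys) + c' (xs @ x # y # ys)
      = - (c (xs @ y # x # ys) + c' (xs @ y # x # ys))" for xs x y ys
    using assms[THEN oriented_chains_swap, of xs x y ys] by simp
qed

lemma comm_group_cycle_group: "comm_group (cycle_group k \<Delta> m)"
proof (rule comm_groupI)
  fix c assume c: "c \<in> carrier (cycle_group k \<Delta> m)"
  show "\<exists>c'\<in>carrier (cycle_group k \<Delta> m). c' \<otimes>\<^bsub>cycle_group k \<Delta> m\<^esub> c = \<one>\<^bsub>cycle_group k \<Delta> m\<^esub>"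
    by (rule bexI[of _ "\<lambda>xs. - c xs"])
      (use c in \<open>auto simp: cycle_group_def chain_group_def kernel_def oriented_chains_minus boundary_map_minus\<close>)
qed (auto simp: cycle_group_def chain_group_def kernel_def oriented_chains_zero oriented_chains_add
       boundary_map_add add_ac boundary_map_def[of _ "\<lambda>_. 0"])

lemma trivial_reduced_homology_iff:
  fixes k :: "'k::comm_ring_1 itself" and \<Delta> :: "'v set set"
  assumes "simplicial_complex V \<Delta>"
  shows "trivial_group (reduced_homology k \<Delta> m) \<longleftrightarrow>
    (\<forall>c\<in>oriented_chains k \<Delta> m. boundary_map \<Delta> c = (\<lambda>_. 0) \<longrightarrow> c \<in> boundary_map \<Delta> ` oriented_chains k \<Delta> (m + 1))"
proof -
  let ?Z = "cycle_group k \<Delta> m" and ?B = "boundary_map \<Delta> ` oriented_chains k \<Delta> (m + 1)"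
  interpret Z: comm_group ?Z by (rule comm_group_cycle_group)
  have carrier: "carrier ?Z = {c \<in> oriented_chains k \<Delta> m. boundary_map \<Delta> c = (\<lambda>_. 0)}"
    by (auto simp: cycle_group_def chain_group_def kernel_def)
  have mult: "c \<otimes>\<^bsub>?Z\<^esub> c' = (\<lambda>xs. c xs + c' xs)" for c c'
    by (simp add: cycle_group_def chain_group_def)
  have one: "\<one>\<^bsub>?Z\<^esub> = (\<lambda>_. 0)"
    by (simp add: cycle_group_def chain_group_def)
  have sub: "?B \<subseteq> carrier ?Z"
    using boundary_map_in_chains[OF assms, of _ k "m + 1"] boundary_map_boundary_map[OF assms]
    by (auto simp: carrier)
  have inv: "inv\<^bsub>?Z\<^esub> c = (\<lambda>xs. - c xs)" if "c \<in> carrier ?Z" for c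
    by (rule Z.inv_equality)
      (use that in \<open>auto simp: mult one carrier oriented_chains_minus boundary_map_minus\<close>)
  have subgrp: "subgroup ?B ?Z"
  proof (rule Z.subgroupI)
    show "?B \<noteq> {}" using oriented_chains_zero by blast
  next
    fix b assume b: "b \<in> ?B"
    then obtain c where "c \<in> oriented_chains k \<Delta> (m + 1)" "b = boundary_map \<Delta> c" by blast
    with inv[of b] b sub show "inv\<^bsub>?Z\<^esub> b \<in> ?B"
      by (auto simp: boundary_map_minus[symmetric] intro!: imageI oriented_chains_minus)
  next
    fix b b' assume "b \<in> ?B" "b' \<in> ?B"
    then show "b \<otimes>\<^bsub>?Z\<^esub> b' \<in> ?B"
      by (auto simp: mult boundary_map_add[symmetric] intro!: imageI oriented_chains_add)
  qed (rule sub)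
  interpret B: normal ?B ?Z
    using subgrp Z.normal_iff_subgroup by blast
  have "trivial_group (reduced_homology k \<Delta> m) \<longleftrightarrow> carrier (?Z Mod ?B) = {?B}"
    using B.factorgroup_is_group by (simp add: trivial_group_def reduced_homology_def)
  also have "\<dots> \<longleftrightarrow> carrier ?Z \<subseteq> ?B"
  proof
    assume *: "carrier (?Z Mod ?B) = {?B}"
    show "carrier ?Z \<subseteq> ?B"
    proof
      fix c assume c: "c \<in> carrier ?Z"
      then have "?B #>\<^bsub>?Z\<^esub> c = ?B"
        using * unfolding carrier_FactGroup by blast
      then show "c \<in> ?B" using Z.rcos_self[OF c subgrp] by simp
    qed
  next
    assume "carrier ?Z \<subseteq> ?B"
    then have "(\<lambda>c. ?B #>\<^bsub>?Z\<^esub> c) ` carrier ?Z = (\<lambda>c. ?B) ` carrier ?Z"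
      using Z.coset_join2[OF _ subgrp] by (intro image_cong) auto
    then show "carrier (?Z Mod ?B) = {?B}"
      unfolding carrier_FactGroup using Z.one_closed by auto
  qed
  finally show ?thesis by (auto simp: carrier)
qed

section \<open>Cohen--Macaulay and 2-Cohen--Macaulay complexes\<close>

text \<open>The bound is \<open>m < d - |F| - 1\<close> where \<open>d - 1\<close> is the dimension of the complex.\<close>

definition cohen_macaulay :: "'k::comm_ring_1 itself \<Rightarrow> 'v set set \<Rightarrow> bool" where
  "cohen_macaulay k \<Delta> \<longleftrightarrow>
     (\<forall>F\<in>\<Delta>. \<forall>m < complex_dim \<Delta> - int (card F). trivial_group (reduced_homology k (link \<Delta> F) m))"

definition two_cohen_macaulay :: "'k::comm_ring_1 itself \<Rightarrow> 'v set \<Rightarrow> 'v set set \<Rightarrow> bool" where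
  "two_cohen_macaulay k V \<Delta> \<longleftrightarrow>
     (\<forall>W. W \<subseteq> V \<and> card W \<le> 1 \<longrightarrow>
        cohen_macaulay k (deletion V \<Delta> W) \<and> complex_dim (deletion V \<Delta> W) = complex_dim \<Delta>)"

section \<open>The lower bound\<close>

text \<open>\<open>psi i n e\<close> is $\psi_i(n, e)$; it is used for \<open>i = j - 1\<close> and \<open>e = d - 1\<close> with \<open>1 \<le> j \<le> d\<close>,
  and the second branch is the case \<open>j = d\<close>.\<close>

definition psi :: "nat \<Rightarrow> nat \<Rightarrow> nat \<Rightarrow> int" where
  "psi i n e = (let j = i + 1; d = e + 1 in
     if j \<le> d - 1
     then (2 ^ j - 1) * int ((d - 1) choose (j - 1)) * (int n - int d)
            + int d * int ((d - 1) choose (j - 1))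
     else (2 ^ d - 2) * (int n - int d) + 2 * int d)"

end

theory Submission
  imports Defs "HOL-Analysis.Determinants"
begin

text \<open>
  Call a graph on \<open>X\<close> rigid if, for some \<open>p : X \<rightarrow> \<real>\<^sup>3\<close> with spanning image, the only
  \<open>m : X \<rightarrow> \<real>\<^sup>3\<close> with \<open>m\<^sub>x \<bullet> p\<^sub>y = m\<^sub>y \<bullet> p\<^sub>x\<close> on all edges are \<open>m = A p\<close> with \<open>A\<close> symmetric
  (Kalai's hyperconnectivity, used here in place of infinitesimal rigidity). Rigid graphs have at
  least \<open>3 |X| - 6\<close> edges, may be glued along three vertices, and stay rigid under vertex splits:
  placing the two halves at the same point forces equal values of \<open>m\<close>. Hence Fogelsanger's
  contraction argument shows that the graph of every minimal 2-cycle is rigid.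

  Let \<open>T\<close> be a set of three colours and let \<open>G\<close> be a face with all the other colours. Two triangles of
  \<open>lk G\<close> sharing an edge lie on a common minimal 2-cycle of \<open>lk G\<close>, because the
  deletions of vertices still have vanishing homology. As the complex is connected through
  codimension one, the graph induced on the colours \<open>T\<close> is rigid. Summing
  \<open>f\<^sub>1 \<ge> 3 f\<^sub>0 - 6\<close> over all \<open>T\<close> gives the bound for \<open>f\<^sub>1\<close>, equivalently for \<open>h\<^sub>2\<close>, and the
  higher face numbers follow by induction over vertex links.
\<close>

section \<open>Linear systems\<close>

text \<open>In bar-and-joint rigidity two joints at one point give no condition along the edge
  between them, so a vertex split needs a limit argument. Here the edge equation with
  \<open>p u = p v\<close> still says that \<open>m u - m v\<close> is orthogonal to
  \<open>p u\<close>, and two common neighbours complete a basis. The 6 in the edge count is the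
  dimension of the symmetric 3 by 3 matrices.

  The obstacle to contraction is that contracting an edge \<open>uv\<close> of a minimal cycle may
  destroy minimality and may cancel triangles. Each minimal piece lifts to a rigid set through
  \<open>u\<close> and \<open>v\<close>, but two such sets may share only these vertices, one short
  of gluing; minimality of the original cycle has to make up for this.

  Cycles are combined by cross-multiplication instead of division, which treats fields and the
  integers at once. Three colours suffice for every \<open>d\<close> since a vertex colour lies in
  \<open>(d - 1) choose 2\<close> triples of colours and the colours of an edge in
  \<open>d - 2\<close> of them, which is the right proportion after averaging.\<close>

definition injective_system :: "'i set \<Rightarrow> ('i \<Rightarrow> 'c \<Rightarrow> 'a::comm_ring_1) \<Rightarrow> 'c set \<Rightarrow> bool" where
  "injective_system I f C \<longleftrightarrow>
     (\<forall>x. (\<forall>i\<in>I. (\<Sum>c\<in>C. f i c * x c) = 0) \<longrightarrow> (\<forall>c\<in>C. x c = 0))"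

text \<open>One step of Gaussian elimination without fractions: the new coefficients are 2 by 2
  minors, so polynomial entries stay polynomial.\<close>

lemma injective_system_eliminate:
  fixes f :: "'i \<Rightarrow> 'c \<Rightarrow> 'a::field"
  assumes "finite C" "k \<notin> C" "i \<in> I" and piv: "f i k \<noteq> 0"
  shows "injective_system I f (insert k C) \<longleftrightarrow>
    injective_system (I - {i}) (\<lambda>j c. f i k * f j c - f j k * f i c) C"
proof
  assume L: "injective_system I f (insert k C)"
  show "injective_system (I - {i}) (\<lambda>j c. f i k * f j c - f j k * f i c) C"
    unfolding injective_system_def
  proof (intro allI impI)
    fix x
    assume x: "\<forall>j\<in>I - {i}. (\<Sum>c\<in>C. (f i k * f j c - f j k * f i c) * x c) = 0"
    define y where "y = x(k := - (\<Sum>c\<in>C. f i c * x c) / f i k)"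
    have yC: "(\<Sum>c\<in>C. g c * y c) = (\<Sum>c\<in>C. g c * x c)" for g
      using assms(2) by (intro sum.cong) (auto simp: y_def)
    have "(\<Sum>c\<in>insert k C. f j c * y c) = 0" if "j \<in> I" for j
    proof -
      have "f i k * (\<Sum>c\<in>insert k C. f j c * y c)
          = f i k * (\<Sum>c\<in>C. f j c * x c) - f j k * (\<Sum>c\<in>C. f i c * x c)"
        using assms by (simp add: yC) (simp add: y_def field_simps)
      also have "\<dots> = (\<Sum>c\<in>C. (f i k * f j c - f j k * f i c) * x c)"
        by (simp add: sum_distrib_left sum_subtractf algebra_simps)
      also have "\<dots> = 0" using x that by (cases "j = i") simp_all
      finally show ?thesis using piv by simp
    qed
    then have "\<forall>c\<in>insert k C. y c = 0" using L unfolding injective_system_def by blast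
    then show "\<forall>c\<in>C. x c = 0" using assms(2) by (auto simp: y_def split: if_splits)
  qed
next
  assume R: "injective_system (I - {i}) (\<lambda>j c. f i k * f j c - f j k * f i c) C"
  show "injective_system I f (insert k C)"
    unfolding injective_system_def
  proof (intro allI impI)
    fix x
    assume x: "\<forall>j\<in>I. (\<Sum>c\<in>insert k C. f j c * x c) = 0"
    have xj: "(\<Sum>c\<in>C. f j c * x c) = - f j k * x k" if "j \<in> I" for j
    proof -
      have "f j k * x k + (\<Sum>c\<in>C. f j c * x c) = 0" using x that assms(1,2) by simp
      then show ?thesis by (simp add: add_eq_0_iff)
    qed
    have "(\<Sum>c\<in>C. (f i k * f j c - f j k * f i c) * x c) = 0" if "j \<in> I - {i}" for j
    proof -
      have "(\<Sum>c\<in>C. (f i k * f j c - f j k * f i c) * x c)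
          = f i k * (\<Sum>c\<in>C. f j c * x c) - f j k * (\<Sum>c\<in>C. f i c * x c)"
        by (simp add: sum_distrib_left sum_subtractf algebra_simps)
      then show ?thesis using xj[of j] xj[of i] that assms(3) by simp
    qed
    then have z: "\<forall>c\<in>C. x c = 0" using R unfolding injective_system_def by blast
    then show "\<forall>c\<in>insert k C. x c = 0"
      using xj[OF assms(3)] piv by auto
  qed
qed

lemma injective_system_pivot:
  fixes f :: "'i \<Rightarrow> 'c \<Rightarrow> 'a::comm_ring_1"
  assumes "finite C" "k \<notin> C" "injective_system I f (insert k C)"
  obtains i where "i \<in> I" "f i k \<noteq> 0"
proof -
  have "\<exists>i\<in>I. f i k \<noteq> 0"
  proof (rule ccontr)
    assume *: "\<not> (\<exists>i\<in>I. f i k \<noteq> 0)"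
    define x :: "'c \<Rightarrow> 'a" where "x = (\<lambda>c. if c = k then 1 else 0)"
    have "\<forall>i\<in>I. (\<Sum>c\<in>insert k C. f i c * x c) = 0"
      using * by (intro ballI sum.neutral) (auto simp: x_def)
    then have "x k = 0"
      using assms(3) unfolding injective_system_def by simp
    then show False by (simp add: x_def)
  qed
  then show thesis using that by blast
qed

text \<open>Each elimination step uses up one unknown and one equation.\<close>

lemma injective_system_card_le:
  fixes f :: "'i \<Rightarrow> 'c \<Rightarrow> 'a::field"
  assumes "finite C" "finite I" "injective_system I f C"
  shows "card C \<le> card I"
  using assms
proof (induction C arbitrary: I f rule: finite_induct)
  case (insert k C)
  obtain i where i: "i \<in> I" "f i k \<noteq> 0"
    by (rule injective_system_pivot[of C k I f, OF insert.hyps insert.prems(2)])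
  have "injective_system (I - {i}) (\<lambda>j c. f i k * f j c - f j k * f i c) C"
    using injective_system_eliminate[of C k i I f] insert.hyps i insert.prems(2) by simp
  then have "card C \<le> card (I - {i})"
    using insert.IH[of "I - {i}" "\<lambda>j c. f i k * f j c - f j k * f i c"] insert.prems(1) by simp
  moreover have "card I = Suc (card (I - {i}))" using i(1) insert.prems(1) by (intro card.remove)
  ultimately show ?case using insert.hyps by simp
qed simp

text \<open>Takes the place of a nonvanishing maximal minor: a pivot that is nonzero at
  \<open>s\<close> is a nonzero polynomial, and away from its finitely many roots the same
  elimination step is valid for every \<open>t\<close>.\<close>

lemma injective_system_cofinite:
  fixes f :: "'i \<Rightarrow> 'c \<Rightarrow> 'a::{field} poly"
  assumes "finite C" "injective_system I (\<lambda>i c. poly (f i c) s) C"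
  shows "finite {t. \<not> injective_system I (\<lambda>i c. poly (f i c) t) C}"
  using assms
proof (induction C arbitrary: I f rule: finite_induct)
  case (insert k C)
  obtain i where i: "i \<in> I" "poly (f i k) s \<noteq> 0"
    by (rule injective_system_pivot[of C k I "\<lambda>i c. poly (f i c) s", OF insert.hyps insert.prems(1)])
  let ?g = "\<lambda>j c. f i k * f j c - f j k * f i c"
  have iff: "injective_system I (\<lambda>i c. poly (f i c) t) (insert k C)
      \<longleftrightarrow> injective_system (I - {i}) (\<lambda>j c. poly (?g j c) t) C" if "poly (f i k) t \<noteq> 0" for t
    using injective_system_eliminate[of C k i I "\<lambda>i c. poly (f i c) t"] insert.hyps i(1) that by simp
  have "injective_system (I - {i}) (\<lambda>j c. poly (?g j c) s) C"
    using iff[OF i(2)] insert.prems by simp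
  then have "finite {t. \<not> injective_system (I - {i}) (\<lambda>j c. poly (?g j c) t) C}"
    by (rule insert.IH[of "I - {i}" ?g])
  moreover have "finite {t. poly (f i k) t = 0}"
    using i(2) by (intro poly_roots_finite) auto
  ultimately have "finite ({t. \<not> injective_system (I - {i}) (\<lambda>j c. poly (?g j c) t) C}
      \<union> {t. poly (f i k) t = 0})" by (rule finite_UnI)
  then show ?case
    by (rule rev_finite_subset) (auto simp: iff)
qed (simp add: injective_system_def)

section \<open>Hyperconnectivity\<close>

text \<open>For \<open>x = y\<close> the equation is void, so singletons in \<open>E\<close> do no
  harm; later \<open>E\<close> is the whole complex \<Delta>, whose faces of size two are the
  graph.\<close>

definition motion :: "('v \<Rightarrow> real^3) \<Rightarrow> 'v set set \<Rightarrow> 'v set \<Rightarrow> ('v \<Rightarrow> real^3) \<Rightarrow> bool" where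
  "motion p E X m \<longleftrightarrow> (\<forall>x\<in>X. \<forall>y\<in>X. {x, y} \<in> E \<longrightarrow> m x \<bullet> p y = m y \<bullet> p x)"

definition rigid_at :: "'v set set \<Rightarrow> 'v set \<Rightarrow> ('v \<Rightarrow> real^3) \<Rightarrow> bool" where
  "rigid_at E X p \<longleftrightarrow>
     (\<forall>m. motion p E X m \<longrightarrow> (\<exists>A. transpose A = A \<and> (\<forall>x\<in>X. m x = A *v p x)))"

text \<open>The vectors at the three vertices \<open>g i\<close> form a basis, stated through
  orthogonality so that it is the injectivity of a linear system.\<close>

definition frame :: "(3 \<Rightarrow> 'v) \<Rightarrow> ('v \<Rightarrow> real^3) \<Rightarrow> bool" where
  "frame g p \<longleftrightarrow> (\<forall>w. (\<forall>i. p (g i) \<bullet> w = 0) \<longrightarrow> w = 0)"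

definition rigid :: "'v set set \<Rightarrow> 'v set \<Rightarrow> bool" where
  "rigid E X \<longleftrightarrow> (\<exists>p g. range g \<subseteq> X \<and> frame g p \<and> rigid_at E X p)"

text \<open>The six pinning conditions kill every \<open>A p\<close> with \<open>A\<close> symmetric.\<close>

definition pinned :: "('v \<Rightarrow> real^3) \<Rightarrow> 'v set set \<Rightarrow> 'v set \<Rightarrow> (3 \<Rightarrow> 'v) \<Rightarrow> ('v \<Rightarrow> real^3) \<Rightarrow> bool" where
  "pinned p E X g m \<longleftrightarrow> motion p E X m \<and> (\<forall>i j. m (g i) \<bullet> p (g j) + m (g j) \<bullet> p (g i) = 0)"

lemma inner_sym_mult:
  fixes A :: "real^'n^'n"
  assumes "transpose A = A"
  shows "(A *v x) \<bullet> y = (A *v y) \<bullet> x"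
  using dot_lmul_matrix[of x A y] transpose_matrix_vector[of A x] assms by (simp add: inner_commute)

lemma frame_eqI:
  assumes "frame g p" "\<And>i. p (g i) \<bullet> x = p (g i) \<bullet> y"
  shows "x = y"
proof -
  have "\<forall>i. p (g i) \<bullet> (x - y) = 0" using assms(2) by (simp add: inner_diff_right)
  then have "x - y = 0" using assms(1) unfolding frame_def by blast
  then show ?thesis by simp
qed

lemma frame_matrix_inverse:
  assumes "frame g p"
  obtains B :: "real^3^3" where "(\<chi> i. p (g i)) ** B = mat 1"
proof -
  let ?P = "\<chi> i. p (g i)"
  have "\<forall>w. ?P *v w = 0 \<longrightarrow> w = 0"
    using assms unfolding frame_def
    by (metis (no_types, lifting) matrix_vector_mul_component vec_lambda_beta zero_index)
  then obtain B where "B ** ?P = mat 1"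
    using matrix_left_invertible_ker[of ?P] by blast
  then show thesis using that matrix_left_right_inverse by blast
qed

text \<open>A symmetric bilinear form can be prescribed freely on a basis: with \<open>P\<close> the
  matrix whose rows are the \<open>p (g i)\<close> and \<open>B\<close> its inverse, congruence by
  \<open>B\<close> solves for \<open>A\<close>.\<close>

lemma frame_symmetric_form:
  assumes "frame g p" and "\<And>i j. s i j = s j i"
  obtains A :: "real^3^3" where "transpose A = A" "\<And>i j. (A *v p (g i)) \<bullet> p (g j) = s i j"
proof -
  let ?P = "\<chi> i. p (g i)"
  obtain B :: "real^3^3" where B: "?P ** B = mat 1" using frame_matrix_inverse[OF assms(1)] .
  define S :: "real^3^3" where "S = (\<chi> i j. s i j)"
  have S: "transpose S = S" by (simp add: S_def transpose_def vec_eq_iff assms(2))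
  define A where "A = B ** S ** transpose B"
  have sym: "transpose A = A"
    by (simp add: A_def matrix_transpose_mul S matrix_mul_assoc)
  have PAP: "?P ** A ** transpose ?P = S"
  proof -
    have "?P ** A ** transpose ?P = (?P ** B) ** S ** transpose (?P ** B)"
      by (simp add: A_def matrix_transpose_mul matrix_mul_assoc)
    then show ?thesis by (simp add: B)
  qed
  have "(A *v p (g i)) \<bullet> p (g j) = s i j" for i j
  proof -
    have "(A *v p (g i)) \<bullet> p (g j) = (?P ** A ** transpose ?P) $ j $ i"
      by (simp add: matrix_mul_assoc[symmetric])
        (simp add: matrix_matrix_mult_def matrix_vector_mult_def transpose_def inner_vec_def mult.commute)
    then show ?thesis unfolding PAP by (simp add: S_def assms(2))
  qed
  then show thesis using that sym by blast
qed

text \<open>Turns triviality modulo the maps \<open>A p\<close> into triviality of a kernel, to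
  which linear systems apply. The symmetric part of the form
  \<open>m (g i) \<bullet> p (g j)\<close> comes from a symmetric \<open>A\<close>, and subtracting
  \<open>A p\<close> pins the motion.\<close>

lemma rigid_at_iff_pinned:
  assumes "range g \<subseteq> X" "frame g p"
  shows "rigid_at E X p \<longleftrightarrow> (\<forall>m. pinned p E X g m \<longrightarrow> (\<forall>x\<in>X. m x = 0))"
proof (intro iffI allI impI)
  fix m assume rig: "rigid_at E X p" and pin: "pinned p E X g m"
  obtain A where A: "transpose A = A" "\<forall>x\<in>X. m x = A *v p x"
    using rig pin unfolding rigid_at_def pinned_def by blast
  have "p (g i) \<bullet> (A *v p (g j)) = 0" for i j
  proof -
    have "m (g i) \<bullet> p (g j) + m (g j) \<bullet> p (g i) = 0" using pin by (simp add: pinned_def)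
    then show ?thesis
      using A(2) assms(1) inner_sym_mult[OF A(1), of "p (g i)" "p (g j)"]
      by (simp add: inner_commute image_subset_iff)
  qed
  then have zero: "A *v p (g j) = 0" for j
    using assms(2) unfolding frame_def by blast
  have "A *v x = 0" for x
  proof (rule frame_eqI[OF assms(2)])
    show "p (g i) \<bullet> (A *v x) = p (g i) \<bullet> 0" for i
      using inner_sym_mult[OF A(1), of "p (g i)" x] zero by (simp add: inner_commute)
  qed
  with A show "\<forall>x\<in>X. m x = 0" by simp
next
  assume pin: "\<forall>m. pinned p E X g m \<longrightarrow> (\<forall>x\<in>X. m x = 0)"
  show "rigid_at E X p"
    unfolding rigid_at_def
  proof (intro allI impI)
    fix m assume m: "motion p E X m"
    obtain A where A: "transpose A = A"
      "\<And>i j. (A *v p (g i)) \<bullet> p (g j) = (m (g i) \<bullet> p (g j) + m (g j) \<bullet> p (g i)) / 2"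
      using frame_symmetric_form[OF assms(2), of "\<lambda>i j. (m (g i) \<bullet> p (g j) + m (g j) \<bullet> p (g i)) / 2"]
      by (auto simp: add.commute)
    have "pinned p E X g (\<lambda>x. m x - A *v p x)"
      unfolding pinned_def motion_def
    proof (intro conjI ballI impI allI)
      fix x y assume "x \<in> X" "y \<in> X" "{x, y} \<in> E"
      then have "m x \<bullet> p y = m y \<bullet> p x" using m unfolding motion_def by blast
      then show "(m x - A *v p x) \<bullet> p y = (m y - A *v p y) \<bullet> p x"
        using inner_sym_mult[OF A(1), of "p x" "p y"] by (simp add: inner_diff_left)
    qed (simp add: A(2) inner_diff_left field_simps)
    then have "\<forall>x\<in>X. m x = A *v p x" using pin by fastforce
    with A show "\<exists>A. transpose A = A \<and> (\<forall>x\<in>X. m x = A *v p x)" by blast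
  qed
qed

text \<open>Openness is tested on lines only, so that polynomials in one variable suffice.\<close>

definition zariski_open :: "(('v \<Rightarrow> real^3) \<Rightarrow> bool) \<Rightarrow> bool" where
  "zariski_open U \<longleftrightarrow> (\<forall>p q. U p \<longrightarrow> finite {t. \<not> U (\<lambda>x. p x + t *\<^sub>R (q x - p x))})"

lemma zariski_open_conj:
  assumes "zariski_open U" "zariski_open W"
  shows "zariski_open (\<lambda>p. U p \<and> W p)"
  unfolding zariski_open_def
proof (intro allI impI)
  fix p q assume "U p \<and> W p"
  then have "finite ({t. \<not> U (\<lambda>x. p x + t *\<^sub>R (q x - p x))} \<union> {t. \<not> W (\<lambda>x. p x + t *\<^sub>R (q x - p x))})"
    using assms unfolding zariski_open_def by simp
  then show "finite {t. \<not> (U (\<lambda>x. p x + t *\<^sub>R (q x - p x)) \<and> W (\<lambda>x. p x + t *\<^sub>R (q x - p x)))}"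
    by (rule rev_finite_subset) auto
qed

text \<open>Each condition fails at finitely many parameters on the line through \<open>p\<close>
  and \<open>q\<close>, so some point satisfies both; the second condition sees the line run
  backwards, hence \<open>1 - t\<close>.\<close>

lemma zariski_open_meet:
  assumes "zariski_open U" "zariski_open W" "U p" "W q"
  obtains r where "U r" "W r"
proof -
  let ?A = "{t. \<not> U (\<lambda>x. p x + t *\<^sub>R (q x - p x))}"
  let ?B = "{t. \<not> W (\<lambda>x. q x + t *\<^sub>R (p x - q x))}"
  have "finite (?A \<union> (\<lambda>t. 1 - t) ` ?B)"
    using assms unfolding zariski_open_def by simp
  then obtain t where t: "t \<notin> ?A \<union> (\<lambda>t. 1 - t) ` ?B"
    using ex_new_if_finite[OF infinite_UNIV_char_0] by blast
  then have "1 - t \<notin> ?B" by (metis (no_types, lifting) UnI2 diff_diff_eq2 add_diff_cancel_left' image_eqI)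
  then have "W (\<lambda>x. q x + (1 - t) *\<^sub>R (p x - q x))" by simp
  moreover have "(\<lambda>x. q x + (1 - t) *\<^sub>R (p x - q x)) = (\<lambda>x. p x + t *\<^sub>R (q x - p x))"
    by (simp add: fun_eq_iff algebra_simps)
  ultimately show thesis using t that by auto
qed

section \<open>Rigid placements form an open set\<close>

lemma frame_iff_injective_system:
  "frame g p \<longleftrightarrow> injective_system UNIV (\<lambda>i c. p (g i) $ c) UNIV"
proof -
  have "frame g p \<longleftrightarrow> (\<forall>x. (\<forall>i. p (g i) \<bullet> (\<chi> c. x c) = 0) \<longrightarrow> (\<chi> c. x c) = (0::real^3))"
    unfolding frame_def by (metis vec_nth_inverse)
  then show ?thesis
    by (simp add: injective_system_def inner_vec_def vec_eq_iff)
qed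

lemma zariski_open_frame: "zariski_open (frame g)"
  unfolding zariski_open_def
proof (intro allI impI)
  fix p q :: "'a \<Rightarrow> real^3" assume "frame g p"
  then have "injective_system UNIV (\<lambda>i c. poly [:p (g i) $ c, (q (g i) - p (g i)) $ c:] 0) UNIV"
    by (simp add: frame_iff_injective_system)
  then have "finite {t. \<not> injective_system UNIV (\<lambda>i c. poly [:p (g i) $ c, (q (g i) - p (g i)) $ c:] t) UNIV}"
    by (intro injective_system_cofinite[of _ _ _ 0]) auto
  then show "finite {t. \<not> frame g (\<lambda>x. p x + t *\<^sub>R (q x - p x))}"
    by (simp add: frame_iff_injective_system)
qed

text \<open>Coefficient rows of the pinned system in the unknowns \<open>(w, k)\<close>, coordinate
  \<open>k\<close> of the motion at \<open>w\<close>: \<open>Inl\<close> for edge equations,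
  \<open>Inr\<close> for pinning conditions. Sums of conditionals let coinciding vertices contribute
  twice. The entries lie in any commutative ring, so the rows serve both for one placement and, with
  polynomials, for a line of placements.\<close>

fun pin_row :: "('v \<Rightarrow> 3 \<Rightarrow> 'a) \<Rightarrow> (3 \<Rightarrow> 'v) \<Rightarrow> 'v \<times> 'v + 3 \<times> 3 \<Rightarrow> 'v \<times> 3 \<Rightarrow> 'a::comm_ring_1" where
  "pin_row P g (Inl (x, y)) (w, k) = (if w = x then P y k else 0) - (if w = y then P x k else 0)"
| "pin_row P g (Inr (i, j)) (w, k) = (if w = g i then P (g j) k else 0) + (if w = g j then P (g i) k else 0)"

lemma poly_pin_row: "poly (pin_row P g r c) t = pin_row (\<lambda>v k. poly (P v k) t) g r c"
  by (cases "(P, g, r, c)" rule: pin_row.cases) auto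

text \<open>\<open>D\<close> and \<open>K\<close> are left free because the two uses differ:
  openness takes every ordered edge and every pin, while the edge count takes one orientation per
  edge and one pin per unordered pair.\<close>

lemma pin_row_injective_iff:
  fixes p :: "'v \<Rightarrow> real^3"
  assumes "finite X" "D \<subseteq> X \<times> X" "range g \<subseteq> X"
  shows "injective_system (Inl ` D \<union> Inr ` K) (pin_row (\<lambda>v k. p v $ k) g) (X \<times> UNIV) \<longleftrightarrow>
    (\<forall>m. (\<forall>(x, y)\<in>D. m x \<bullet> p y = m y \<bullet> p x) \<and>
         (\<forall>(i, j)\<in>K. m (g i) \<bullet> p (g j) + m (g j) \<bullet> p (g i) = 0) \<longrightarrow> (\<forall>x\<in>X. m x = 0))"
proof -
  have single: "(\<Sum>c\<in>X \<times> UNIV. (if fst c = x then p y $ snd c else 0) * m (fst c) $ snd c) = m x \<bullet> p y"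
    if "x \<in> X" for x y and m :: "'v \<Rightarrow> real^3"
  proof -
    have "(\<Sum>c\<in>X \<times> UNIV. (if fst c = x then p y $ snd c else 0) * m (fst c) $ snd c)
        = (\<Sum>w\<in>X. if w = x then m w \<bullet> p y else 0)"
      by (subst sum.cartesian_product')
        (auto simp: inner_vec_def mult.commute intro!: sum.cong)
    then show ?thesis using that assms(1) by simp
  qed
  have rowl: "(\<Sum>c\<in>X \<times> UNIV. pin_row (\<lambda>v k. p v $ k) g (Inl (x, y)) c * m (fst c) $ snd c)
      = m x \<bullet> p y - m y \<bullet> p x" if "x \<in> X" "y \<in> X" for x y m
  proof -
    have "pin_row (\<lambda>v k. p v $ k) g (Inl (x, y)) c
        = (if fst c = x then p y $ snd c else 0) - (if fst c = y then p x $ snd c else 0)" for c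
      by (cases c) simp
    then show ?thesis
      using single[OF that(1)] single[OF that(2)] by (simp only: left_diff_distrib sum_subtractf)
  qed
  have rowr: "(\<Sum>c\<in>X \<times> UNIV. pin_row (\<lambda>v k. p v $ k) g (Inr (i, j)) c * m (fst c) $ snd c)
      = m (g i) \<bullet> p (g j) + m (g j) \<bullet> p (g i)" for i j m
  proof -
    have *: "pin_row (\<lambda>v k. p v $ k) g (Inr (i, j)) c
        = (if fst c = g i then p (g j) $ snd c else 0) + (if fst c = g j then p (g i) $ snd c else 0)" for c
      by (cases c) simp
    have "g i \<in> X" "g j \<in> X" using assms(3) by auto
    then show ?thesis
      unfolding * using single by (simp only: distrib_right sum.distrib)
  qed
  have all: "(\<forall>x. Q x) \<longleftrightarrow> (\<forall>m. Q (\<lambda>c. m (fst c) $ snd c))" for Q :: "('v \<times> 3 \<Rightarrow> real) \<Rightarrow> bool"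
  proof (intro iffI allI)
    fix x assume "\<forall>m. Q (\<lambda>c. m (fst c) $ snd c)"
    then have "Q (\<lambda>c. (\<lambda>v. \<chi> k. x (v, k)) (fst c) $ snd c)" by (rule spec)
    then show "Q x" by simp
  qed simp
  have "(\<forall>i\<in>Inl ` D \<union> Inr ` K. (\<Sum>c\<in>X \<times> UNIV. pin_row (\<lambda>v k. p v $ k) g i c * m (fst c) $ snd c) = 0)
     \<longleftrightarrow> (\<forall>(x, y)\<in>D. m x \<bullet> p y = m y \<bullet> p x) \<and>
         (\<forall>(i, j)\<in>K. m (g i) \<bullet> p (g j) + m (g j) \<bullet> p (g i) = 0)" for m
    using assms(2) by (fastforce simp: ball_Un rowl rowr)
  moreover have "(\<forall>c\<in>X \<times> UNIV. m (fst c) $ snd c = 0) \<longleftrightarrow> (\<forall>x\<in>X. m x = 0)" for m :: "'v \<Rightarrow> real^3"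
    by (auto simp: vec_eq_iff)
  ultimately show ?thesis
    unfolding injective_system_def by (subst all) simp
qed

text \<open>The frame condition belongs to the open set because only there is rigidity the
  injectivity of the pinned system. The rows of that system are linear in \<open>p\<close>, so along
  a line they are polynomials of degree at most one.\<close>

lemma zariski_open_rigid_at:
  assumes "finite X" "range g \<subseteq> X"
  shows "zariski_open (\<lambda>p. frame g p \<and> rigid_at E X p)"
proof -
  define D where "D = {(x, y). x \<in> X \<and> y \<in> X \<and> {x, y} \<in> E}"
  define J where "J p = injective_system (Inl ` D \<union> Inr ` UNIV) (pin_row (\<lambda>v k. p v $ k) g) (X \<times> UNIV)"
    for p :: "'a \<Rightarrow> real^3"
  have "D \<subseteq> X \<times> X" by (auto simp: D_def)
  then have iff: "J p \<longleftrightarrow> rigid_at E X p" if "frame g p" for p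
    unfolding J_def rigid_at_iff_pinned[OF assms(2) that] pinned_def motion_def
    by (subst pin_row_injective_iff[OF assms(1) _ assms(2)]) (auto simp: D_def)
  have "zariski_open J"
    unfolding zariski_open_def
  proof (intro allI impI)
    fix p q :: "'a \<Rightarrow> real^3" assume "J p"
    define P where "P = (\<lambda>v k. [:p v $ k, (q v - p v) $ k:])"
    have "injective_system (Inl ` D \<union> Inr ` UNIV) (\<lambda>r c. poly (pin_row P g r c) 0) (X \<times> UNIV)"
      using \<open>J p\<close> by (simp add: J_def poly_pin_row P_def)
    then have "finite {t. \<not> injective_system (Inl ` D \<union> Inr ` UNIV) (\<lambda>r c. poly (pin_row P g r c) t) (X \<times> UNIV)}"
      using assms(1) by (intro injective_system_cofinite[of _ _ _ 0]) auto
    then show "finite {t. \<not> J (\<lambda>x. p x + t *\<^sub>R (q x - p x))}"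
      by (simp add: J_def poly_pin_row P_def)
  qed
  then have "zariski_open (\<lambda>p. frame g p \<and> J p)"
    by (rule zariski_open_conj[OF zariski_open_frame])
  moreover have "(\<lambda>p. frame g p \<and> J p) = (\<lambda>p. frame g p \<and> rigid_at E X p)"
    using iff by (auto simp: fun_eq_iff)
  ultimately show ?thesis by simp
qed

lemma frame_exists:
  assumes "inj g"
  obtains p where "frame g p"
proof
  show "frame g (\<lambda>x. axis (inv_into UNIV g x) 1)"
    using assms by (auto simp: frame_def vec_eq_iff inner_axis')
qed

text \<open>The placement hidden in \<open>rigid\<close> may be degenerate on vertices that matter
  later; moving it along a line towards \<open>q\<close> repairs this.\<close>

lemma rigid_generic:
  assumes "finite X" "rigid E X" "zariski_open U" "U q"
  obtains p g where "range g \<subseteq> X" "frame g p" "rigid_at E X p" "U p"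
proof -
  obtain p0 g where g: "range g \<subseteq> X" "frame g p0" "rigid_at E X p0"
    using assms(2) unfolding rigid_def by blast
  obtain r where "frame g r \<and> rigid_at E X r" "U r"
    using zariski_open_meet[OF zariski_open_rigid_at[OF assms(1) g(1), of E] assms(3), of p0 q] g assms(4) by blast
  then show thesis using that g(1) by blast
qed

lemma obtain_inj_3:
  assumes "card Y \<ge> 3"
  obtains g :: "3 \<Rightarrow> 'v" where "inj g" "range g \<subseteq> Y"
proof -
  have "finite Y" using assms by (metis card.infinite not_numeral_le_zero)
  then show thesis
    using card_le_inj[of "UNIV :: 3 set" Y] assms that by auto
qed

section \<open>Gluing, complete graphs, vertex splits and the edge count\<close>

text \<open>One placement is made rigid for both graphs and spanning on three common vertices; the
  two symmetric matrices then agree on a basis, hence everywhere.\<close>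

lemma rigid_Un:
  assumes "finite X" "finite Y" "rigid E X" "rigid E Y" "card (X \<inter> Y) \<ge> 3"
  shows "rigid E (X \<union> Y)"
proof -
  obtain g :: "3 \<Rightarrow> 'a" where g: "inj g" "range g \<subseteq> X \<inter> Y" using obtain_inj_3[OF assms(5)] .
  obtain q0 where "frame g q0" using frame_exists[OF g(1)] .
  obtain p1 g1 where p1: "range g1 \<subseteq> X" "frame g1 p1" "rigid_at E X p1" "frame g p1"
    using rigid_generic[OF assms(1,3) zariski_open_frame \<open>frame g q0\<close>] .
  have gX: "range g \<subseteq> X" "range g \<subseteq> Y" using g by auto
  have "frame g p1 \<and> rigid_at E X p1" using p1 by blast
  then obtain p g2 where "range g2 \<subseteq> Y" "frame g2 p" "rigid_at E Y p" "frame g p \<and> rigid_at E X p"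
    by (rule rigid_generic[OF assms(2,4) zariski_open_rigid_at[OF assms(1) gX(1), of E]])
  then have p: "frame g p" "rigid_at E X p" "rigid_at E Y p" by blast+
  have "rigid_at E (X \<union> Y) p"
    unfolding rigid_at_def
  proof (intro allI impI)
    fix m assume "motion p E (X \<union> Y) m"
    then have "motion p E X m" "motion p E Y m" unfolding motion_def by blast+
    moreover from this obtain A where A: "transpose A = A" "\<forall>x\<in>X. m x = A *v p x"
      using p(2) unfolding rigid_at_def by blast
    ultimately obtain B where B: "transpose B = B" "\<forall>x\<in>Y. m x = B *v p x"
      using p(3) unfolding rigid_at_def by blast
    have eq: "A *v p (g i) = B *v p (g i)" for i
      using A(2) B(2) gX by (metis rangeI subsetD)
    have "A *v x = B *v x" for x
    proof (rule frame_eqI[OF p(1)])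
      show "p (g i) \<bullet> (A *v x) = p (g i) \<bullet> (B *v x)" for i
        using inner_sym_mult[OF A(1), of "p (g i)" x] inner_sym_mult[OF B(1), of "p (g i)" x] eq
        by (simp add: inner_commute)
    qed
    with A B show "\<exists>A. transpose A = A \<and> (\<forall>x\<in>X \<union> Y. m x = A *v p x)" by auto
  qed
  then show ?thesis unfolding rigid_def using p(1) gX by blast
qed

text \<open>The edges within the frame make \<open>m (g i) \<bullet> p (g j)\<close> a symmetric
  form, which yields \<open>A\<close>; the edges from any vertex to the frame determine its
  vector.\<close>

lemma rigid_complete:
  assumes "finite X" "card X \<ge> 3" "\<And>x y. x \<in> X \<Longrightarrow> y \<in> X \<Longrightarrow> x \<noteq> y \<Longrightarrow> {x, y} \<in> E"
  shows "rigid E X"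
proof -
  obtain g :: "3 \<Rightarrow> 'a" where g: "inj g" "range g \<subseteq> X" using obtain_inj_3[OF assms(2)] .
  obtain p where p: "frame g p" using frame_exists[OF g(1)] .
  have "rigid_at E X p"
    unfolding rigid_at_def
  proof (intro allI impI)
    fix m assume m: "motion p E X m"
    have sym: "m x \<bullet> p y = m y \<bullet> p x" if "x \<in> X" "y \<in> X" for x y
      using m assms(3) that unfolding motion_def by (cases "x = y") auto
    have "m (g i) \<bullet> p (g j) = m (g j) \<bullet> p (g i)" for i j using sym g(2) by blast
    then obtain A where A: "transpose A = A" "\<And>i j. (A *v p (g i)) \<bullet> p (g j) = m (g i) \<bullet> p (g j)"
      using frame_symmetric_form[OF p, of "\<lambda>i j. m (g i) \<bullet> p (g j)"] by metis
    have mg: "m (g i) = A *v p (g i)" for i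
    proof (rule frame_eqI[OF p])
      show "p (g j) \<bullet> m (g i) = p (g j) \<bullet> (A *v p (g i))" for j
        using A(2)[of i j] by (simp add: inner_commute)
    qed
    have "m x = A *v p x" if "x \<in> X" for x
    proof (rule frame_eqI[OF p])
      fix i
      have "g i \<in> X" using g(2) by blast
      then show "p (g i) \<bullet> m x = p (g i) \<bullet> (A *v p x)"
        using sym[OF that] inner_sym_mult[OF A(1), of "p (g i)" "p x"] mg[of i]
        by (simp add: inner_commute)
    qed
    with A(1) show "\<exists>A. transpose A = A \<and> (\<forall>x\<in>X. m x = A *v p x)" by blast
  qed
  then show ?thesis unfolding rigid_def using p g(2) by blast
qed

text \<open>The edges among \<open>u\<close>, \<open>v\<close> and from both to \<open>a\<close> and
  \<open>b\<close> make \<open>m u - m v\<close> orthogonal to a basis. Once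
  \<open>m u = m v\<close>, an edge at \<open>v\<close> gives the same equation as the edge of
  \<open>E\<close> at \<open>u\<close> that it replaces.\<close>

lemma rigid_vertex_split:
  assumes "finite X" "rigid E X" "u \<in> X" "v \<notin> X" "a \<in> X" "b \<in> X" "distinct [u, a, b]"
    and uv: "{u, v} \<in> E'" "{u, a} \<in> E'" "{v, a} \<in> E'" "{u, b} \<in> E'" "{v, b} \<in> E'"
    and away: "\<And>x y. x \<in> X - {u} \<Longrightarrow> y \<in> X - {u} \<Longrightarrow> {x, y} \<in> E \<Longrightarrow> {x, y} \<in> E'"
    and at_u: "\<And>x. x \<in> X - {u} \<Longrightarrow> {u, x} \<in> E \<Longrightarrow> {u, x} \<in> E' \<or> {v, x} \<in> E'"
  shows "rigid E' (insert v X)"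
proof -
  define h :: "3 \<Rightarrow> 'a" where "h i = (if i = 1 then u else if i = 2 then a else b)" for i
  have "inj h" using assms(7) by (auto simp: inj_def h_def forall_3 split: if_splits)
  then obtain q0 where "frame h q0" using frame_exists by blast
  then obtain p g where p: "range g \<subseteq> X" "frame g p" "rigid_at E X p" "frame h p"
    using rigid_generic[OF assms(1,2) zariski_open_frame] by metis
  define p' where "p' = p(v := p u)"
  have p': "p' x = p x" if "x \<in> X" for x using that assms(4) by (auto simp: p'_def)
  have "p' (g i) = p (g i)" for i using p(1) by (intro p') auto
  then have frame': "frame g p'" using p(2) by (simp add: frame_def)
  have "rigid_at E' (insert v X) p'"
    unfolding rigid_at_def
  proof (intro allI impI)
    fix m assume m: "motion p' E' (insert v X) m"
    have edge: "m x \<bullet> p' y = m y \<bullet> p' x" if "{x, y} \<in> E'" "x \<in> insert v X" "y \<in> insert v X" for x y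
      using m that unfolding motion_def by blast
    have v: "p' v = p u" by (simp add: p'_def)
    have "(m u - m v) \<bullet> p (h i) = 0" for i
      using edge[of u v] edge[of u a] edge[of v a] edge[of u b] edge[of v b] uv assms(3,5,6) v
      by (auto simp: h_def p' inner_diff_left)
    then have "m u = m v"
      using p(4) unfolding frame_def by (metis eq_iff_diff_eq_0 inner_commute)
    have "motion p E X m"
      unfolding motion_def
    proof (intro ballI impI)
      have *: "m u \<bullet> p x = m x \<bullet> p u" if x: "x \<in> X" "{u, x} \<in> E" for x
      proof (cases "x = u")
        case False
        then consider "{u, x} \<in> E'" | "{v, x} \<in> E'" using at_u x by blast
        then show ?thesis
        proof cases
          case 1 then show ?thesis using edge[of u x] x assms(3) by (simp add: p')
        next
          case 2 then show ?thesis using edge[of v x] x \<open>m u = m v\<close> v by (simp add: p')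
        qed
      qed simp
      fix x y assume xy: "x \<in> X" "y \<in> X" "{x, y} \<in> E"
      consider "x = u" | "y = u" | "x \<noteq> u" "y \<noteq> u" by blast
      then show "m x \<bullet> p y = m y \<bullet> p x"
      proof cases
        case 1 then show ?thesis using * xy by auto
      next
        case 2 then show ?thesis using *[of x] xy by (auto simp: insert_commute)
      next
        case 3 then show ?thesis using away edge[of x y] xy by (simp add: p')
      qed
    qed
    then obtain A where A: "transpose A = A" "\<forall>x\<in>X. m x = A *v p x"
      using p(3) unfolding rigid_at_def by blast
    have "\<forall>x\<in>insert v X. m x = A *v p' x"
      using A(2) \<open>m u = m v\<close> assms(3) v p' by auto
    with A(1) show "\<exists>A. transpose A = A \<and> (\<forall>x\<in>insert v X. m x = A *v p' x)" by blast
  qed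
  then show ?thesis unfolding rigid_def using frame' p(1) by blast
qed
text \<open>The pinned system has \<open>3 * card X\<close> unknowns and at most six equations
  besides those of the edges, and injectivity bounds unknowns by equations.\<close>

lemma rigid_edge_bound:
  assumes "finite X" "rigid E X"
  shows "3 * card X \<le> card {e \<in> E. e \<subseteq> X \<and> card e = 2} + 6"
proof -
  obtain p g where g: "range g \<subseteq> X" "frame g p" "rigid_at E X p"
    using assms(2) unfolding rigid_def by blast
  let ?M = "{e \<in> E. e \<subseteq> X \<and> card e = 2}"
  have fin: "finite ?M" by (rule finite_subset[of _ "Pow X"]) (use assms(1) in auto)
  have "\<exists>c. e = {fst c, snd c}" if "e \<in> ?M" for e
  proof -
    have "card e = 2" using \<open>e \<in> ?M\<close> by blast
    then obtain x y where "e = {x, y}" unfolding card_2_iff by blast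
    then have "e = {fst (x, y), snd (x, y)}" by simp
    then show ?thesis by blast
  qed
  \<comment> \<open>One orientation per edge: the reversed pair gives the same equation and would
    double the count.\<close>
  then obtain orient where o: "\<And>e. e \<in> ?M \<Longrightarrow> e = {fst (orient e), snd (orient e)}" by metis
  \<comment> \<open>The pinning condition is symmetric in \<open>i\<close> and \<open>j\<close>,
    which leaves six of the nine.\<close>
  define K :: "(3 \<times> 3) set" where "K = set [(1,1), (1,2), (1,3), (2,2), (2,3), (3,3)]"
  have "pinned p E X g m"
    if "\<forall>(x, y)\<in>orient ` ?M. m x \<bullet> p y = m y \<bullet> p x" "\<forall>(i, j)\<in>K. m (g i) \<bullet> p (g j) + m (g j) \<bullet> p (g i) = 0" for m
    unfolding pinned_def motion_def
  proof (intro conjI ballI impI allI)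
    fix x y assume xy: "x \<in> X" "y \<in> X" "{x, y} \<in> E"
    show "m x \<bullet> p y = m y \<bullet> p x"
    proof (cases "x = y")
      case False
      then have e: "{x, y} \<in> ?M" using xy by auto
      then have "orient {x, y} = (x, y) \<or> orient {x, y} = (y, x)"
        using o[OF e] by (metis doubleton_eq_iff prod.collapse)
      then show ?thesis using that(1) e by force
    qed simp
  next
    show "m (g i) \<bullet> p (g j) + m (g j) \<bullet> p (g i) = 0" for i j
      using that(2) exhaust_3[of i] exhaust_3[of j] by (auto simp: K_def add.commute)
  qed
  then have "\<forall>m. (\<forall>(x, y)\<in>orient ` ?M. m x \<bullet> p y = m y \<bullet> p x) \<and>
      (\<forall>(i, j)\<in>K. m (g i) \<bullet> p (g j) + m (g j) \<bullet> p (g i) = 0) \<longrightarrow> (\<forall>x\<in>X. m x = 0)"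
    using rigid_at_iff_pinned[OF g(1,2), of E] g(3) by blast
  moreover have "orient ` ?M \<subseteq> X \<times> X"
  proof
    fix c assume "c \<in> orient ` ?M"
    then obtain e where "e \<in> ?M" "c = orient e" by blast
    then show "c \<in> X \<times> X" using o[of e] by (auto simp: mem_Times_iff)
  qed
  ultimately have "injective_system (Inl ` orient ` ?M \<union> Inr ` K) (pin_row (\<lambda>v k. p v $ k) g) (X \<times> UNIV)"
    using pin_row_injective_iff[OF assms(1) _ g(1)] by blast
  then have "card (X \<times> (UNIV :: 3 set)) \<le> card ((Inl ` orient ` ?M \<union> Inr ` K) :: ('a \<times> 'a + 3 \<times> 3) set)"
    using assms(1) fin by (intro injective_system_card_le) (auto simp: K_def)
  also have "\<dots> \<le> card ((Inl ` orient ` ?M) :: ('a \<times> 'a + 3 \<times> 3) set) + card ((Inr ` K) :: ('a \<times> 'a + 3 \<times> 3) set)"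
    by (rule card_Un_le)
  also have "\<dots> \<le> card ?M + card K"
    using fin by (intro add_mono order.trans[OF card_image_le card_image_le] card_image_le) (auto simp: K_def)
  also have "card K \<le> 6"
    unfolding K_def by (rule order.trans[OF card_length]) simp
  finally show ?thesis by (simp add: card_cartesian_product mult.commute)
qed

section \<open>Minimal 2-cycles\<close>

text \<open>The condition \<open>z x x w = 0\<close> is not automatic in characteristic 2.\<close>

definition alternating :: "('v \<Rightarrow> 'v \<Rightarrow> 'v \<Rightarrow> 'k::comm_ring_1) \<Rightarrow> bool" where
  "alternating z \<longleftrightarrow> (\<forall>x y w. z y x w = - z x y w) \<and> (\<forall>x y w. z x w y = - z x y w) \<and> (\<forall>x w. z x x w = 0)"

definition supp :: "('v \<Rightarrow> 'v \<Rightarrow> 'v \<Rightarrow> 'k::zero) \<Rightarrow> ('v \<times> 'v \<times> 'v) set" where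
  "supp z = {(x, y, w). z x y w \<noteq> 0}"

text \<open>A cycle in the full simplex on \<open>V\<close>. Which triangles belong to a complex is
  tracked through supports alone, so that contraction may leave the complex it started in.\<close>

definition cycle :: "'v set \<Rightarrow> ('v \<Rightarrow> 'v \<Rightarrow> 'v \<Rightarrow> 'k::comm_ring_1) \<Rightarrow> bool" where
  "cycle V z \<longleftrightarrow> alternating z \<and> supp z \<subseteq> V \<times> V \<times> V \<and> (\<forall>y w. (\<Sum>x\<in>V. z x y w) = 0)"

definition minimal_cycle :: "'v set \<Rightarrow> ('v \<Rightarrow> 'v \<Rightarrow> 'v \<Rightarrow> 'k::comm_ring_1) \<Rightarrow> bool" where
  "minimal_cycle V z \<longleftrightarrow> cycle V z \<and> supp z \<noteq> {} \<and>
     (\<forall>y :: 'v \<Rightarrow> 'v \<Rightarrow> 'v \<Rightarrow> 'k. cycle V y \<and> supp y \<noteq> {} \<and> supp y \<subseteq> supp z \<longrightarrow> supp y = supp z)"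

definition verts :: "('v \<Rightarrow> 'v \<Rightarrow> 'v \<Rightarrow> 'k::zero) \<Rightarrow> 'v set" where
  "verts z = {x. \<exists>y w. z x y w \<noteq> 0}"

definition edges :: "('v \<Rightarrow> 'v \<Rightarrow> 'v \<Rightarrow> 'k::zero) \<Rightarrow> 'v set set" where
  "edges z = {{x, y} | x y. \<exists>w. z x y w \<noteq> 0}"

text \<open>The join \<open>v * \<phi>\<close>; the three summands are the positions of
  \<open>v\<close>, reached by cyclic rotations, which are even.\<close>

definition cone :: "'v \<Rightarrow> ('v \<Rightarrow> 'v \<Rightarrow> 'k::comm_ring_1) \<Rightarrow> 'v \<Rightarrow> 'v \<Rightarrow> 'v \<Rightarrow> 'k" where
  "cone v \<phi> p q r =
     (if p = v then \<phi> q r else 0) + (if q = v then \<phi> r p else 0) + (if r = v then \<phi> p q else 0)"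

lemma alternating_swap12: "alternating z \<Longrightarrow> z y x w = - z x y w"
  and alternating_swap23: "alternating z \<Longrightarrow> z x w y = - z x y w"
  and alternating_eq12: "alternating z \<Longrightarrow> z x x w = 0"
  unfolding alternating_def by blast+

lemma alternating_eq23: "alternating z \<Longrightarrow> z w x x = 0"
  by (metis alternating_eq12 alternating_swap12 alternating_swap23 neg_equal_0_iff_equal)

lemma alternating_eq13: "alternating z \<Longrightarrow> z x w x = 0"
  by (metis alternating_eq12 alternating_swap23 neg_equal_0_iff_equal)

lemma alternating_rotate: "alternating z \<Longrightarrow> z y w x = z x y w"
  by (metis alternating_swap12 alternating_swap23 minus_minus)

lemma alternating_distinct: "alternating z \<Longrightarrow> z x y w \<noteq> 0 \<Longrightarrow> x \<noteq> y \<and> y \<noteq> w \<and> x \<noteq> w"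
  using alternating_eq12 alternating_eq23 alternating_eq13 by metis

lemma alternating_add:
  assumes "alternating y" "alternating z"
  shows "alternating (\<lambda>i j k. y i j k + z i j k)"
  unfolding alternating_def
proof (intro conjI allI)
  fix i j k
  show "y j i k + z j i k = - (y i j k + z i j k)"
    using assms[THEN alternating_swap12, of j i k] by simp
  show "y i k j + z i k j = - (y i j k + z i j k)"
    using assms[THEN alternating_swap23, of i k j] by simp
  show "y i i k + z i i k = 0"
    using assms[THEN alternating_eq12, of i k] by simp
qed

lemma alternating_scale:
  assumes "alternating z"
  shows "alternating (\<lambda>i j k. a * z i j k)"
  unfolding alternating_def
proof (intro conjI allI)
  fix i j k
  show "a * z j i k = - (a * z i j k)"
    using alternating_swap12[OF assms, of j i k] by simp
  show "a * z i k j = - (a * z i j k)"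
    using alternating_swap23[OF assms, of i k j] by simp
  show "a * z i i k = 0"
    using alternating_eq12[OF assms, of i k] by simp
qed

lemma alternating_diff:
  assumes "alternating y" "alternating z"
  shows "alternating (\<lambda>i j k. y i j k - z i j k)"
  using alternating_add[OF assms(1) alternating_scale[OF assms(2), of "- 1"]] by simp

lemma alternating_nonzero_perm:
  assumes "alternating z" "z x y w \<noteq> 0"
  shows "z x w y \<noteq> 0" "z y x w \<noteq> 0" "z y w x \<noteq> 0" "z w x y \<noteq> 0" "z w y x \<noteq> 0"
  using assms by (metis alternating_swap12 alternating_swap23 neg_equal_0_iff_equal)+

lemma alternating_verts:
  assumes "alternating z" "z x y w \<noteq> 0"
  shows "x \<in> verts z" "y \<in> verts z" "w \<in> verts z"
  using assms(2) alternating_nonzero_perm[OF assms] unfolding verts_def by blast+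

lemma alternating_edges:
  assumes "alternating z" "z x y w \<noteq> 0"
  shows "{x, y} \<in> edges z" "{y, w} \<in> edges z" "{x, w} \<in> edges z"
  using assms(2) alternating_nonzero_perm[OF assms] unfolding edges_def by blast+

lemma edgesD:
  assumes "alternating z" "{x, y} \<in> edges z"
  shows "\<exists>w. z x y w \<noteq> 0"
proof -
  obtain a b w where "{x, y} = {a, b}" "z a b w \<noteq> 0" using assms(2) unfolding edges_def by blast
  then show ?thesis using alternating_nonzero_perm(2)[OF assms(1)] by (auto simp: doubleton_eq_iff)
qed

lemma cycleD:
  assumes "cycle V z"
  shows "alternating z" "\<And>x y w. z x y w \<noteq> 0 \<Longrightarrow> x \<in> V \<and> y \<in> V \<and> w \<in> V" "\<And>y w. (\<Sum>x\<in>V. z x y w) = 0"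
  using assms unfolding cycle_def supp_def by auto

lemma cycle_sum: "cycle V z \<Longrightarrow> (\<Sum>w\<in>V. z x y w) = 0"
  using cycleD(3)[of V z x y] alternating_rotate[OF cycleD(1), of V z]
  by simp

lemma cycleI:
  assumes "alternating z" "\<And>x y w. z x y w \<noteq> 0 \<Longrightarrow> x \<in> V \<and> y \<in> V \<and> w \<in> V" "\<And>y w. (\<Sum>x\<in>V. z x y w) = 0"
  shows "cycle V z"
  using assms unfolding cycle_def supp_def by auto

lemma cycle_second_triangle:
  assumes "finite V" "cycle V z" "z x y w \<noteq> 0"
  shows "\<exists>w'. w' \<noteq> w \<and> z x y w' \<noteq> 0"
proof (rule ccontr)
  assume "\<not> ?thesis"
  then have "(\<Sum>w'\<in>V. z x y w') = (\<Sum>w'\<in>V. if w' = w then z x y w else 0)"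
    by (intro sum.cong) auto
  moreover have "w \<in> V" using cycleD(2)[OF assms(2,3)] by blast
  ultimately show False using cycle_sum[OF assms(2), of x y] assms(1,3) by simp
qed

text \<open>A smaller cycle \<open>y\<close> that misses the triangle \<open>abc\<close> is still
  useful: a combination with \<open>z\<close> cancels one triangle of \<open>y\<close> and keeps
  \<open>abc\<close>. Cross-multiplication and the absence of zero divisors do this over any
  domain.\<close>

lemma exists_minimal_cycle:
  fixes z :: "'v \<Rightarrow> 'v \<Rightarrow> 'v \<Rightarrow> 'k::idom"
  assumes "finite V" "cycle V z" "z a b c \<noteq> 0"
  obtains y :: "'v \<Rightarrow> 'v \<Rightarrow> 'v \<Rightarrow> 'k" where "minimal_cycle V y" "supp y \<subseteq> supp z" "y a b c \<noteq> 0"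
proof -
  have "\<exists>y :: 'v \<Rightarrow> 'v \<Rightarrow> 'v \<Rightarrow> 'k. minimal_cycle V y \<and> supp y \<subseteq> supp z \<and> y a b c \<noteq> 0"
    using assms(2,3)
  proof (induction "card (supp z)" arbitrary: z rule: less_induct)
    case less
    have fin: "finite (supp z)"
      using less.prems(1) assms(1) unfolding cycle_def by (meson finite_SigmaI finite_subset)
    show ?case
    proof (cases "minimal_cycle V z")
      case False
      moreover have "supp z \<noteq> {}" using less.prems(2) by (auto simp: supp_def)
      ultimately obtain y :: "'v \<Rightarrow> 'v \<Rightarrow> 'v \<Rightarrow> 'k" where y: "cycle V y" "supp y \<noteq> {}" "supp y \<subset> supp z"
        using less.prems(1) unfolding minimal_cycle_def by blast
      show ?thesis
      proof (cases "y a b c = 0")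
        case False
        then show ?thesis
          using less.hyps[of y] y psubset_card_mono[OF fin y(3)] by blast
      next
        case True
        obtain p q r where pqr: "y p q r \<noteq> 0" using y(2) by (auto simp: supp_def)
        define x where "x i j k = y p q r * z i j k - z p q r * y i j k" for i j k
        have "cycle V x"
        proof (rule cycleI)
          show "alternating x"
            unfolding x_def
            by (intro alternating_diff alternating_scale cycleD(1)[OF less.prems(1)] cycleD(1)[OF y(1)])
          show "i \<in> V \<and> j \<in> V \<and> k \<in> V" if "x i j k \<noteq> 0" for i j k
          proof -
            have "z i j k \<noteq> 0 \<or> y i j k \<noteq> 0" using that by (auto simp: x_def)
            then show ?thesis using cycleD(2)[OF less.prems(1)] cycleD(2)[OF y(1)] by blast
          qed
          show "(\<Sum>i\<in>V. x i j k) = 0" for j k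
            using cycleD(3)[OF less.prems(1)] cycleD(3)[OF y(1)]
            by (simp add: x_def sum_subtractf sum_distrib_left[symmetric])
        qed
        moreover have xabc: "x a b c \<noteq> 0" using True pqr less.prems(2) by (simp add: x_def)
        moreover have sub: "supp x \<subset> supp z"
        proof
          have "z i j k \<noteq> 0" if "x i j k \<noteq> 0" for i j k
            using that y(3) by (cases "y i j k = 0") (auto simp: supp_def x_def)
          then show "supp x \<subseteq> supp z" by (auto simp: supp_def)
          have "(p, q, r) \<in> supp z" using pqr y(3) by (auto simp: supp_def)
          moreover have "(p, q, r) \<notin> supp x" by (simp add: supp_def x_def)
          ultimately show "supp x \<noteq> supp z" by blast
        qed
        ultimately obtain w :: "'v \<Rightarrow> 'v \<Rightarrow> 'v \<Rightarrow> 'k" where "minimal_cycle V w" "supp w \<subseteq> supp x" "w a b c \<noteq> 0"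
          using less.hyps[of x] psubset_card_mono[OF fin sub] by blast
        with sub show ?thesis by blast
      qed
    qed (use less.prems in blast)
  qed
  then show thesis using that by blast
qed

lemma cone_alternating:
  assumes sym: "\<And>q r. \<phi> r q = - \<phi> q r" and "\<And>q. \<phi> q q = 0" "\<And>q. \<phi> v q = 0"
  shows "alternating (cone v \<phi>)"
  unfolding alternating_def cone_def
proof (intro conjI allI, goal_cases)
  case (1 x y w)
  show ?case using sym[of y w] sym[of w x] sym[of x y] by auto
next
  case (2 x y w)
  show ?case using sym[of y w] sym[of w x] sym[of x y] by auto
next
  case (3 x w)
  have "\<phi> w v = 0" using sym[of w v] assms(3) by simp
  then show ?case using assms(2,3) sym[of w x] by auto
qed

text \<open>The formula
  \<open>\<partial>(v * \<phi>) = \<phi> - v * \<partial>\<phi>\<close>.\<close>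

lemma cone_boundary:
  assumes "finite V" "v \<in> V" "\<And>q r. \<phi> r q = - \<phi> q r"
  shows "(\<Sum>p\<in>V. cone v \<phi> p q r)
    = \<phi> q r - (if q = v then \<Sum>p\<in>V. \<phi> p r else 0) + (if r = v then \<Sum>p\<in>V. \<phi> p q else 0)"
proof -
  have "(\<Sum>p\<in>V. \<phi> r p) = - (\<Sum>p\<in>V. \<phi> p r)"
    by (subst assms(3)) (simp add: sum_negf)
  then show ?thesis
    using assms(1,2) by (simp add: cone_def sum.distrib)
qed

section \<open>Contraction of an edge in a cycle\<close>

text \<open>The push-forward of \<open>z\<close> under \<open>v \<mapsto> u\<close>, written as
  \<open>z\<close> minus the boundary of the 3-chain \<open>u * v * \<theta>\<close>, where \<theta>
  is the link of \<open>v\<close> away from \<open>u\<close>. For a cycle \<open>z\<close>, \<eta>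
  is the boundary of \<open>v * \<theta>\<close>. This avoids summing over preimages.\<close>

definition contract :: "'v \<Rightarrow> 'v \<Rightarrow> ('v \<Rightarrow> 'v \<Rightarrow> 'v \<Rightarrow> 'k::comm_ring_1) \<Rightarrow> 'v \<Rightarrow> 'v \<Rightarrow> 'v \<Rightarrow> 'k" where
  "contract u v z =
    (let \<theta> = (\<lambda>q r. if q = u \<or> r = u then 0 else z v q r);
         \<eta> = (\<lambda>q r. \<theta> q r - (if q = v then z u v r else 0) + (if r = v then z u v q else 0))
     in (\<lambda>p q r. z p q r - cone v \<theta> p q r + cone u \<eta> p q r))"

lemma contract_values:
  assumes "alternating z" "u \<noteq> v"
  shows "p \<notin> {u, v} \<Longrightarrow> q \<notin> {u, v} \<Longrightarrow> r \<notin> {u, v} \<Longrightarrow> contract u v z p q r = z p q r"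
    and "q \<notin> {u, v} \<Longrightarrow> r \<notin> {u, v} \<Longrightarrow> contract u v z u q r = z u q r + z v q r"
    and "contract u v z v q r = 0"
proof -
  note eqs = alternating_eq12[OF assms(1)] alternating_eq13[OF assms(1)] alternating_eq23[OF assms(1)]
  show "p \<notin> {u, v} \<Longrightarrow> q \<notin> {u, v} \<Longrightarrow> r \<notin> {u, v} \<Longrightarrow> contract u v z p q r = z p q r"
    by (simp add: contract_def cone_def)
  show "q \<notin> {u, v} \<Longrightarrow> r \<notin> {u, v} \<Longrightarrow> contract u v z u q r = z u q r + z v q r"
    using assms(2) by (simp add: contract_def cone_def)
  show "contract u v z v q r = 0"
    using assms(2) eqs alternating_swap12[OF assms(1), of v u r] alternating_rotate[OF assms(1), of u v q]
      alternating_swap12[OF assms(1), of v q u] alternating_swap23[OF assms(1), of v u q]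
      alternating_swap12[OF assms(1), of v u q]
    by (simp add: contract_def cone_def)
qed

lemma contract_cycle:
  fixes z :: "'v \<Rightarrow> 'v \<Rightarrow> 'v \<Rightarrow> 'k::comm_ring_1"
  assumes "finite V" "u \<in> V" "v \<in> V" "u \<noteq> v" "cycle V z"
  shows "cycle V (contract u v z)"
proof -
  note alt = cycleD(1)[OF assms(5)]
  note eqs = alternating_eq12[OF alt] alternating_eq13[OF alt] alternating_eq23[OF alt]
  define \<theta> where "\<theta> = (\<lambda>q r. if q = u \<or> r = u then 0 else z v q r)"
  define \<eta> where "\<eta> = (\<lambda>q r. \<theta> q r - (if q = v then z u v r else 0) + (if r = v then z u v q else 0))"
  have c: "contract u v z = (\<lambda>p q r. z p q r - cone v \<theta> p q r + cone u \<eta> p q r)"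
    by (simp add: contract_def Let_def \<theta>_def \<eta>_def)
  have sym\<theta>: "\<theta> r q = - \<theta> q r" for q r
    using alternating_swap23[OF alt, of v q r] by (simp add: \<theta>_def)
  have sym\<eta>: "\<eta> r q = - \<eta> q r" for q r
    using sym\<theta>[of r q] by (auto simp: \<eta>_def)
  have "alternating (cone v \<theta>)"
    by (rule cone_alternating[OF sym\<theta>]) (simp_all add: \<theta>_def eqs)
  moreover have "alternating (cone u \<eta>)"
    by (rule cone_alternating[OF sym\<eta>]) (use assms(4) in \<open>simp_all add: \<eta>_def \<theta>_def eqs\<close>)
  ultimately have alt': "alternating (contract u v z)"
    unfolding c by (intro alternating_add alternating_diff alt)
  \<comment> \<open>The link of \<open>v\<close> is a 1-cycle, and \<theta> omits just its edges at
    \<open>u\<close>; hence the boundary of \<theta> is the link of the edge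
    \<open>uv\<close>.\<close>
  have bd\<theta>: "(\<Sum>p\<in>V. \<theta> p r) = z u v r" for r
  proof (cases "r = u")
    case False
    have "(\<Sum>p\<in>V. \<theta> p r) = (\<Sum>p\<in>V. z v p r - (if p = u then z v u r else 0))"
      using False by (intro sum.cong) (auto simp: \<theta>_def)
    also have "\<dots> = - (\<Sum>p\<in>V. z p v r) - z v u r"
      using assms(1,2) alternating_swap12[OF alt, of v _ r] by (simp add: sum_subtractf sum_negf)
    finally show ?thesis using cycleD(3)[OF assms(5), of v r] alternating_swap12[OF alt, of u v r] by simp
  qed (simp add: \<theta>_def eqs)
  have bd\<eta>: "(\<Sum>p\<in>V. \<eta> p r) = 0" for r
    using assms(1,3) cycle_sum[OF assms(5), of u v]
    by (cases "r = v") (simp_all add: \<eta>_def sum.distrib sum_subtractf bd\<theta>)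
  have "(\<Sum>p\<in>V. contract u v z p q r) = 0" for q r
  proof -
    have "(\<Sum>p\<in>V. contract u v z p q r) = - (\<Sum>p\<in>V. cone v \<theta> p q r) + (\<Sum>p\<in>V. cone u \<eta> p q r)"
      using cycleD(3)[OF assms(5), of q r] by (simp add: c sum.distrib sum_subtractf)
    also have "\<dots> = 0"
      by (simp add: cone_boundary[OF assms(1,3) sym\<theta>] cone_boundary[OF assms(1,2) sym\<eta>] bd\<theta> bd\<eta>)
        (simp add: \<eta>_def)
    finally show ?thesis .
  qed
  moreover have "p \<in> V \<and> q \<in> V \<and> r \<in> V" if "contract u v z p q r \<noteq> 0" for p q r
  proof (rule ccontr)
    assume "\<not> ?thesis"
    moreover have "z i j k = 0" if "i \<notin> V \<or> j \<notin> V \<or> k \<notin> V" for i j k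
      using cycleD(2)[OF assms(5)] that by blast
    ultimately have "contract u v z p q r = 0"
      using assms(2,3) by (auto simp: c cone_def \<theta>_def \<eta>_def)
    with that show False by simp
  qed
  ultimately show ?thesis using alt' by (intro cycleI)
qed

text \<open>Triangles of \<open>x\<close> at \<open>u\<close> that come from \<open>v\<close> are moved back to \<open>v\<close> by adding
  the boundary of the 3-chain \<open>v u \<phi>\<close>; since \<open>z\<close> is minimal, this must create
  triangles containing both \<open>u\<close> and \<open>v\<close>.\<close>

lemma contract_lift_common:
  fixes z x :: "'v \<Rightarrow> 'v \<Rightarrow> 'v \<Rightarrow> 'k::idom"
  assumes "finite V" "minimal_cycle V z" "z u v r0 \<noteq> 0" "cycle V x" "supp x \<noteq> {}"
    and sub: "supp x \<subseteq> supp (contract u v z)"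
  obtains a b where "a \<noteq> b" "\<And>r. r \<in> {a, b} \<Longrightarrow>
    r \<notin> {u, v} \<and> r \<in> verts x \<and> u \<in> verts x \<and> {u, r} \<in> edges z \<and> {v, r} \<in> edges z"
proof -
  have z: "cycle V z" using assms(2) unfolding minimal_cycle_def by blast
  note alt = cycleD(1)[OF z] and altx = cycleD(1)[OF assms(4)]
  have uv: "u \<noteq> v" "u \<in> V" "v \<in> V"
    using alternating_distinct[OF alt assms(3)] cycleD(2)[OF z assms(3)] by auto
  have subD: "contract u v z p q r \<noteq> 0" if "x p q r \<noteq> 0" for p q r
    using sub that unfolding supp_def by blast
  have xv: "x v q r = 0" for q r
    using subD[of v q r] contract_values(3)[OF alt uv(1)] by auto
  have xv': "x p v r = 0" "x p q v = 0" for p q r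
    using xv alternating_nonzero_perm[OF altx] by metis+
  \<comment> \<open>The part of the link of \<open>u\<close> in \<open>x\<close> that is absent from
    \<open>z\<close> at \<open>u\<close>; by \<open>zv\<close> it is then present at
    \<open>v\<close>.\<close>
  define \<phi> where "\<phi> q r = (if z u q r = 0 then x u q r else 0)" for q r
  have sym: "\<phi> r q = - \<phi> q r" for q r
    using alternating_swap23[OF alt, of u q r] alternating_swap23[OF altx, of u q r] by (simp add: \<phi>_def)
  have \<phi>0: "\<phi> q q = 0" "\<phi> u q = 0" "\<phi> v q = 0" "\<phi> q u = 0" "\<phi> q v = 0" for q
    by (simp_all add: \<phi>_def alternating_eq12[OF altx] alternating_eq23[OF altx] alternating_eq13[OF altx] xv')
  define \<psi> where "\<psi> r = (\<Sum>p\<in>V. \<phi> p r)" for r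
  have zv: "z v q r \<noteq> 0" if "\<phi> q r \<noteq> 0" for q r
  proof -
    have *: "x u q r \<noteq> 0" "z u q r = 0" using that by (auto simp: \<phi>_def split: if_splits)
    moreover have "q \<notin> {u, v}" "r \<notin> {u, v}" using \<phi>0 that by auto
    ultimately show ?thesis using subD[of u q r] contract_values(2)[OF alt uv(1)] by auto
  qed
  \<comment> \<open>If \<phi> were a cycle, moving it from \<open>u\<close> to \<open>v\<close>
    would turn \<open>x\<close> into a nonzero cycle supported in \<open>z\<close> that misses the
    triangle \<open>u v r0\<close>, against minimality.\<close>
  have key: "\<exists>r. \<psi> r \<noteq> 0"
  proof (rule ccontr)
    assume "\<not> ?thesis"
    then have \<psi>0: "(\<Sum>p\<in>V. \<phi> p r) = 0" for r by (auto simp: \<psi>_def)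
    define y where "y p q r = x p q r + cone v \<phi> p q r - cone u \<phi> p q r" for p q r
    have alty: "alternating y"
      unfolding y_def
      by (intro alternating_add alternating_diff altx cone_alternating[OF sym] \<phi>0)
    have yzv: "z p q r \<noteq> 0" if "y p q r \<noteq> 0" "p \<notin> {u, v}" "q \<notin> {u, v}" "r \<notin> {u, v}" for p q r
      using subD[of p q r] that contract_values(1)[OF alt uv(1)] by (auto simp: y_def cone_def)
    have yzu: "z u q r \<noteq> 0" if "y u q r \<noteq> 0" for q r
    proof -
      have "y u q r = x u q r - \<phi> q r" using uv(1) \<phi>0 by (simp add: y_def cone_def)
      with that show ?thesis by (auto simp: \<phi>_def)
    qed
    have yzv': "z v q r \<noteq> 0" if "y v q r \<noteq> 0" for q r
    proof -
      have "y v q r = \<phi> q r" using uv(1) \<phi>0 xv by (simp add: y_def cone_def)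
      with that show ?thesis using zv by auto
    qed
    have yz: "z p q r \<noteq> 0" if y: "y p q r \<noteq> 0" for p q r
    proof -
      note perms = alternating_nonzero_perm[OF alty y]
      consider "p \<notin> {u, v}" "q \<notin> {u, v}" "r \<notin> {u, v}" | "p = u" | "p = v" | "q = u" | "q = v" | "r = u" | "r = v"
        by blast
      then show ?thesis
      proof cases
        case 1 then show ?thesis using yzv y by blast
      next
        case 2 then show ?thesis using yzu y by blast
      next
        case 3 then show ?thesis using yzv' y by blast
      next
        case 4 then show ?thesis using yzu perms(3) alternating_nonzero_perm(4)[OF alt] by blast
      next
        case 5 then show ?thesis using yzv' perms(3) alternating_nonzero_perm(4)[OF alt] by blast
      next
        case 6 then show ?thesis using yzu perms(4) alternating_nonzero_perm(3)[OF alt] by blast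
      next
        case 7 then show ?thesis using yzv' perms(4) alternating_nonzero_perm(3)[OF alt] by blast
      qed
    qed
    have "cycle V y"
    proof (rule cycleI[OF alty])
      show "p \<in> V \<and> q \<in> V \<and> r \<in> V" if "y p q r \<noteq> 0" for p q r
        using cycleD(2)[OF z yz[OF that]] .
      show "(\<Sum>p\<in>V. y p q r) = 0" for q r
        using cycleD(3)[OF assms(4), of q r] \<psi>0
        by (simp add: y_def sum.distrib sum_subtractf cone_boundary[OF assms(1) uv(2) sym] cone_boundary[OF assms(1) uv(3) sym])
    qed
    moreover have "supp y \<noteq> {}"
    proof -
      obtain p q r where pqr: "x p q r \<noteq> 0" using assms(5) by (auto simp: supp_def)
      have ne: "y u q r \<noteq> 0 \<or> y v q r \<noteq> 0" if "x u q r \<noteq> 0" for q r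
        using that uv(1) \<phi>0[of q] \<phi>0[of r] xv[of q r] by (cases "z u q r = 0") (auto simp: y_def cone_def \<phi>_def)
      note perms = alternating_nonzero_perm[OF altx pqr]
      consider "p = u" | "q = u" | "r = u" | "p \<noteq> u" "q \<noteq> u" "r \<noteq> u" by blast
      then show ?thesis
      proof cases
        case 1 then show ?thesis using ne[of q r] pqr by (auto simp: supp_def)
      next
        case 2 then show ?thesis using ne[of r p] perms by (auto simp: supp_def)
      next
        case 3 then show ?thesis using ne[of p q] perms by (auto simp: supp_def)
      next
        case 4
        moreover have "p \<noteq> v" "q \<noteq> v" "r \<noteq> v" using pqr xv xv' by auto
        ultimately have "y p q r \<noteq> 0" using pqr by (simp add: y_def cone_def)
        then show ?thesis by (auto simp: supp_def)
      qed
    qed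
    moreover have "supp y \<subseteq> supp z" using yz by (auto simp: supp_def)
    ultimately have "supp y = supp z" using assms(2) unfolding minimal_cycle_def by blast
    moreover have "y u v r0 = 0" using uv(1) \<phi>0 xv' by (simp add: y_def cone_def)
    ultimately show False using assms(3) unfolding supp_def by blast
  qed
  \<comment> \<open>Where \<phi> has boundary, so has the rest of the link of \<open>u\<close> in
    \<open>x\<close>, because the whole link is a cycle. The first gives the edge \<open>vr\<close>
    of \<open>z\<close>, the second the edge \<open>ur\<close>.\<close>
  have r_props: "r \<notin> {u, v} \<and> r \<in> verts x \<and> u \<in> verts x \<and> {u, r} \<in> edges z \<and> {v, r} \<in> edges z"
    if "\<psi> r \<noteq> 0" for r
  proof -
    obtain p where p: "\<phi> p r \<noteq> 0"
      using \<open>\<psi> r \<noteq> 0\<close> unfolding \<psi>_def by (elim sum.not_neutral_contains_not_neutral)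
    have x: "x u p r \<noteq> 0" using p by (auto simp: \<phi>_def split: if_splits)
    have "(\<Sum>p\<in>V. x u p r) = 0"
      using cycleD(3)[OF assms(4), of r u] alternating_rotate[OF altx, of _ r u] by simp
    then have "(\<Sum>p\<in>V. x u p r - \<phi> p r) \<noteq> 0" using that by (simp add: sum_subtractf \<psi>_def)
    then obtain p' where "x u p' r - \<phi> p' r \<noteq> 0" by (elim sum.not_neutral_contains_not_neutral)
    then have zu: "z u p' r \<noteq> 0" by (auto simp: \<phi>_def)
    have "r \<notin> {u, v}" using p \<phi>0(4,5)[of p] by auto
    then show ?thesis
      using alternating_edges(3)[OF alt zu] alternating_edges(3)[OF alt zv[OF p]]
        alternating_verts(1,3)[OF altx x] by blast
  qed
  obtain a where a: "\<psi> a \<noteq> 0" using key by blast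
  \<comment> \<open>\<psi> is a boundary, so its values sum to zero and one nonzero value forces a
    second. This is why there are two common neighbours, as many as a vertex split needs.\<close>
  have "(\<Sum>r\<in>V. \<psi> r) = 0"
    unfolding \<psi>_def by (rule sum_alternating_eq_0[OF assms(1)]) (rule \<phi>0(1), rule sym)
  moreover have "(\<Sum>r\<in>V. \<psi> r) = \<psi> a + (\<Sum>r\<in>V - {a}. \<psi> r)"
  proof -
    have "a \<in> V"
      using r_props[OF a] cycleD(2)[OF assms(4)] unfolding verts_def by blast
    then show ?thesis by (rule sum.remove[OF assms(1)])
  qed
  ultimately have "(\<Sum>r\<in>V - {a}. \<psi> r) \<noteq> 0" using a by auto
  then obtain b where "b \<in> V - {a}" "\<psi> b \<noteq> 0" by (elim sum.not_neutral_contains_not_neutral)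
  then show thesis using that[of a b] a r_props by blast
qed

text \<open>Undoes the contraction on one minimal piece: \<open>x\<close> has lost the vertex
  \<open>v\<close>, so the induction hypothesis applies to it, and the common neighbours
  \<open>a\<close>, \<open>b\<close> allow \<open>u\<close> to be split into \<open>u\<close> and
  \<open>v\<close>.\<close>

lemma contract_lift_rigid:
  fixes z x :: "'v \<Rightarrow> 'v \<Rightarrow> 'v \<Rightarrow> 'k::idom"
  assumes "finite V" "minimal_cycle V z" "z u v r0 \<noteq> 0" "minimal_cycle V x"
    and sub: "supp x \<subseteq> supp (contract u v z)"
    and IH: "card (verts x) < card (verts z) \<Longrightarrow> rigid (edges x) (verts x)"
  shows "u \<in> verts x" "verts x \<subseteq> verts z - {v}" "rigid (edges z) (insert v (verts x))"
proof -
  have z: "cycle V z" and x: "cycle V x" "supp x \<noteq> {}"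
    using assms(2,4) unfolding minimal_cycle_def by blast+
  note alt = cycleD(1)[OF z] and altx = cycleD(1)[OF x(1)]
  have uv: "u \<noteq> v" "u \<in> verts z" "v \<in> verts z"
    using alternating_distinct[OF alt assms(3)] alternating_verts[OF alt assms(3)] by auto
  note vals = contract_values[OF alt uv(1)]
  have subD: "contract u v z p q r \<noteq> 0" if "x p q r \<noteq> 0" for p q r
    using sub that unfolding supp_def by blast
  obtain a b where ab: "a \<noteq> b" "\<And>r. r \<in> {a, b} \<Longrightarrow>
    r \<notin> {u, v} \<and> r \<in> verts x \<and> u \<in> verts x \<and> {u, r} \<in> edges z \<and> {v, r} \<in> edges z"
    using contract_lift_common[OF assms(1-3) x sub] by metis
  show u: "u \<in> verts x" using ab(2)[of a] by blast
  have xv: "x p q r = 0" if "v \<in> {p, q, r}" for p q r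
  proof (rule ccontr)
    assume nz: "x p q r \<noteq> 0"
    have "x v b c = 0" for b c using subD[of v b c] vals(3) by blast
    then show False using that nz alternating_nonzero_perm[OF altx nz] by auto
  qed
  have xuv: "q \<notin> {u, v}" "r \<notin> {u, v}" if "x u q r \<noteq> 0" for q r
    using that xv[of u q r] alternating_distinct[OF altx that] by auto
  have at_u: "z u q r \<noteq> 0 \<or> z v q r \<noteq> 0" if "x u q r \<noteq> 0" for q r
    using subD[OF that] vals(2) xuv[OF that] by auto
  \<comment> \<open>If the third vertex is \<open>u\<close>, the triangle may come from one at
    \<open>v\<close>; the edge \<open>pq\<close> belongs to \<open>z\<close> in either case.\<close>
  have away: "z p q r \<noteq> 0 \<or> z v q p \<noteq> 0" if "x p q r \<noteq> 0" "p \<noteq> u" "q \<noteq> u" for p q r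
  proof (cases "r = u")
    case True
    then have "z u q p \<noteq> 0 \<or> z v q p \<noteq> 0"
      using at_u[of q p] alternating_nonzero_perm[OF altx that(1)] by auto
    then show ?thesis using True alternating_nonzero_perm[OF alt] by metis
  next
    case False
    moreover have "v \<notin> {p, q, r}" using xv that(1) by blast
    ultimately show ?thesis using subD[OF that(1)] vals(1)[of p q r] that by auto
  qed
  show vx: "verts x \<subseteq> verts z - {v}"
  proof
    fix p assume "p \<in> verts x"
    then obtain q r where pqr: "x p q r \<noteq> 0" unfolding verts_def by blast
    show "p \<in> verts z - {v}"
    proof (cases "p = u")
      case False
      have "p \<in> verts z"
      proof (cases "q = u")
        case True
        then show ?thesis
          using at_u[of p r] alternating_nonzero_perm[OF altx pqr] alternating_verts[OF alt] by blast
      next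
        case False
        then show ?thesis
          using away[OF pqr] \<open>p \<noteq> u\<close> alternating_verts[OF alt] by blast
      qed
      then show ?thesis using xv[of p q r] pqr by auto
    qed (use uv in auto)
  qed
  have fin: "finite (verts z)"
    by (rule finite_subset[OF _ assms(1)]) (use cycleD(2)[OF z] in \<open>auto simp: verts_def\<close>)
  have "card (verts x) < card (verts z)"
    using vx uv(3) by (intro psubset_card_mono[OF fin]) blast
  then have rig: "rigid (edges x) (verts x)" by (rule IH)
  have finx: "finite (verts x)" using finite_subset[OF vx] fin by blast
  show "rigid (edges z) (insert v (verts x))"
  proof (rule rigid_vertex_split[OF finx rig, where u = u and a = a and b = b])
    show "u \<in> verts x" by (rule u)
    show "v \<notin> verts x" using vx by blast
    show "{u, v} \<in> edges z" using alternating_edges[OF alt assms(3)] by blast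
    show "distinct [u, a, b]" using ab(1) ab(2)[of a] ab(2)[of b] by auto
    show "{p, q} \<in> edges z" if "p \<in> verts x - {u}" "q \<in> verts x - {u}" "{p, q} \<in> edges x" for p q
    proof -
      obtain r where "x p q r \<noteq> 0" using edgesD[OF altx \<open>{p, q} \<in> edges x\<close>] by blast
      then have "z p q r \<noteq> 0 \<or> z v q p \<noteq> 0" using away that by blast
      then show ?thesis
        using alternating_edges[OF alt] by (metis insert_commute)
    qed
    show "{u, q} \<in> edges z \<or> {v, q} \<in> edges z" if "{u, q} \<in> edges x" for q
      using at_u edgesD[OF altx that] alternating_edges(1)[OF alt] by blast
  qed (use ab(2)[of a] ab(2)[of b] in auto)
qed

text \<open>The lifted pieces contain \<open>u\<close> and \<open>v\<close> but need no third vertex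
  in common. So a largest rigid \<open>X\<close> through these is taken: by maximality, a triangle
  not inside \<open>X\<close> meets it at most in \<open>u\<close> and \<open>v\<close>, and the
  triangles inside \<open>X\<close> form a cycle, which minimality makes all of
  \<open>z\<close>.\<close>

theorem minimal_cycle_rigid:
  fixes z :: "'v \<Rightarrow> 'v \<Rightarrow> 'v \<Rightarrow> 'k::idom"
  assumes "finite V" "minimal_cycle V z"
  shows "rigid (edges z) (verts z)"
  using assms(2)
proof (induction "card (verts z)" arbitrary: z rule: less_induct)
  case less
  then have z: "cycle V z" "supp z \<noteq> {}"
    unfolding minimal_cycle_def by blast+
  note alt = cycleD(1)[OF z(1)]
  have fin: "finite (verts z)"
    by (rule finite_subset[OF _ assms(1)]) (use cycleD(2)[OF z(1)] in \<open>auto simp: verts_def\<close>)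
  obtain u v r0 where uvr: "z u v r0 \<noteq> 0" using z(2) by (auto simp: supp_def)
  have uv: "u \<noteq> v" "u \<in> V" "v \<in> V" "u \<in> verts z" "v \<in> verts z" "{u, v} \<in> edges z"
    using alternating_distinct[OF alt uvr] cycleD(2)[OF z(1) uvr] alternating_verts[OF alt uvr]
      alternating_edges[OF alt uvr] by auto
  note vals = contract_values[OF alt uv(1)]
  have lift: "\<exists>X. {u, v, p, q, r} \<subseteq> X \<and> X \<subseteq> verts z \<and> rigid (edges z) X"
    if nz: "contract u v z p q r \<noteq> 0" for p q r
  proof -
    obtain x :: "'v \<Rightarrow> 'v \<Rightarrow> 'v \<Rightarrow> 'k"
      where x: "minimal_cycle V x" "supp x \<subseteq> supp (contract u v z)" "x p q r \<noteq> 0"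
      using exists_minimal_cycle[OF assms(1) contract_cycle[OF assms(1) uv(2,3,1) z(1)] nz] by blast
    have "cycle V x" using x(1) unfolding minimal_cycle_def by blast
    then have "alternating x" by (rule cycleD(1))
    then have "{p, q, r} \<subseteq> verts x" using alternating_verts[of x p q r] x(3) by blast
    then show ?thesis
      using contract_lift_rigid[OF assms(1) less.prems uvr x(1,2) less.hyps[OF _ x(1)]] uv(5)
      by (intro exI[of _ "insert v (verts x)"]) blast
  qed
  \<comment> \<open>The triangles \<open>uqr\<close> and \<open>vqr\<close> have the same image and
    may cancel, so no piece of the contraction need contain it; then the complete graph on the four
    vertices serves instead.\<close>
  have tetra: "\<exists>X. {u, v, q, r} \<subseteq> X \<and> X \<subseteq> verts z \<and> rigid (edges z) X"
    if "z u q r \<noteq> 0" "z v q r \<noteq> 0" for q r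
  proof (intro exI conjI)
    have "distinct [u, v, q, r]"
      using alternating_distinct[OF alt that(1)] alternating_distinct[OF alt that(2)] uv(1) by auto
    moreover have "{x, y} \<in> edges z" if "x \<in> {u, v, q, r}" "y \<in> {u, v, q, r}" "x \<noteq> y" for x y
      using alternating_edges[OF alt \<open>z u q r \<noteq> 0\<close>] alternating_edges[OF alt \<open>z v q r \<noteq> 0\<close>] uv(6) that
      by (auto simp: insert_commute)
    ultimately show "rigid (edges z) {u, v, q, r}"
      by (intro rigid_complete) auto
    show "{u, v, q, r} \<subseteq> verts z"
      using alternating_verts[OF alt that(1)] uv(5) by blast
  qed simp
  have piece_uv: "\<exists>X. {u, v, q, r} \<subseteq> X \<and> X \<subseteq> verts z \<and> rigid (edges z) X"
    if "z u q r \<noteq> 0 \<or> z v q r \<noteq> 0" "q \<notin> {u, v}" "r \<notin> {u, v}" for q r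
  proof (cases "z u q r \<noteq> 0 \<and> z v q r \<noteq> 0")
    case False
    then have "contract u v z u q r \<noteq> 0" using vals(2)[OF that(2,3)] that(1) by auto
    then show ?thesis using lift by fastforce
  qed (use tetra in blast)
  have piece: "\<exists>X. {u, v, p, q, r} \<subseteq> X \<and> X \<subseteq> verts z \<and> rigid (edges z) X"
    if nz: "z p q r \<noteq> 0" and no: "\<not> {u, v} \<subseteq> {p, q, r}" for p q r
  proof -
    note d = alternating_distinct[OF alt nz] and perms = alternating_nonzero_perm[OF alt nz]
    have other: "b \<notin> {u, v}" if "a \<in> {u, v}" "a \<noteq> b" "a \<in> {p, q, r}" "b \<in> {p, q, r}" for a b
    proof
      assume "b \<in> {u, v}"
      with that have "{u, v} = {a, b}" by auto
      with no that show False by blast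
    qed
    consider "p \<notin> {u, v}" "q \<notin> {u, v}" "r \<notin> {u, v}" | "p \<in> {u, v}" | "q \<in> {u, v}" | "r \<in> {u, v}" by blast
    then show ?thesis
    proof cases
      case 1
      then show ?thesis using lift[of p q r] vals(1) nz by auto
    next
      case 2
      then have "p \<in> {u, v} \<and> (z u q r \<noteq> 0 \<or> z v q r \<noteq> 0)" using nz by auto
      moreover have "q \<notin> {u, v}" "r \<notin> {u, v}" using other[of p q] other[of p r] 2 d by auto
      ultimately obtain X where "{u, v, q, r} \<subseteq> X" "X \<subseteq> verts z" "rigid (edges z) X" "p \<in> {u, v}"
        using piece_uv[of q r] by blast
      then show ?thesis by (intro exI[of _ X]) auto
    next
      case 3
      then have "q \<in> {u, v} \<and> (z u r p \<noteq> 0 \<or> z v r p \<noteq> 0)" using perms(3) by auto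
      moreover have "r \<notin> {u, v}" "p \<notin> {u, v}" using other[of q r] other[of q p] 3 d by auto
      ultimately obtain X where "{u, v, r, p} \<subseteq> X" "X \<subseteq> verts z" "rigid (edges z) X" "q \<in> {u, v}"
        using piece_uv[of r p] by blast
      then show ?thesis by (intro exI[of _ X]) auto
    next
      case 4
      then have "r \<in> {u, v} \<and> (z u p q \<noteq> 0 \<or> z v p q \<noteq> 0)" using perms(4) by auto
      moreover have "p \<notin> {u, v}" "q \<notin> {u, v}" using other[of r p] other[of r q] 4 d by auto
      ultimately obtain X where "{u, v, p, q} \<subseteq> X" "X \<subseteq> verts z" "rigid (edges z) X" "r \<in> {u, v}"
        using piece_uv[of p q] by blast
      then show ?thesis by (intro exI[of _ X]) auto
    qed
  qed
  \<comment> \<open>A second triangle on the edge \<open>u r0\<close>. Keeping it inside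
    \<open>X\<close> makes the truncation of \<open>z\<close> to \<open>X\<close> nonzero.\<close>
  obtain s where s: "s \<noteq> v" "z r0 u s \<noteq> 0"
    using cycle_second_triangle[OF assms(1) z(1), of r0 u v] alternating_nonzero_perm(4)[OF alt uvr] by blast
  have "\<not> {u, v} \<subseteq> {r0, u, s}" using s uv(1) alternating_distinct[OF alt uvr] by auto
  define good where "good X \<longleftrightarrow> {u, v, r0, s} \<subseteq> X \<and> X \<subseteq> verts z \<and> rigid (edges z) X" for X
  obtain X0 where "good X0"
    using piece[OF s(2) \<open>\<not> {u, v} \<subseteq> {r0, u, s}\<close>] unfolding good_def by blast
  moreover have "\<forall>Y. good Y \<longrightarrow> card Y < Suc (card (verts z))"
    using card_mono[OF fin] unfolding good_def by (simp add: less_Suc_eq_le)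
  ultimately obtain X where X: "good X" "\<And>Y. good Y \<Longrightarrow> card Y \<le> card X"
    using ex_has_greatest_nat[of good X0 card "Suc (card (verts z))"] by blast
  have finX: "finite X" using X(1) fin finite_subset unfolding good_def by blast
  \<comment> \<open>A vertex of the triangle in \<open>X\<close> other than \<open>u\<close> and
    \<open>v\<close> would be the third common vertex for gluing, and maximality of \<open>X\<close>
    absorbs the triangle.\<close>
  have split: "{p, q, r} \<subseteq> X \<or> {p, q, r} \<inter> X \<subseteq> {u, v}" if nz: "z p q r \<noteq> 0" for p q r
  proof (cases "{u, v} \<subseteq> {p, q, r}")
    case True
    then have "{p, q, r} = {u, v, p} \<or> {p, q, r} = {u, v, q} \<or> {p, q, r} = {u, v, r}"
      using uv(1) by auto
    then obtain w where eq: "{p, q, r} = {u, v, w}" by blast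
    show ?thesis unfolding eq using X(1) unfolding good_def by blast
  next
    case False
    obtain Y where Y: "{u, v, p, q, r} \<subseteq> Y" "Y \<subseteq> verts z" "rigid (edges z) Y"
      using piece[OF nz False] by blast
    show ?thesis
    proof (rule ccontr)
      assume neg: "\<not> ?thesis"
      then obtain w where w: "w \<in> X" "w \<in> {p, q, r}" "w \<notin> {u, v}" by blast
      have "card {u, v, w} = 3" using w uv(1) by auto
      moreover have "{u, v, w} \<subseteq> X \<inter> Y" using w Y(1) X(1) unfolding good_def by blast
      ultimately have "card (X \<inter> Y) \<ge> 3" using card_mono[of "X \<inter> Y" "{u, v, w}"] finX by simp
      then have "rigid (edges z) (X \<union> Y)"
        using rigid_Un[OF finX finite_subset[OF Y(2) fin], of "edges z"] X(1) Y(3) unfolding good_def by blast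
      then have "good (X \<union> Y)" using X(1) Y unfolding good_def by blast
      then have "card (X \<union> Y) \<le> card X" by (rule X(2))
      then have "X \<union> Y = X"
        using card_seteq[of "X \<union> Y" X] finX finite_subset[OF Y(2) fin] by simp
      then show False using neg Y(1) by blast
    qed
  qed
  \<comment> \<open>By \<open>split\<close>, the boundary of \<open>y\<close> can only live on the edge \<open>uv\<close>, so it vanishes and \<open>y\<close> is a cycle.\<close>
  define y where "y p q r = (if {p, q, r} \<subseteq> X then z p q r else 0)" for p q r
  have alty: "alternating y"
    unfolding alternating_def
  proof (intro conjI allI)
    fix p q r
    show "y q p r = - y p q r" using alternating_swap12[OF alt, of q p r] by (auto simp: y_def)
    show "y p r q = - y p q r" using alternating_swap23[OF alt, of p r q] by (auto simp: y_def)
    show "y p p r = 0" using alternating_eq12[OF alt] by (simp add: y_def)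
  qed
  have bd: "(\<Sum>p\<in>V. y p q r) = 0" if "{q, r} \<noteq> {u, v}" for q r
  proof (cases "{q, r} \<subseteq> X \<and> q \<noteq> r")
    case True
    have "y p q r = z p q r" for p
    proof (cases "z p q r = 0")
      case False
      have "\<not> {p, q, r} \<inter> X \<subseteq> {u, v}" using True that by auto
      then show ?thesis using split[OF False] by (simp add: y_def)
    qed (simp add: y_def)
    then show ?thesis using cycleD(3)[OF z(1)] by simp
  next
    case False
    then have "y p q r = 0" for p using alternating_eq23[OF alt] by (auto simp: y_def)
    then show ?thesis by simp
  qed
  \<comment> \<open>The boundary of \<open>y\<close> is itself a cycle, and at the vertex
    \<open>v\<close> only the edge \<open>uv\<close> could contribute to it.\<close>
  have bd_uv: "(\<Sum>p\<in>V. y p u v) = 0"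
  proof -
    have "(\<Sum>q\<in>V. \<Sum>p\<in>V. y p q v) = 0"
      by (rule sum_alternating_eq_0[OF assms(1), where a = "\<lambda>q p. y p q v"])
        (rule alternating_eq12[OF alty], rule alternating_swap12[OF alty])
    moreover have "(\<Sum>q\<in>V. \<Sum>p\<in>V. y p q v) = (\<Sum>q\<in>V. if q = u then \<Sum>p\<in>V. y p u v else 0)"
      using bd uv(1) by (intro sum.cong) (auto simp: doubleton_eq_iff)
    ultimately show ?thesis using assms(1) uv(2) by simp
  qed
  have "cycle V y"
  proof (rule cycleI[OF alty])
    show "p \<in> V \<and> q \<in> V \<and> r \<in> V" if "y p q r \<noteq> 0" for p q r
      using cycleD(2)[OF z(1)] that by (auto simp: y_def split: if_splits)
    show "(\<Sum>p\<in>V. y p q r) = 0" for q r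
    proof (cases "{q, r} = {u, v}")
      case True
      then consider "q = u" "r = v" | "q = v" "r = u" by (auto simp: doubleton_eq_iff)
      then show ?thesis
      proof cases
        case 2
        then have "(\<Sum>p\<in>V. y p q r) = - (\<Sum>p\<in>V. y p u v)"
          using alternating_swap23[OF alty, of _ u v] by (simp add: sum_negf)
        then show ?thesis using bd_uv by simp
      qed (use bd_uv in simp)
    qed (rule bd)
  qed
  moreover have "supp y \<noteq> {}"
  proof -
    have "y r0 u s \<noteq> 0" using s X(1) by (simp add: y_def good_def)
    then show ?thesis by (auto simp: supp_def)
  qed
  moreover have "supp y \<subseteq> supp z" by (auto simp: supp_def y_def split: if_splits)
  ultimately have eq: "supp y = supp z" using less.prems unfolding minimal_cycle_def by blast
  have "verts z \<subseteq> X"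
  proof
    fix p assume "p \<in> verts z"
    then obtain q r where "z p q r \<noteq> 0" unfolding verts_def by blast
    then have "(p, q, r) \<in> supp y" unfolding eq by (simp add: supp_def)
    then show "p \<in> X" by (simp add: supp_def y_def split: if_splits)
  qed
  then have "X = verts z" using X(1) unfolding good_def by blast
  then show ?case using X(1) unfolding good_def by blast
qed

section \<open>Coloured doubly Cohen--Macaulay complexes\<close>

lemma rigid_mono:
  assumes "rigid E X" "E \<subseteq> E'"
  shows "rigid E' X"
proof -
  have "motion p E X m" if "motion p E' X m" for p m
    using that assms(2) unfolding motion_def by blast
  then have "rigid_at E' X p" if "rigid_at E X p" for p
    using that unfolding rigid_at_def by blast
  then show ?thesis using assms(1) unfolding rigid_def by blast
qed

text \<open>A form of the hypotheses that passes to vertex links: the colours are any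
  \<open>d\<close>-element set \<open>S\<close>, links and deletions are merged into one condition,
  and \<open>W\<close> may contain points outside the vertex set. Fields and the integers are both
  of class \<open>idom\<close>.\<close>

locale colored_2cm =
  fixes k :: "'k::idom itself" and \<Delta> :: "'v set set" and d :: nat and \<kappa> :: "'v \<Rightarrow> 'c" and S :: "'c set"
  assumes complex: "simplicial_complex (\<Union>\<Delta>) \<Delta>"
    and acyclic: "\<And>F W m. F \<in> \<Delta> \<Longrightarrow> finite W \<Longrightarrow> card W \<le> 1 \<Longrightarrow> F \<inter> W = {} \<Longrightarrow> m + 1 + int (card F) < int d \<Longrightarrow>
      trivial_group (reduced_homology k {G \<in> \<Delta>. F \<union> G \<in> \<Delta> \<and> G \<inter> (F \<union> W) = {}} m)"
    and color_inj: "\<And>F. F \<in> \<Delta> \<Longrightarrow> inj_on \<kappa> F"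
    and color_range: "\<kappa> ` \<Union>\<Delta> \<subseteq> S"
    and colors: "finite S" "card S = d"
begin

section \<open>Low-degree homology of links with at most one vertex deleted\<close>

abbreviation V :: "'v set" where "V \<equiv> \<Union>\<Delta>"

text \<open>For \<open>F\<close> disjoint from \<open>W\<close>, the link of \<open>F\<close> in the
  deletion of \<open>W\<close>.\<close>

definition slink :: "'v set \<Rightarrow> 'v set \<Rightarrow> 'v set set" where
  "slink F W = {G \<in> \<Delta>. F \<union> G \<in> \<Delta> \<and> G \<inter> (F \<union> W) = {}}"

lemma finV: "finite V" and empty_face: "{} \<in> \<Delta>"
  and subface: "F \<in> \<Delta> \<Longrightarrow> G \<subseteq> F \<Longrightarrow> G \<in> \<Delta>" and vertex_face: "v \<in> V \<Longrightarrow> {v} \<in> \<Delta>"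
  using complex unfolding simplicial_complex_def by blast+

lemma face_finite: "F \<in> \<Delta> \<Longrightarrow> finite F"
  using finV by (meson Union_upper finite_subset)

lemma face_card_le: "F \<in> \<Delta> \<Longrightarrow> card F \<le> d"
  using card_image[OF color_inj, of F] card_mono[OF colors(1), of "\<kappa> ` F"] color_range colors(2)
  by (metis Union_upper image_mono order_trans)

lemma slink_complex:
  assumes "F \<in> \<Delta>"
  shows "simplicial_complex (\<Union>(slink F W)) (slink F W)"
  unfolding simplicial_complex_def
proof (intro conjI ballI allI impI)
  show "finite (\<Union>(slink F W))" by (rule finite_subset[OF _ finV]) (auto simp: slink_def)
  show "{} \<in> slink F W" using assms empty_face by (simp add: slink_def)
  show closed: "H \<in> slink F W" if "G \<in> slink F W" "H \<subseteq> G" for G H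
    using that subface[of G H] subface[of "F \<union> G" "F \<union> H"] unfolding slink_def by blast
  show "{v} \<in> slink F W" if "v \<in> \<Union>(slink F W)" for v
    using that closed by blast
qed auto

lemma slink_fill:
  assumes "F \<in> \<Delta>" "finite W" "card W \<le> 1" "F \<inter> W = {}" "m + 1 + int (card F) < int d"
    and "c \<in> oriented_chains k (slink F W) m" "boundary_map (slink F W) c = (\<lambda>_. 0)"
  shows "\<exists>b\<in>oriented_chains k (slink F W) (m + 1). c = boundary_map (slink F W) b"
proof -
  have "trivial_group (reduced_homology k (slink F W) m)"
    unfolding slink_def by (rule acyclic[OF assms(1-5)])
  then show ?thesis
    using trivial_reduced_homology_iff[OF slink_complex[OF assms(1)], of k W m] assms(6,7) by blast
qed

text \<open>With the sum over all of \<open>V\<close> the formula is the same for every link, so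
  chains from different links can be combined.\<close>

lemma boundary_slink:
  assumes "b \<in> oriented_chains k (slink F W) m"
  shows "boundary_map (slink F W) b xs = (\<Sum>x\<in>V. b (x # xs))"
  unfolding boundary_map_def
proof (rule sum.mono_neutral_left[OF finV])
  show "\<Union>(slink F W) \<subseteq> V" by (auto simp: slink_def)
  show "\<forall>x\<in>V - \<Union>(slink F W). b (x # xs) = 0"
    using oriented_chains_support[OF assms] by fastforce
qed

text \<open>Degree -1: the generator on the empty list is a cycle, and it can bound only if the link
  has a vertex outside \<open>W\<close>.\<close>

lemma extend_face:
  assumes "F \<in> \<Delta>" "card F < d" "finite W" "card W \<le> 1" "F \<inter> W = {}"
  obtains v where "v \<notin> F \<union> W" "insert v F \<in> \<Delta>"
proof -
  let ?c = "\<lambda>xs :: 'v list. if xs = [] then 1 else 0 :: 'k"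
  have chain: "?c \<in> oriented_chains k (slink F W) (- 1)"
    by (rule oriented_chainsI) (use assms(1) empty_face in \<open>auto simp: slink_def face_dim_def split: if_splits\<close>)
  have "boundary_map (slink F W) ?c = (\<lambda>_. 0)" by (simp add: boundary_map_def fun_eq_iff)
  then have "\<exists>b\<in>oriented_chains k (slink F W) (- 1 + 1). ?c = boundary_map (slink F W) b"
    using assms by (intro slink_fill[OF assms(1) _ _ _ _ chain]) simp_all
  then obtain b where b: "b \<in> oriented_chains k (slink F W) (- 1 + 1)" "?c = boundary_map (slink F W) b"
    by (rule bexE)
  have "(\<Sum>x\<in>V. b [x]) = 1"
    using b(2)[THEN fun_cong, of "[]"] boundary_slink[OF b(1), of "[]"] by simp
  then obtain v where "b [v] \<noteq> 0" by (metis (no_types, lifting) sum.neutral zero_neq_one)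
  then have "{v} \<in> slink F W" using oriented_chains_support[OF b(1)] by fastforce
  then show thesis using that by (auto simp: slink_def)
qed

text \<open>Degree 1, transported from functions on lists to functions of two and three
  arguments.\<close>

lemma two_chain_fill:
  assumes "F \<in> \<Delta>" "card F + 3 \<le> d" "finite W" "card W \<le> 1" "F \<inter> W = {}"
    and supp: "\<And>x y. c x y \<noteq> 0 \<Longrightarrow> x \<noteq> y \<and> {x, y} \<in> slink F W"
    and alt: "\<And>x y. c y x = - c x y" and cyc: "\<And>y. (\<Sum>x\<in>V. c x y) = 0"
  shows "\<exists>\<beta> :: 'v \<Rightarrow> 'v \<Rightarrow> 'v \<Rightarrow> 'k. alternating \<beta> \<and>
    (\<forall>x y z. \<beta> x y z \<noteq> 0 \<longrightarrow> {x, y, z} \<in> slink F W) \<and> (\<forall>y z. (\<Sum>x\<in>V. \<beta> x y z) = c y z)"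
proof -
  define C where "C xs = (case xs of [x, y] \<Rightarrow> c x y | _ \<Rightarrow> 0)" for xs
  have C2: "C [x, y] = c x y" for x y by (simp add: C_def)
  have C0: "C xs = 0" if "length xs \<noteq> 2" for xs
    using that by (auto simp: C_def split: list.splits)
  have chain: "C \<in> oriented_chains k (slink F W) 1"
  proof (rule oriented_chainsI)
    fix xs assume nz: "C xs \<noteq> 0"
    then have "length xs = 2" using C0 by blast
    then obtain x y where "xs = [x, y]" by (auto simp: length_Suc_conv numeral_2_eq_2)
    with nz supp[of x y] C2 show "distinct xs \<and> set xs \<in> slink F W \<and> face_dim (set xs) = 1"
      by (auto simp: face_dim_def)
  next
    fix xs x y ys
    show "C (xs @ x # y # ys) = - C (xs @ y # x # ys)"
    proof (cases "xs = [] \<and> ys = []")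
      case True
      then show ?thesis using C2 alt[of x y] by simp
    next
      case False
      then have "length (xs @ x # y # ys) \<noteq> 2" "length (xs @ y # x # ys) \<noteq> 2" by auto
      then show ?thesis using C0 by simp
    qed
  qed
  have "boundary_map (slink F W) C = (\<lambda>_. 0)"
  proof
    fix xs
    show "boundary_map (slink F W) C xs = 0"
    proof (cases "length xs = 1")
      case True
      then obtain y where "xs = [y]" by (auto simp: length_Suc_conv)
      then show ?thesis using cyc[of y] by (simp add: boundary_slink[OF chain] C2)
    qed (simp add: boundary_slink[OF chain] C0)
  qed
  then have "\<exists>b\<in>oriented_chains k (slink F W) (1 + 1). C = boundary_map (slink F W) b"
    using assms(2) by (intro slink_fill[OF assms(1,3,4,5) _ chain]) simp_all
  then obtain b where b: "b \<in> oriented_chains k (slink F W) (1 + 1)" "C = boundary_map (slink F W) b"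
    by (rule bexE)
  show ?thesis
  proof (intro exI[of _ "\<lambda>x y z. b [x, y, z]"] conjI allI impI)
    show "alternating (\<lambda>x y z. b [x, y, z])"
      unfolding alternating_def
    proof (intro conjI allI)
      fix x y w
      show "b [y, x, w] = - b [x, y, w]" using oriented_chains_swap[OF b(1), of "[]" y x "[w]"] by simp
      show "b [x, w, y] = - b [x, y, w]" using oriented_chains_swap[OF b(1), of "[x]" w y "[]"] by simp
      show "b [x, x, w] = 0" using oriented_chains_support[OF b(1), of "[x, x, w]"] by auto
    qed
    show "{x, y, z} \<in> slink F W" if "b [x, y, z] \<noteq> 0" for x y z
      using oriented_chains_support[OF b(1) that] by simp
    show "(\<Sum>x\<in>V. b [x, y, z]) = c y z" for y z
      using b(2)[THEN fun_cong, of "[y, z]"] boundary_slink[OF b(1), of "[y, z]"] C2 by simp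
  qed
qed

text \<open>Degree 0: \<open>s - t\<close> bounds, and the 1-chain that it bounds stands in for a
  path between the two vertices.\<close>

lemma path_chain:
  assumes "F \<in> \<Delta>" "card F + 2 \<le> d" "finite W" "card W \<le> 1" "F \<inter> W = {}"
    and ab: "{s} \<in> slink F W" "{t} \<in> slink F W"
  shows "\<exists>\<beta> :: 'v \<Rightarrow> 'v \<Rightarrow> 'k. (\<forall>x y. \<beta> y x = - \<beta> x y) \<and>
    (\<forall>x y. \<beta> x y \<noteq> 0 \<longrightarrow> x \<noteq> y \<and> {x, y} \<in> slink F W) \<and>
    (\<forall>y. (\<Sum>x\<in>V. \<beta> x y) = (if y = s then 1 else 0) - (if y = t then 1 else 0))"
proof -
  define g :: "'v \<Rightarrow> 'k" where "g y = (if y = s then 1 else 0) - (if y = t then 1 else 0)" for y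
  define C where "C xs = (case xs of [x] \<Rightarrow> g x | _ \<Rightarrow> 0)" for xs
  have C1: "C [x] = g x" for x by (simp add: C_def)
  have C0: "C xs = 0" if "length xs \<noteq> 1" for xs
    using that by (auto simp: C_def split: list.splits)
  have chain: "C \<in> oriented_chains k (slink F W) 0"
  proof (rule oriented_chainsI)
    fix xs assume nz: "C xs \<noteq> 0"
    then have "length xs = 1" using C0 by blast
    then obtain x where "xs = [x]" by (auto simp: length_Suc_conv)
    with nz C1 have "xs = [s] \<or> xs = [t]" by (auto simp: g_def split: if_splits)
    with ab show "distinct xs \<and> set xs \<in> slink F W \<and> face_dim (set xs) = 0"
      by (auto simp: face_dim_def)
  qed (simp add: C0)
  have "s \<in> V" "t \<in> V" using ab by (auto simp: slink_def)
  then have g0: "(\<Sum>x\<in>V. g x) = 0" using finV by (simp add: g_def sum_subtractf)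
  have "boundary_map (slink F W) C = (\<lambda>_. 0)"
  proof
    fix xs
    show "boundary_map (slink F W) C xs = 0"
      using g0 by (cases "xs = []") (simp_all add: boundary_slink[OF chain] C1 C0)
  qed
  then have "\<exists>b\<in>oriented_chains k (slink F W) (0 + 1). C = boundary_map (slink F W) b"
    using assms(2) by (intro slink_fill[OF assms(1,3,4,5) _ chain]) simp_all
  then obtain b where b: "b \<in> oriented_chains k (slink F W) (0 + 1)" "C = boundary_map (slink F W) b"
    by (rule bexE)
  show ?thesis
  proof (rule exI[of _ "\<lambda>x y. b [x, y]"], intro conjI allI impI)
    show "b [y, x] = - b [x, y]" for x y using oriented_chains_swap[OF b(1), of "[]" y x "[]"] by simp
    show "x \<noteq> y" "{x, y} \<in> slink F W" if "b [x, y] \<noteq> 0" for x y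
      using oriented_chains_support[OF b(1) that] by auto
    show "(\<Sum>x\<in>V. b [x, y]) = (if y = s then 1 else 0) - (if y = t then 1 else 0)" for y
      using b(2)[THEN fun_cong, of "[y]"] boundary_slink[OF b(1), of "[y]"] C1 by (simp add: g_def)
  qed
qed

text \<open>Both deletions are used. Without \<open>w\<close>, the link of \<open>insert v G\<close>
  still joins \<open>a\<close> to \<open>b\<close>; without \<open>v\<close>, the link of
  \<open>G\<close> still fills the closed path so obtained. The edge \<open>vw\<close> then lies in
  just two triangles of the 2-cycle, so a minimal cycle through \<open>vwa\<close> also contains
  \<open>vwb\<close>.\<close>

lemma adjacent_triangles_rigid:
  assumes G: "card G + 3 \<le> d" "G \<inter> {v, w, a, b} = {}" "distinct [v, w, a, b]"
    and A: "insert v (insert w (insert a G)) \<in> \<Delta>" and B: "insert v (insert w (insert b G)) \<in> \<Delta>"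
  obtains X where "rigid \<Delta> X" "{v, w, a, b} \<subseteq> X" "\<And>x. x \<in> X \<Longrightarrow> x \<notin> G \<and> insert x G \<in> \<Delta>"
proof -
  have faces: "insert v G \<in> \<Delta>" "G \<in> \<Delta>" using subface[OF A] by blast+
  have vV: "v \<in> V" "w \<in> V" "a \<in> V" "b \<in> V" using A B by blast+
  have finG: "finite G" using face_finite[OF faces(2)] .
  have sl: "{a} \<in> slink (insert v G) {w}" "{b} \<in> slink (insert v G) {w}"
    using subface[OF A, of "insert v (insert a G)"] subface[OF B, of "insert v (insert b G)"]
      subface[OF A, of "{a}"] subface[OF B, of "{b}"] G(2,3) by (auto simp: slink_def subset_insertI2)
  have cd: "card (insert v G) + 2 \<le> d" using G(1,2) finG by simp
  have dis: "insert v G \<inter> {w} = {}" using G(2,3) by auto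
  have singleton: "finite {x}" "card {x} \<le> 1" for x :: 'v by simp_all
  obtain \<beta> :: "'v \<Rightarrow> 'v \<Rightarrow> 'k" where \<beta>: "\<And>x y. \<beta> y x = - \<beta> x y"
    "\<And>x y. \<beta> x y \<noteq> 0 \<Longrightarrow> x \<noteq> y \<and> {x, y} \<in> slink (insert v G) {w}"
    "\<And>y. (\<Sum>x\<in>V. \<beta> x y) = (if y = a then 1 else 0) - (if y = b then 1 else 0)"
    using path_chain[OF faces(1) cd singleton dis sl] by metis
  define g :: "'v \<Rightarrow> 'k" where "g y = (if y = a then 1 else 0) - (if y = b then 1 else 0)" for y
  have g0: "(\<Sum>x\<in>V. g x) = 0" using finV vV by (simp add: g_def sum_subtractf)
  \<comment> \<open>\<beta> closed up through \<open>w\<close>: as \<beta> avoids \<open>w\<close>,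
    the only edges of \<open>c\<close> at \<open>w\<close> are \<open>wa\<close> and
    \<open>wb\<close>.\<close>
  define c where "c x y = \<beta> x y - ((if x = w then g y else 0) - (if y = w then g x else 0))" for x y
  have c_alt: "c y x = - c x y" for x y using \<beta>(1)[of x y] by (simp add: c_def)
  have c_supp: "x \<noteq> y \<and> x \<notin> insert v G \<and> y \<notin> insert v G \<and> insert x (insert y (insert v G)) \<in> \<Delta>"
    if nz: "c x y \<noteq> 0" for x y
  proof -
    consider "\<beta> x y \<noteq> 0" | "x = w" "y = a \<or> y = b" | "y = w" "x = a \<or> x = b"
      using nz unfolding c_def g_def by (auto split: if_splits)
    then show ?thesis
    proof cases
      case 1
      then show ?thesis using \<beta>(2)[OF 1] by (auto simp: slink_def insert_commute)
    qed (use A B G(2,3) in \<open>auto simp: insert_commute\<close>)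
  qed
  have c_slink: "x \<noteq> y \<and> {x, y} \<in> slink G {v}" if nz: "c x y \<noteq> 0" for x y
    using c_supp[OF nz] subface[of "insert x (insert y (insert v G))" "{x, y}"]
      subface[of "insert x (insert y (insert v G))" "insert x (insert y G)"]
    by (auto simp: slink_def)
  have c_cyc: "(\<Sum>x\<in>V. c x y) = 0" for y
  proof -
    have "(\<Sum>x\<in>V. if y = w then g x else 0) = 0" using g0 by (cases "y = w") simp_all
    moreover have "(\<Sum>x\<in>V. \<beta> x y) = g y" by (simp only: \<beta>(3) g_def)
    moreover have "(\<Sum>x\<in>V. if x = w then g y else 0) = g y" using finV vV(2) by simp
    ultimately show ?thesis by (simp only: c_def sum_subtractf) simp
  qed
  have "G \<inter> {v} = {}" using G(2) by auto
  note two_chain_fill[OF faces(2) G(1) singleton this c_slink c_alt c_cyc]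
  then obtain \<gamma> :: "'v \<Rightarrow> 'v \<Rightarrow> 'v \<Rightarrow> 'k" where \<gamma>: "alternating \<gamma>"
    "\<And>x y z. \<gamma> x y z \<noteq> 0 \<Longrightarrow> {x, y, z} \<in> slink G {v}" "\<And>y z. (\<Sum>x\<in>V. \<gamma> x y z) = c y z"
    by metis
  have c0: "c v q = 0" "c q v = 0" "c q q = 0" for q using c_supp[of v q] c_supp[of q v] c_supp[of q q] by blast+
  \<comment> \<open>The cone over \<open>c\<close> and \<gamma> both have boundary \<open>c\<close>,
    because \<open>c\<close> is a cycle; \<gamma> has no triangle at \<open>v\<close>.\<close>
  define z where "z p q r = cone v c p q r - \<gamma> p q r" for p q r
  have altz: "alternating z"
    unfolding z_def by (intro alternating_diff \<gamma>(1) cone_alternating c_alt c0)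
  have z_supp: "p \<notin> G \<and> insert p G \<in> \<Delta> \<and> {p, q} \<in> \<Delta>" if nz: "z p q r \<noteq> 0" for p q r
  proof -
    have "\<gamma> p q r \<noteq> 0 \<or> (p = v \<and> c q r \<noteq> 0) \<or> (q = v \<and> c r p \<noteq> 0) \<or> (r = v \<and> c p q \<noteq> 0)"
    proof (rule ccontr)
      assume "\<not> ?thesis"
      then have "z p q r = 0" by (simp add: z_def cone_def)
      with nz show False by simp
    qed
    then consider "\<gamma> p q r \<noteq> 0" | "p = v" "c q r \<noteq> 0" | "q = v" "c r p \<noteq> 0" | "r = v" "c p q \<noteq> 0"
      by blast
    then show ?thesis
    proof cases
      case 1
      then show ?thesis
        using \<gamma>(2)[OF 1] subface[of "{p, q, r}" "{p, q}"] subface[of "G \<union> {p, q, r}" "insert p G"]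
        by (auto simp: slink_def)
    next
      case 2
      then show ?thesis
        using c_supp[OF 2(2)] subface[of "insert q (insert r (insert v G))"] faces(1) G(2) by auto
    next
      case 3
      then show ?thesis
        using c_supp[OF 3(2)] subface[of "insert r (insert p (insert v G))"] by auto
    next
      case 4
      then show ?thesis
        using c_supp[OF 4(2)] subface[of "insert p (insert q (insert v G))"] by auto
    qed
  qed
  have cyc: "cycle V z"
  proof (rule cycleI[OF altz])
    show "p \<in> V \<and> q \<in> V \<and> r \<in> V" if "z p q r \<noteq> 0" for p q r
      using z_supp[OF that] z_supp[OF alternating_nonzero_perm(4)[OF altz that]] by blast
    show "(\<Sum>p\<in>V. z p q r) = 0" for q r
      by (simp add: z_def sum_subtractf cone_boundary[OF finV vV(1) c_alt] c_cyc \<gamma>(3))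
  qed
  have zvw: "z v w y = - g y" if "y \<noteq> v" for y
  proof -
    have "\<gamma> v w y = 0" using \<gamma>(2)[of v w y] by (auto simp: slink_def)
    moreover have "\<beta> w y = 0" using \<beta>(2)[of w y] by (auto simp: slink_def)
    moreover have "g w = 0" "v \<noteq> w" using G(3) by (auto simp: g_def)
    ultimately show ?thesis using that by (simp add: z_def cone_def c_def)
  qed
  have zvwv: "z v w v = 0" by (rule alternating_eq13[OF altz])
  have "z v w a \<noteq> 0" using zvw[of a] G(3) by (auto simp: g_def)
  then obtain m :: "'v \<Rightarrow> 'v \<Rightarrow> 'v \<Rightarrow> 'k" where m: "minimal_cycle V m" "supp m \<subseteq> supp z" "m v w a \<noteq> 0"
    using exists_minimal_cycle[OF finV cyc] by blast
  have mcyc: "cycle V m" using m(1) unfolding minimal_cycle_def by blast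
  note altm = cycleD(1)[OF mcyc]
  have mz: "z p q r \<noteq> 0" if "m p q r \<noteq> 0" for p q r using m(2) that unfolding supp_def by blast
  obtain y where "y \<noteq> a" "m v w y \<noteq> 0" using cycle_second_triangle[OF finV mcyc m(3)] by blast
  moreover from this have "y = a \<or> y = b" using mz[of v w y] zvw[of y] zvwv by (cases "y = v") (auto simp: g_def split: if_splits)
  ultimately have mb: "m v w b \<noteq> 0" by blast
  show thesis
  proof (rule that[of "verts m"])
    have "edges m \<subseteq> \<Delta>" unfolding edges_def using z_supp mz by blast
    with minimal_cycle_rigid[OF finV m(1)] show "rigid \<Delta> (verts m)" by (rule rigid_mono)
    show "{v, w, a, b} \<subseteq> verts m" using alternating_verts[OF altm m(3)] alternating_verts[OF altm mb] by blast
    show "x \<notin> G \<and> insert x G \<in> \<Delta>" if "x \<in> verts m" for x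
      using that z_supp mz unfolding verts_def by blast
  qed
qed

section \<open>Facets and connectedness through codimension one\<close>

definition facets :: "'v set set" where
  "facets = {A \<in> \<Delta>. card A = d}"

lemma face_subset_facet:
  assumes "F \<in> \<Delta>"
  obtains A where "A \<in> facets" "F \<subseteq> A"
proof -
  have "\<exists>A\<in>facets. F \<subseteq> A" using assms
  proof (induction "d - card F" arbitrary: F rule: less_induct)
    case less
    show ?case
    proof (cases "card F = d")
      case True
      with less.prems show ?thesis by (auto simp: facets_def)
    next
      case False
      then have lt: "card F < d" using face_card_le[OF less.prems] by simp
      obtain v where v: "v \<notin> F" "insert v F \<in> \<Delta>"
        using extend_face[OF less.prems lt, of "{}"] by auto
      have "card (insert v F) = Suc (card F)" using v(1) face_finite[OF less.prems] by simp
      then have "d - card (insert v F) < d - card F" using lt by simp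
      then obtain A where "A \<in> facets" "insert v F \<subseteq> A" using less.hyps[OF _ v(2)] by blast
      then show ?thesis by blast
    qed
  qed
  then show thesis using that by blast
qed

text \<open>Connectedness as an induction principle. If \<open>Q\<close> failed at \<open>b\<close>,
  no edge of the path chain would leave the set where \<open>Q\<close> holds, yet its boundary would
  have total weight 1 there, while both ends of every edge inside cancel.\<close>

lemma link_connected:
  assumes "F \<in> \<Delta>" "card F + 2 \<le> d" "a \<notin> F" "insert a F \<in> \<Delta>" "b \<notin> F" "insert b F \<in> \<Delta>"
    and "Q a"
    and step: "\<And>x y. x \<notin> F \<Longrightarrow> y \<notin> F \<Longrightarrow> x \<noteq> y \<Longrightarrow> insert x (insert y F) \<in> \<Delta> \<Longrightarrow> Q x \<Longrightarrow> Q y"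
  shows "Q b"
proof (rule ccontr)
  assume "\<not> Q b"
  have ab: "{a} \<in> slink F {}" "{b} \<in> slink F {}"
    using subface[OF assms(4), of "{a}"] subface[OF assms(6), of "{b}"] assms(3-6) by (auto simp: slink_def)
  obtain \<beta> :: "'v \<Rightarrow> 'v \<Rightarrow> 'k" where \<beta>: "\<And>x y. \<beta> y x = - \<beta> x y"
    "\<And>x y. \<beta> x y \<noteq> 0 \<Longrightarrow> x \<noteq> y \<and> {x, y} \<in> slink F {}"
    "\<And>y. (\<Sum>x\<in>V. \<beta> x y) = (if y = a then 1 else 0) - (if y = b then 1 else 0)"
    using path_chain[OF assms(1,2) finite.emptyI _ _ ab] by (metis card.empty inf_bot_right zero_le_one)
  define C where "C = {x \<in> V. Q x}"
  have C: "C \<subseteq> V" "a \<in> C" "b \<notin> C" using assms(4,7) \<open>\<not> Q b\<close> by (auto simp: C_def)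
  note finC = finite_subset[OF C(1) finV]
  have "(\<Sum>x\<in>V. \<beta> x y) = (\<Sum>x\<in>C. \<beta> x y)" if "y \<in> C" for y
  proof (rule sum.mono_neutral_right[OF finV C(1)], rule ballI, rule ccontr)
    fix x assume x: "x \<in> V - C" "\<beta> x y \<noteq> 0"
    then have "x \<notin> F \<and> y \<notin> F \<and> x \<noteq> y \<and> insert y (insert x F) \<in> \<Delta>"
      using \<beta>(2)[OF x(2)] by (auto simp: slink_def insert_commute)
    then show False using step[of y x] x(1) that by (auto simp: C_def)
  qed
  then have "(\<Sum>y\<in>C. \<Sum>x\<in>V. \<beta> x y) = (\<Sum>y\<in>C. \<Sum>x\<in>C. \<beta> x y)"
    by (rule sum.cong[OF HOL.refl])
  also have "\<dots> = 0"
    by (rule sum_alternating_eq_0[OF finC, where a = "\<lambda>y x. \<beta> x y"]) (use \<beta>(2) in blast, rule \<beta>(1))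
  finally have "(\<Sum>y\<in>C. (if y = a then 1 else 0) - (if y = b then 1 else 0)) = (0 :: 'k)"
    by (simp only: \<beta>(3))
  then show False using C(2,3) finC by (simp add: sum_subtractf)
qed

text \<open>An arbitrary relation replaces chains of facets. The induction is on the codimension of
  a face \<open>F\<close> common to \<open>A\<close> and \<open>B\<close>: from codimension two on,
  the link of \<open>F\<close> is connected, and adjacent vertices \<open>x\<close>,
  \<open>y\<close> of it lie with \<open>F\<close> in one facet, which joins the facets through
  \<open>x\<close> to those through \<open>y\<close>.\<close>

lemma facets_related:
  assumes refl: "\<And>A. A \<in> facets \<Longrightarrow> R A A"
    and trans: "\<And>A B C. A \<in> facets \<Longrightarrow> B \<in> facets \<Longrightarrow> C \<in> facets \<Longrightarrow> R A B \<Longrightarrow> R B C \<Longrightarrow> R A C"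
    and adj: "\<And>H a b. insert a H \<in> facets \<Longrightarrow> insert b H \<in> facets \<Longrightarrow> a \<notin> H \<Longrightarrow> b \<notin> H \<Longrightarrow> a \<noteq> b \<Longrightarrow>
      R (insert a H) (insert b H)"
    and "A \<in> facets" "B \<in> facets"
  shows "R A B"
proof -
  have "R A B" if "F \<in> \<Delta>" "A \<in> facets" "B \<in> facets" "F \<subseteq> A" "F \<subseteq> B" for F A B
    using that
  proof (induction "d - card F" arbitrary: F A B rule: less_induct)
    case less
    note finF = face_finite[OF less.prems(1)]
    have A: "A \<in> \<Delta>" "card A = d" "finite A" and B: "B \<in> \<Delta>" "card B = d" "finite B"
      using less.prems(2,3) face_finite by (auto simp: facets_def)
    have le: "card F \<le> d" by (rule face_card_le[OF less.prems(1)])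
    consider "card F = d" | "card F + 1 = d" | "card F + 2 \<le> d" using le by linarith
    then show ?case
    proof cases
      case 1
      then have "F = A" "F = B"
        using card_subset_eq[OF A(3) less.prems(4)] card_subset_eq[OF B(3) less.prems(5)] A B by auto
      then show ?thesis using refl less.prems(2) by blast
    next
      case 2
      have "card (A - F) = 1" "card (B - F) = 1"
        using card_Diff_subset[OF finF less.prems(4)] card_Diff_subset[OF finF less.prems(5)] A B 2 by auto
      then obtain a b where ab: "A - F = {a}" "B - F = {b}" by (meson card_1_singletonE)
      then have eq: "A = insert a F" "B = insert b F" "a \<notin> F" "b \<notin> F" using less.prems(4,5) by blast+
      show ?thesis
      proof (cases "a = b")
        case True
        then show ?thesis using eq refl less.prems(2) by simp
      next
        case False
        then show ?thesis using adj[of a F b] eq less.prems(2,3) by simp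
      qed
    next
      case 3
      have up: "d - card (insert x F) < d - card F" if "x \<notin> F" for x
        using that finF 3 by simp
      have "A - F \<noteq> {}" "B - F \<noteq> {}"
        using card_mono[OF finF, of A] card_mono[OF finF, of B] A B 3 by auto
      then obtain a b where a: "a \<in> A" "a \<notin> F" and b: "b \<in> B" "b \<notin> F" by blast
      \<comment> \<open>Quantifying over all facets through \<open>x\<close> makes \<open>Q\<close>
        a property of the vertex, which can be carried along edges of the link.\<close>
      define Q where "Q x \<longleftrightarrow> (\<forall>D\<in>facets. insert x F \<subseteq> D \<longrightarrow> R A D)" for x
      have aF: "insert a F \<in> \<Delta>" and bF: "insert b F \<in> \<Delta>"
        using subface[OF A(1), of "insert a F"] subface[OF B(1), of "insert b F"] a b less.prems(4,5) by auto
      have "Q b"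
      proof (rule link_connected[OF less.prems(1) 3 a(2) aF b(2) bF])
        show "Q a"
          unfolding Q_def using less.hyps[OF up[OF a(2)] aF less.prems(2)] a(1) less.prems(4) by blast
        show "Q y" if xy: "x \<notin> F" "y \<notin> F" "insert x (insert y F) \<in> \<Delta>" "Q x" for x y
          unfolding Q_def
        proof (intro ballI impI)
          fix D assume D: "D \<in> facets" "insert y F \<subseteq> D"
          obtain C where C: "C \<in> facets" "insert x (insert y F) \<subseteq> C" using face_subset_facet[OF xy(3)] .
          have yF: "insert y F \<in> \<Delta>" using subface[OF xy(3)] by blast
          have "R A C" using xy(4) C unfolding Q_def by blast
          moreover have "R C D"
            using less.hyps[OF up[OF xy(2)] yF C(1) D(1)] C(2) D(2) by blast
          ultimately show "R A D" using trans less.prems(2) C(1) D(1) by blast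
        qed
      qed
      then show ?thesis unfolding Q_def using less.prems(3,5) b by blast
    qed
  qed
  from this[OF empty_face assms(4,5)] show ?thesis by simp
qed

end

lemma card_supersets_of_size:
  assumes "finite S" "K \<subseteq> S" "card K \<le> r"
  shows "card {T. T \<subseteq> S \<and> card T = r \<and> K \<subseteq> T} = (card S - card K) choose (r - card K)"
proof -
  have finK: "finite K" using assms(1,2) by (rule rev_finite_subset)
  have "bij_betw (\<lambda>U. U \<union> K) {U. U \<subseteq> S - K \<and> card U = r - card K} {T. T \<subseteq> S \<and> card T = r \<and> K \<subseteq> T}"
  proof (rule bij_betw_byWitness[where f' = "\<lambda>T. T - K"])
    show "(\<lambda>U. U \<union> K) ` {U. U \<subseteq> S - K \<and> card U = r - card K} \<subseteq> {T. T \<subseteq> S \<and> card T = r \<and> K \<subseteq> T}"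
    proof (rule image_subsetI)
      fix U assume "U \<in> {U. U \<subseteq> S - K \<and> card U = r - card K}"
      then have U: "U \<subseteq> S - K" "card U = r - card K" by auto
      then have "card (U \<union> K) = card U + card K"
        using finite_subset[OF U(1)] assms(1) finK by (intro card_Un_disjoint) auto
      then show "U \<union> K \<in> {T. T \<subseteq> S \<and> card T = r \<and> K \<subseteq> T}" using U assms(2,3) by auto
    qed
    show "(\<lambda>T. T - K) ` {T. T \<subseteq> S \<and> card T = r \<and> K \<subseteq> T} \<subseteq> {U. U \<subseteq> S - K \<and> card U = r - card K}"
      using card_Diff_subset[OF finK] by auto
  qed auto
  then have "card {T. T \<subseteq> S \<and> card T = r \<and> K \<subseteq> T} = card {U. U \<subseteq> S - K \<and> card U = r - card K}"
    by (rule bij_betw_same_card[symmetric])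
  also have "\<dots> = card (S - K) choose (r - card K)"
    using assms(1) by (intro n_subsets) auto
  finally show ?thesis using card_Diff_subset[OF finK assms(2)] by simp
qed

context colored_2cm
begin

section \<open>Rigidity on three colours, and averaging\<close>

definition selected :: "'c set \<Rightarrow> 'v set" where
  "selected T = {v \<in> V. \<kappa> v \<in> T}"

lemma selected_finite: "finite (selected T)"
  by (rule finite_subset[OF _ finV]) (auto simp: selected_def)

lemma facet_colors:
  assumes "A \<in> facets"
  shows "\<kappa> ` A = S"
proof -
  have "A \<in> \<Delta>" "card A = d" using assms by (auto simp: facets_def)
  then have "card (\<kappa> ` A) = card S" using card_image[OF color_inj] colors(2) by simp
  moreover have "\<kappa> ` A \<subseteq> S" using \<open>A \<in> \<Delta>\<close> color_range by blast
  ultimately show ?thesis using card_subset_eq[OF colors(1)] by blast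
qed

lemma card_facet_selected:
  assumes "A \<in> facets" "T \<subseteq> S"
  shows "card (A \<inter> selected T) = card T"
proof -
  have A: "A \<in> \<Delta>" using assms(1) by (auto simp: facets_def)
  have "A \<inter> selected T = {v \<in> A. \<kappa> v \<in> T}" using A by (auto simp: selected_def)
  then have "\<kappa> ` (A \<inter> selected T) = T"
    using facet_colors[OF assms(1)] assms(2) by blast
  moreover have "inj_on \<kappa> (A \<inter> selected T)" using color_inj[OF A] by (rule inj_on_subset) blast
  ultimately show ?thesis using card_image by metis
qed

lemma facet_rigid:
  assumes "A \<in> facets" "T \<subseteq> S" "card T = 3"
  shows "rigid \<Delta> (A \<inter> selected T)"
proof (rule rigid_complete)
  have A: "A \<in> \<Delta>" using assms(1) by (auto simp: facets_def)
  show "finite (A \<inter> selected T)" using face_finite[OF A] by simp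
  show "{x, y} \<in> \<Delta>" if "x \<in> A \<inter> selected T" "y \<in> A \<inter> selected T" for x y
    using subface[OF A, of "{x, y}"] that by blast
qed (use card_facet_selected[OF assms(1,2)] assms(3) in simp)

text \<open>\<open>a\<close> and \<open>b\<close> replace the one colour missing from
  \<open>H\<close>. If it is outside \<open>T\<close>, both facets have the same vertices over
  \<open>T\<close>; otherwise these form two triangles with a common edge in the link of the
  remaining vertices \<open>G\<close>.\<close>

lemma adjacent_facets_rigid:
  assumes T: "T \<subseteq> S" "card T = 3"
    and A: "insert a H \<in> facets" and B: "insert b H \<in> facets" and ab: "a \<notin> H" "b \<notin> H" "a \<noteq> b"
  shows "\<exists>X. rigid \<Delta> X \<and> X \<subseteq> selected T \<and> (insert a H \<union> insert b H) \<inter> selected T \<subseteq> X"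
proof -
  have faces: "insert a H \<in> \<Delta>" "insert b H \<in> \<Delta>" and dA: "card (insert a H) = d"
    using A B by (auto simp: facets_def)
  have finH: "finite H" using face_finite[OF faces(1)] by simp
  have "\<kappa> a \<notin> \<kappa> ` H" "\<kappa> b \<notin> \<kappa> ` H"
    using color_inj[OF faces(1)] color_inj[OF faces(2)] ab by auto
  then have col: "\<kappa> a = \<kappa> b"
    using facet_colors[OF A] facet_colors[OF B] by auto
  have V: "a \<in> V" "b \<in> V" using faces by blast+
  show ?thesis
  proof (cases "\<kappa> a \<in> T")
    case False
    then have "(insert a H \<union> insert b H) \<inter> selected T = insert a H \<inter> selected T"
      using col by (auto simp: selected_def)
    then show ?thesis using facet_rigid[OF A T] by blast
  next
    case True
    have Asel: "insert a H \<inter> selected T = insert a (H \<inter> selected T)"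
      and Bsel: "insert b H \<inter> selected T = insert b (H \<inter> selected T)"
      using True col V by (auto simp: selected_def)
    have "card (insert a (H \<inter> selected T)) = 3"
      using card_facet_selected[OF A T(1)] Asel T(2) by simp
    then have "card (H \<inter> selected T) = 2" using ab(1) finH by simp
    then obtain v w where vw: "H \<inter> selected T = {v, w}" "v \<noteq> w" by (auto simp: card_2_iff)
    define G where "G = H - selected T"
    have H: "H = insert v (insert w G)" "v \<notin> G" "w \<notin> G" using vw unfolding G_def by blast+
    have "card (insert a H) = card G + 3"
      using finH H vw(2) ab(1) by auto
    then have cardG: "card G + 3 \<le> d" using dA by simp
    have "G \<inter> {v, w, a, b} = {}" "distinct [v, w, a, b]" using H ab vw(2) by auto
    moreover have "insert v (insert w (insert a G)) \<in> \<Delta>" "insert v (insert w (insert b G)) \<in> \<Delta>"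
      using faces H(1) by (simp_all add: insert_commute)
    ultimately obtain X where X: "rigid \<Delta> X" "{v, w, a, b} \<subseteq> X" "\<And>x. x \<in> X \<Longrightarrow> x \<notin> G \<and> insert x G \<in> \<Delta>"
      using adjacent_triangles_rigid[OF cardG] by metis
    have "X \<subseteq> selected T"
    proof
      fix x assume "x \<in> X"
      then have x: "x \<notin> G" "insert x G \<in> \<Delta>" using X(3) by blast+
      then have "x \<in> V" by blast
      show "x \<in> selected T"
      \<comment> \<open>\<open>G\<close> already uses every colour outside \<open>T\<close>, so a
        vertex of its link cannot have such a colour.\<close>
      proof (rule ccontr)
        assume "x \<notin> selected T"
        then have "\<kappa> x \<notin> T" using \<open>x \<in> V\<close> unfolding selected_def by blast
        obtain y where y: "y \<in> insert a H" "\<kappa> y = \<kappa> x"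
          using facet_colors[OF A] color_range \<open>x \<in> V\<close> by (metis image_iff subsetD)
        then have "y \<in> G" using \<open>\<kappa> x \<notin> T\<close> True by (auto simp: G_def selected_def)
        then show False using inj_onD[OF color_inj[OF x(2)] y(2)] x(1) by blast
      qed
    qed
    moreover have "(insert a H \<union> insert b H) \<inter> selected T \<subseteq> X"
      using X(2) Asel Bsel vw(1) by blast
    ultimately show ?thesis using X(1) by blast
  qed
qed

text \<open>Transitivity is gluing: both rigid sets contain the three vertices of the middle facet
  with colours in \<open>T\<close>.\<close>

lemma facets_rigid:
  assumes T: "T \<subseteq> S" "card T = 3" and "A \<in> facets" "B \<in> facets"
  shows "\<exists>X. rigid \<Delta> X \<and> X \<subseteq> selected T \<and> (A \<union> B) \<inter> selected T \<subseteq> X"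
proof (rule facets_related[OF _ _ _ assms(3,4)])
  fix A assume "A \<in> facets"
  then show "\<exists>X. rigid \<Delta> X \<and> X \<subseteq> selected T \<and> (A \<union> A) \<inter> selected T \<subseteq> X"
    using facet_rigid[OF _ T] by auto
next
  fix A B C assume "B \<in> facets"
    and "\<exists>X. rigid \<Delta> X \<and> X \<subseteq> selected T \<and> (A \<union> B) \<inter> selected T \<subseteq> X"
    and "\<exists>X. rigid \<Delta> X \<and> X \<subseteq> selected T \<and> (B \<union> C) \<inter> selected T \<subseteq> X"
  then obtain X Y where X: "rigid \<Delta> X" "X \<subseteq> selected T" "(A \<union> B) \<inter> selected T \<subseteq> X"
    and Y: "rigid \<Delta> Y" "Y \<subseteq> selected T" "(B \<union> C) \<inter> selected T \<subseteq> Y" by blast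
  have fin: "finite X" "finite Y"
    using finite_subset[OF X(2) selected_finite] finite_subset[OF Y(2) selected_finite] .
  have "card (B \<inter> selected T) \<le> card (X \<inter> Y)"
    using fin X(3) Y(3) by (intro card_mono) auto
  then have "rigid \<Delta> (X \<union> Y)"
    using card_facet_selected[OF \<open>B \<in> facets\<close> T(1)] T(2) by (intro rigid_Un fin X(1) Y(1)) simp
  then show "\<exists>X. rigid \<Delta> X \<and> X \<subseteq> selected T \<and> (A \<union> C) \<inter> selected T \<subseteq> X"
    using X(2,3) Y(2,3) by (intro exI[of _ "X \<union> Y"]) blast
qed (rule adjacent_facets_rigid[OF T])

text \<open>All facets are accumulated around one fixed facet \<open>A\<close>, whose three vertices
  over \<open>T\<close> serve for every gluing; facets cover all vertices.\<close>

lemma selected_rigid: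
  assumes T: "T \<subseteq> S" "card T = 3"
  shows "rigid \<Delta> (selected T)"
proof -
  obtain A where A: "A \<in> facets" using face_subset_facet[OF empty_face] by blast
  have rigid_hull: "\<exists>X. rigid \<Delta> X \<and> X \<subseteq> selected T \<and> A \<inter> selected T \<subseteq> X \<and> \<Union>\<B> \<inter> selected T \<subseteq> X"
    if "finite \<B>" "\<B> \<subseteq> facets" for \<B>
    using that
  proof (induction \<B> rule: finite_induct)
    case empty
    then show ?case using facet_rigid[OF A T] by auto
  next
    case (insert B \<B>)
    then obtain X where X: "rigid \<Delta> X" "X \<subseteq> selected T" "A \<inter> selected T \<subseteq> X" "\<Union>\<B> \<inter> selected T \<subseteq> X"
      by blast
    obtain Y where Y: "rigid \<Delta> Y" "Y \<subseteq> selected T" "(A \<union> B) \<inter> selected T \<subseteq> Y"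
      using facets_rigid[OF T A, of B] insert.prems by blast
    have fin: "finite X" "finite Y"
      using finite_subset[OF X(2) selected_finite] finite_subset[OF Y(2) selected_finite] .
    have "card (A \<inter> selected T) \<le> card (X \<inter> Y)"
      using fin X(3) Y(3) by (intro card_mono) auto
    then have "rigid \<Delta> (X \<union> Y)"
      using card_facet_selected[OF A T(1)] T(2) by (intro rigid_Un fin X(1) Y(1)) simp
    then show ?case
      using X(2-4) Y(2,3) by (intro exI[of _ "X \<union> Y"]) blast
  qed
  have "finite facets"
    using finV by (intro finite_subset[of facets "Pow V"]) (auto simp: facets_def)
  then obtain X where X: "rigid \<Delta> X" "X \<subseteq> selected T" "\<Union>facets \<inter> selected T \<subseteq> X"
    using rigid_hull[of facets] by blast
  have "selected T \<subseteq> \<Union>facets"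
  proof
    fix v assume "v \<in> selected T"
    then have "{v} \<in> \<Delta>" using vertex_face by (simp add: selected_def)
    then show "v \<in> \<Union>facets" using face_subset_facet by blast
  qed
  then have "X = selected T" using X by blast
  with X(1) show ?thesis by simp
qed

text \<open>Double counting over colour triples; since \<open>card F\<close> colours are prescribed,
  each vertex is counted \<open>(d - 1) choose 2\<close> times and each edge \<open>d - 2\<close>
  times.\<close>

lemma edge_bound:
  assumes "d \<ge> 3"
  shows "3 * card V * (d - 1) \<le> 2 * card {e \<in> \<Delta>. card e = 2} + 2 * d * (d - 1)"
proof -
  define \<T> where "\<T> = {T. T \<subseteq> S \<and> card T = 3}"
  let ?E = "{e \<in> \<Delta>. card e = 2}"
  have fin\<T>: "finite \<T>" using colors(1) by (simp add: \<T>_def)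
  have finE: "finite ?E" by (rule finite_subset[of _ "Pow V"]) (use finV in auto)
  have supersets: "card {T \<in> \<T>. \<kappa> ` F \<subseteq> T} = (d - card F) choose (3 - card F)"
    if "F \<in> \<Delta>" "card F \<le> 3" for F
  proof -
    have "card (\<kappa> ` F) = card F" by (rule card_image[OF color_inj[OF that(1)]])
    moreover have "\<kappa> ` F \<subseteq> S" using color_range that(1) by blast
    moreover have "{T \<in> \<T>. \<kappa> ` F \<subseteq> T} = {T. T \<subseteq> S \<and> card T = 3 \<and> \<kappa> ` F \<subseteq> T}" by (auto simp: \<T>_def)
    ultimately show ?thesis using card_supersets_of_size[OF colors(1), of "\<kappa> ` F" 3] that(2) colors(2) by simp
  qed
  have "(\<Sum>T\<in>\<T>. card {v \<in> V. \<kappa> v \<in> T}) = (\<Sum>v\<in>V. (d - 1) choose 2)"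
  proof (rule sum_multicount_gen[OF fin\<T> finV], rule ballI)
    show "card {T \<in> \<T>. \<kappa> v \<in> T} = (d - 1) choose 2" if "v \<in> V" for v
      using supersets[OF vertex_face[OF that]] by simp
  qed
  then have verts: "(\<Sum>T\<in>\<T>. card (selected T)) = card V * ((d - 1) choose 2)"
    by (simp add: selected_def)
  have "(\<Sum>T\<in>\<T>. card {e \<in> ?E. \<kappa> ` e \<subseteq> T}) = (\<Sum>e\<in>?E. d - 2)"
  proof (rule sum_multicount_gen[OF fin\<T> finE], rule ballI)
    show "card {T \<in> \<T>. \<kappa> ` e \<subseteq> T} = d - 2" if "e \<in> ?E" for e
      using supersets[of e] that by simp
  qed
  moreover have "{e \<in> ?E. \<kappa> ` e \<subseteq> T} = {e \<in> \<Delta>. e \<subseteq> selected T \<and> card e = 2}" for T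
    by (auto simp: selected_def)
  ultimately have edges: "(\<Sum>T\<in>\<T>. card {e \<in> \<Delta>. e \<subseteq> selected T \<and> card e = 2}) = card ?E * (d - 2)"
    by simp
  have "3 * card (selected T) \<le> card {e \<in> \<Delta>. e \<subseteq> selected T \<and> card e = 2} + 6" if "T \<in> \<T>" for T
    using that by (intro rigid_edge_bound selected_rigid selected_finite) (auto simp: \<T>_def)
  then have "(\<Sum>T\<in>\<T>. 3 * card (selected T)) \<le> (\<Sum>T\<in>\<T>. card {e \<in> \<Delta>. e \<subseteq> selected T \<and> card e = 2} + 6)"
    by (rule sum_mono)
  then have main: "3 * (card V * ((d - 1) choose 2)) \<le> card ?E * (d - 2) + 6 * card \<T>"
    by (simp add: sum_distrib_left[symmetric] sum.distrib verts edges)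
  have "card \<T> = d choose 3"
    unfolding \<T>_def using n_subsets[OF colors(1), of 3] colors(2) by simp
  then have three: "3 * card \<T> = d * ((d - 1) choose 2)"
    using times_binomial_minus1_eq[of 3 d] by simp
  have two: "2 * ((d - 1) choose 2) = (d - 1) * (d - 2)"
    using times_binomial_minus1_eq[of 2 "d - 1"] assms by (simp add: numeral_2_eq_2)
  \<comment> \<open>The averaged inequality is doubled so that all binomials become products; the
    common factor \<open>d - 2\<close> is positive and cancels at the end.\<close>
  have "(3 * card V * (d - 1)) * (d - 2) = 3 * card V * (2 * ((d - 1) choose 2))"
    by (simp only: two mult.assoc)
  also have "\<dots> = 2 * (3 * (card V * ((d - 1) choose 2)))"
    by (simp only: mult_ac)
  also have "\<dots> \<le> 2 * (card ?E * (d - 2) + 2 * (3 * card \<T>))"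
    by (rule order.trans[OF mult_le_mono2[OF main]]) simp
  also have "\<dots> = 2 * (card ?E * (d - 2)) + 2 * (d * (2 * ((d - 1) choose 2)))"
    by (simp only: three distrib_left mult.left_commute[of d 2])
  also have "\<dots> = (2 * card ?E + 2 * d * (d - 1)) * (d - 2)"
    by (simp only: two distrib_right mult.assoc)
  finally show ?thesis using assms by simp
qed

section \<open>Vertex degrees and vertex links\<close>

lemma incidences:
  "(\<Sum>v\<in>V. card {F \<in> \<Delta>. card F = j \<and> v \<in> F}) = j * card {F \<in> \<Delta>. card F = j}"
proof -
  have fin: "finite {F \<in> \<Delta>. card F = j}" by (rule finite_subset[of _ "Pow V"]) (use finV in auto)
  have "(\<Sum>v\<in>V. card {F \<in> {F \<in> \<Delta>. card F = j}. v \<in> F}) = (\<Sum>F\<in>{F \<in> \<Delta>. card F = j}. j)"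
  proof (rule sum_multicount_gen[OF finV fin], rule ballI)
    show "card {v \<in> V. v \<in> F} = j" if "F \<in> {F \<in> \<Delta>. card F = j}" for F
    proof -
      have "{v \<in> V. v \<in> F} = F" using that by blast
      then show ?thesis using that by simp
    qed
  qed
  then show ?thesis by (simp add: conj_assoc)
qed

text \<open>The second neighbour exists because the link of \<open>v\<close> is nonempty even after
  the first is deleted. This covers \<open>d = 2\<close>, where there are no colour triples.\<close>

lemma two_edges_at_vertex:
  assumes "v \<in> V" "d \<ge> 2"
  shows "card {F \<in> \<Delta>. card F = 2 \<and> v \<in> F} \<ge> 2"
proof -
  have v: "{v} \<in> \<Delta>" using vertex_face[OF assms(1)] .
  obtain a where a: "a \<noteq> v" "{a, v} \<in> \<Delta>" using extend_face[OF v, of "{}"] assms(2) by auto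
  obtain b where b: "b \<noteq> v" "b \<noteq> a" "{b, v} \<in> \<Delta>" using extend_face[OF v, of "{a}"] assms(2) a by auto
  have "card {{a, v}, {b, v}} = 2" using a b by (auto simp: doubleton_eq_iff)
  moreover have "{{a, v}, {b, v}} \<subseteq> {F \<in> \<Delta>. card F = 2 \<and> v \<in> F}" using a b by auto
  moreover have "finite {F \<in> \<Delta>. card F = 2 \<and> v \<in> F}"
    by (rule finite_subset[of _ "Pow V"]) (use finV in auto)
  ultimately show ?thesis using card_mono[of "{F \<in> \<Delta>. card F = 2 \<and> v \<in> F}" "{{a, v}, {b, v}}"] by linarith
qed

lemma link_faces_card:
  assumes "v \<in> V"
  shows "card {G \<in> link \<Delta> {v}. card G = j} = card {F \<in> \<Delta>. card F = Suc j \<and> v \<in> F}"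
proof (rule bij_betw_same_card[of "insert v"], rule bij_betw_byWitness[where f' = "\<lambda>F. F - {v}"])
  show "insert v ` {G \<in> link \<Delta> {v}. card G = j} \<subseteq> {F \<in> \<Delta>. card F = Suc j \<and> v \<in> F}"
    using face_finite by (auto simp: link_def)
  show "(\<lambda>F. F - {v}) ` {F \<in> \<Delta>. card F = Suc j \<and> v \<in> F} \<subseteq> {G \<in> link \<Delta> {v}. card G = j}"
    using subface by (auto simp: link_def insert_absorb)
qed (auto simp: link_def)

lemma link_colored_2cm:
  assumes "v \<in> V"
  shows "colored_2cm k (link \<Delta> {v}) (d - 1) \<kappa> (S - {\<kappa> v})"
proof
  let ?L = "link \<Delta> {v}"
  have L: "G \<in> ?L \<longleftrightarrow> v \<notin> G \<and> insert v G \<in> \<Delta>" for G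
    using subface by (auto simp: link_def)
  show "simplicial_complex (\<Union>?L) ?L"
    unfolding simplicial_complex_def
  proof (intro conjI ballI allI impI)
    show "finite (\<Union>?L)" by (rule finite_subset[OF _ finV]) (auto simp: link_def)
    show "{} \<in> ?L" using vertex_face[OF assms] by (simp add: L)
    show closed: "H \<in> ?L" if "G \<in> ?L" "H \<subseteq> G" for G H
      using that subface[of "insert v G" "insert v H"] by (auto simp: L)
    show "{x} \<in> ?L" if "x \<in> \<Union>?L" for x using that closed by blast
  qed auto
  show "trivial_group (reduced_homology k {G \<in> ?L. F \<union> G \<in> ?L \<and> G \<inter> (F \<union> W) = {}} m)"
    if F: "F \<in> ?L" and W: "finite W" "card W \<le> 1" "F \<inter> W = {}" and m: "m + 1 + int (card F) < int (d - 1)" for F W m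
  proof -
    \<comment> \<open>A link in the link of \<open>v\<close> is the link of the enlarged face.
      \<open>W\<close> may contain \<open>v\<close>, so \<open>v\<close> is removed from it to stay
      disjoint from \<open>insert v F\<close>.\<close>
    have eq: "{G \<in> ?L. F \<union> G \<in> ?L \<and> G \<inter> (F \<union> W) = {}}
        = {G \<in> \<Delta>. insert v F \<union> G \<in> \<Delta> \<and> G \<inter> (insert v F \<union> (W - {v})) = {}}"
    proof (intro equalityI subsetI)
      fix G assume "G \<in> {G \<in> ?L. F \<union> G \<in> ?L \<and> G \<inter> (F \<union> W) = {}}"
      then have G: "v \<notin> G" "insert v G \<in> \<Delta>" "insert v F \<union> G \<in> \<Delta>" "G \<inter> (F \<union> W) = {}"
        by (simp_all add: L)
      then show "G \<in> {G \<in> \<Delta>. insert v F \<union> G \<in> \<Delta> \<and> G \<inter> (insert v F \<union> (W - {v})) = {}}"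
        using subface[OF G(2), of G] by blast
    next
      fix G assume "G \<in> {G \<in> \<Delta>. insert v F \<union> G \<in> \<Delta> \<and> G \<inter> (insert v F \<union> (W - {v})) = {}}"
      then have G: "G \<in> \<Delta>" "insert v F \<union> G \<in> \<Delta>" "v \<notin> G" "G \<inter> (F \<union> W) = {}" by blast+
      then show "G \<in> {G \<in> ?L. F \<union> G \<in> ?L \<and> G \<inter> (F \<union> W) = {}}"
        using subface[OF G(2), of "insert v G"] F by (auto simp: L)
    qed
    have "v \<notin> F" "insert v F \<in> \<Delta>" using F by (simp_all add: L)
    then have "card (insert v F) = Suc (card F)" using face_finite[of "insert v F"] by simp
    moreover have "int (d - 1) = int d - 1" using face_card_le[OF vertex_face[OF assms]] by simp
    moreover have "card (W - {v}) \<le> 1" using card_Diff1_le[of W v] W(2) by linarith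
    ultimately show ?thesis
      unfolding eq using \<open>insert v F \<in> \<Delta>\<close> W m by (intro acyclic) auto
  qed
  show "inj_on \<kappa> F" if "F \<in> ?L" for F using that color_inj by (simp add: link_def)
  show "\<kappa> ` \<Union>?L \<subseteq> S - {\<kappa> v}"
  proof
    fix c assume "c \<in> \<kappa> ` \<Union>?L"
    then obtain x F where x: "c = \<kappa> x" "x \<in> F" "F \<in> ?L" by blast
    then have xv: "insert v F \<in> \<Delta>" "x \<noteq> v" by (auto simp: L)
    then have "\<kappa> x \<noteq> \<kappa> v" using inj_onD[OF color_inj[OF xv(1)], of x v] x(2) by auto
    moreover have "x \<in> V" using xv(1) x(2) by blast
    then have "\<kappa> x \<in> S" using color_range by blast
    ultimately show "c \<in> S - {\<kappa> v}" using x(1) by simp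
  qed
  have "\<kappa> v \<in> S" using color_range assms by blast
  then show "finite (S - {\<kappa> v})" "card (S - {\<kappa> v}) = d - 1"
    using colors by simp_all
qed

end

section \<open>Lower bounds\<close>

lemma psi_low:
  assumes "2 \<le> j" "j \<le> d - 1"
  shows "psi (j - 1) n (d - 1)
    = int ((d - 1) choose (j - 1)) * ((2 ^ j - 1) * (int n - int d) + int d)"
proof -
  have "j - 1 + 1 = j" "d - 1 + 1 = d" using assms by auto
  then show ?thesis using assms(2) by (simp add: psi_def Let_def algebra_simps)
qed

lemma psi_top:
  assumes "2 \<le> d"
  shows "psi (d - 1) n (d - 1) = (2 ^ d - 2) * (int n - int d) + 2 * int d"
proof -
  have d: "d - 1 + 1 = d" "\<not> d \<le> d - 1" using assms by auto
  show ?thesis unfolding psi_def Let_def d(1) using d(2) by (simp only: if_False)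
qed

text \<open>\<open>m v\<close> stands for the degree of \<open>v\<close>, and \<open>edges\<close>
  is the edge bound with the degree sum in place of twice the number of edges. As \<open>psi\<close>
  is affine in the vertex number, summing it over links needs only that degree sum.\<close>

lemma psi_step:
  assumes "3 \<le> j" "j \<le> d" "finite A"
    and edges: "3 * int n * (int d - 1) \<le> (\<Sum>v\<in>A. int (m v)) + 2 * int d * (int d - 1)" and n: "card A = n"
  shows "(int j - 1) * psi (j - 1) n (d - 1) \<le> (\<Sum>v\<in>A. psi (j - 2) (m v) (d - 2))"
proof -
  \<comment> \<open>\<alpha> and \<beta> parametrise both branches of \<open>psi\<close> for the
    links; the edge bound says that the numbers \<open>m v - (d - 1)\<close> sum to at least
    \<open>2 (d - 1) (n - d)\<close>.\<close>
  have linear: "(int d - 1) * (2 * \<alpha> * (int n - int d) + int n * \<beta>) \<le> (\<Sum>v\<in>A. \<alpha> * (int (m v) - (int d - 1)) + (int d - 1) * \<beta>)"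
    if "\<alpha> \<ge> 0" for \<alpha> \<beta> :: int
  proof -
    have "2 * (int d - 1) * (int n - int d) \<le> (\<Sum>v\<in>A. int (m v)) - int n * (int d - 1)"
      using edges by (simp add: algebra_simps)
    then have "\<alpha> * (2 * (int d - 1) * (int n - int d)) \<le> \<alpha> * ((\<Sum>v\<in>A. int (m v)) - int n * (int d - 1))"
      using that by (rule mult_left_mono)
    moreover have "(\<Sum>v\<in>A. \<alpha> * (int (m v) - (int d - 1)) + (int d - 1) * \<beta>)
        = \<alpha> * ((\<Sum>v\<in>A. int (m v)) - int n * (int d - 1)) + int n * ((int d - 1) * \<beta>)"
      using n by (simp add: sum.distrib sum_distrib_left[symmetric] sum_subtractf)
    ultimately show ?thesis by (simp add: algebra_simps)
  qed
  have eq: "j - 1 - 1 = j - 2" "d - 1 - 1 = d - 2" "int (d - 1) = int d - 1" using assms by auto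
  show ?thesis
  \<comment> \<open>The branches match: links have dimension one less, so their top case is
    \<open>j = d\<close> again. The slopes fit because \<open>2^d - 2\<close> and
    \<open>2^j - 1\<close> are twice the previous slope plus 2 and plus 1.\<close>
  proof (cases "j = d")
    case True
    have pow: "(2 :: int) ^ d = 2 * 2 ^ (d - 1)" using assms by (simp add: power_eq_if)
    have one: "(1 :: int) \<le> 2 ^ (d - 2)" by simp
    have pow': "(2 :: int) ^ (d - 1) = 2 * 2 ^ (d - 2)"
    proof -
      have "d - 1 = Suc (d - 2)" using assms by simp
      then show ?thesis by simp
    qed
    have "psi (j - 2) (m v) (d - 2) = (2 ^ (d - 1) - 2) * (int (m v) - (int d - 1)) + (int d - 1) * 2" for v
      using psi_top[of "d - 1" "m v"] assms(1,2) True eq by simp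
    moreover have "(int j - 1) * psi (j - 1) n (d - 1)
        = (int d - 1) * (2 * (2 ^ (d - 1) - 2) * (int n - int d) + int n * 2)"
    proof -
      have "2 \<le> d" using assms(1,2) by simp
      then show ?thesis unfolding True psi_top[OF \<open>2 \<le> d\<close>] pow by (simp add: algebra_simps)
    qed
    ultimately show ?thesis using linear[of "2 ^ (d - 1) - 2" 2] one pow' by simp
  next
    case False
    define c where "c = int ((d - 2) choose (j - 2))"
    have pow: "(2 :: int) ^ j = 2 * 2 ^ (j - 1)" using assms by (simp add: power_eq_if)
    have "psi (j - 2) (m v) (d - 2) = (2 ^ (j - 1) - 1) * c * (int (m v) - (int d - 1)) + (int d - 1) * c" for v
      using psi_low[of "j - 1" "d - 1" "m v"] assms(1,2) False eq by (simp add: c_def algebra_simps)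
    moreover have "(j - 1) * ((d - 1) choose (j - 1)) = (d - 1) * ((d - 2) choose (j - 2))"
      using times_binomial_minus1_eq[of "j - 1" "d - 1"] assms eq by simp
    then have "int ((j - 1) * ((d - 1) choose (j - 1))) = int ((d - 1) * ((d - 2) choose (j - 2)))" by simp
    then have "(int j - 1) * int ((d - 1) choose (j - 1)) = (int d - 1) * c"
      using assms(1,2) by (simp add: c_def of_nat_diff)
    then have "(int j - 1) * psi (j - 1) n (d - 1) = ((int d - 1) * c) * ((2 ^ j - 1) * (int n - int d) + int d)"
      using psi_low[of j d n] assms False by simp
    then have "(int j - 1) * psi (j - 1) n (d - 1)
        = (int d - 1) * (2 * ((2 ^ (j - 1) - 1) * c) * (int n - int d) + int n * c)"
      unfolding pow by (simp add: algebra_simps)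
    moreover have "(2 ^ (j - 1) - 1) * c \<ge> 0" by (simp add: c_def)
    ultimately show ?thesis using linear[of "(2 ^ (j - 1) - 1) * c" c] by simp
  qed
qed

context colored_2cm
begin

lemma link_vertices_card:
  assumes "v \<in> V"
  shows "card (\<Union>(link \<Delta> {v})) = card {F \<in> \<Delta>. card F = 2 \<and> v \<in> F}"
proof -
  interpret L: colored_2cm k "link \<Delta> {v}" "d - 1" \<kappa> "S - {\<kappa> v}"
    by (rule link_colored_2cm[OF assms])
  have "{G \<in> link \<Delta> {v}. card G = 1} = (\<lambda>x. {x}) ` \<Union>(link \<Delta> {v})"
    using L.vertex_face by (auto simp: card_1_singleton_iff)
  then have "card {G \<in> link \<Delta> {v}. card G = 1} = card (\<Union>(link \<Delta> {v}))"
    by (simp add: card_image)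
  then show ?thesis using link_faces_card[OF assms, of 1] by (simp add: numeral_2_eq_2)
qed

lemma edge_bound_int:
  assumes "d \<ge> 3"
  shows "3 * int (card V) * (int d - 1) \<le> 2 * int (card {e \<in> \<Delta>. card e = 2}) + 2 * int d * (int d - 1)"
proof -
  have "int (3 * card V * (d - 1)) \<le> int (2 * card {e \<in> \<Delta>. card e = 2} + 2 * d * (d - 1))"
    using edge_bound[OF assms] by (simp only: of_nat_le_iff)
  then show ?thesis using assms by (simp add: of_nat_diff)
qed

end

text \<open>The step from \<open>j - 1\<close> to \<open>j\<close> is the McMullen--Perles--Walkup reduction: sum the bound over all vertex links.\<close>

lemma face_bound:
  fixes k :: "'k::idom itself"
  assumes "colored_2cm k \<Delta> d \<kappa> S" "2 \<le> j" "j \<le> d"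
  shows "psi (j - 1) (card (\<Union>\<Delta>)) (d - 1) \<le> int j * int (card {F \<in> \<Delta>. card F = j})"
  using assms(2,1,3)
proof (induction j arbitrary: \<Delta> d S rule: nat_induct_at_least)
  case base
  interpret colored_2cm k \<Delta> d \<kappa> S by fact
  show ?case
  proof (cases "d = 2")
    \<comment> \<open>Here \<open>psi\<close> takes the value \<open>2 n\<close>, so it is enough
      that every vertex has degree at least two.\<close>
    case True
    have "(\<Sum>v\<in>V. 2) \<le> (\<Sum>v\<in>V. card {F \<in> \<Delta>. card F = 2 \<and> v \<in> F})"
      by (rule sum_mono) (use two_edges_at_vertex True in simp)
    then have "card V * 2 \<le> 2 * card {F \<in> \<Delta>. card F = 2}" by (simp add: incidences)
    then have "int (card V * 2) \<le> int (2 * card {F \<in> \<Delta>. card F = 2})" by (simp only: of_nat_le_iff)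
    then show ?thesis using psi_top[of 2 "card V"] True by simp
  next
    case False
    then have d: "d \<ge> 3" "2 \<le> d - 1" using base by simp_all
    show ?thesis
      using edge_bound_int[OF d(1)] psi_low[OF order.refl d(2), of "card V"] d(1)
      by (simp add: of_nat_diff algebra_simps)
  qed
next
  case (Suc j)
  interpret colored_2cm k \<Delta> d \<kappa> S by fact
  let ?f = "\<lambda>v. card (\<Union>(link \<Delta> {v}))"
  have d: "d \<ge> 3" using Suc.hyps Suc.prems(2) by simp
  have link: "psi (j - 1) (?f v) (d - 1 - 1) \<le> int j * int (card {F \<in> \<Delta>. card F = Suc j \<and> v \<in> F})"
    if "v \<in> V" for v
    using Suc.IH[OF link_colored_2cm[OF that]] Suc.prems(2) link_faces_card[OF that, of j] by simp
  have "(\<Sum>v\<in>V. int (?f v)) = int (\<Sum>v\<in>V. card {F \<in> \<Delta>. card F = 2 \<and> v \<in> F})"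
    using link_vertices_card by simp
  \<comment> \<open>The vertices of a link count the edges at its apex, so the edge bound becomes
    the hypothesis \<open>edges\<close> of \<open>psi_step\<close>.\<close>
  then have deg: "(\<Sum>v\<in>V. int (?f v)) = 2 * int (card {F \<in> \<Delta>. card F = 2})"
    unfolding incidences by simp
  have "int j * psi (Suc j - 1) (card V) (d - 1) \<le> (\<Sum>v\<in>V. psi (Suc j - 2) (?f v) (d - 2))"
    using psi_step[of "Suc j" d V "card V" ?f] edge_bound_int[OF d] finV Suc.hyps Suc.prems(2)
    unfolding deg by simp
  also have "\<dots> \<le> (\<Sum>v\<in>V. int j * int (card {F \<in> \<Delta>. card F = Suc j \<and> v \<in> F}))"
    using link by (intro sum_mono) (simp add: numeral_2_eq_2)
  also have "\<dots> = int j * int (\<Sum>v\<in>V. card {F \<in> \<Delta>. card F = Suc j \<and> v \<in> F})"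
    by (simp add: sum_distrib_left)
  also have "\<dots> = int j * (int (Suc j) * int (card {F \<in> \<Delta>. card F = Suc j}))"
    by (simp only: incidences of_nat_mult)
  finally show ?case using Suc.hyps by (simp only: mult_le_cancel_left_pos of_nat_0_less_iff)
qed

section \<open>The numbers h_1 and h_2, and transfer to the given hypotheses\<close>

lemma coeff_one_minus_x_power:
  shows "coeff ([:1, -1:] ^ n) 0 = (1 :: int)"
    and "coeff ([:1, -1:] ^ n) (Suc 0) = - int n"
    and "coeff ([:1, -1:] ^ n) 2 = int (n choose 2)"
proof -
  have "coeff ([:1, -1:] ^ n) 0 = (1 :: int) \<and> coeff ([:1, -1:] ^ n) (Suc 0) = - int n
      \<and> coeff ([:1, -1:] ^ n) 2 = int (n choose 2)"
    by (induction n) (simp_all add: numeral_2_eq_2)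
  then show "coeff ([:1, -1:] ^ n) 0 = (1 :: int)" "coeff ([:1, -1:] ^ n) (Suc 0) = - int n"
    "coeff ([:1, -1:] ^ n) 2 = int (n choose 2)" by blast+
qed

lemma h_num_small:
  assumes "complex_dim \<Delta> = int d - 1" "d \<ge> 2" "{} \<in> \<Delta>" "finite \<Delta>"
    and f: "\<And>j. f_num \<Delta> (int j - 1) = card {F \<in> \<Delta>. card F = j}" and "\<And>F. F \<in> \<Delta> \<Longrightarrow> finite F"
  shows "h_num \<Delta> 1 = int (f_num \<Delta> 0) - int d"
    and "h_num \<Delta> 2 = int (f_num \<Delta> 1) - (int d - 1) * int (f_num \<Delta> 0) + int (d choose 2)"
proof -
  have d: "nat (complex_dim \<Delta> + 1) = d" using assms(1) by simp
  have "{F \<in> \<Delta>. card F = 0} = {{}}" using assms(3,6) by auto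
  then have f0: "f_num \<Delta> (- 1) = 1" using f[of 0] by simp
  have "h_num \<Delta> i = (\<Sum>j\<in>{0, 1, 2}. if i < j then 0
      else int (f_num \<Delta> (int j - 1)) * coeff ([:1, -1:] ^ (d - j)) (i - j))" if "i \<le> 2" for i
  proof -
    have "h_num \<Delta> i = (\<Sum>j\<le>d. if i < j then 0
        else int (f_num \<Delta> (int j - 1)) * coeff ([:1, -1:] ^ (d - j)) (i - j))"
      by (simp add: h_num_def h_poly_def Let_def d coeff_sum coeff_monom_mult)
    also have "\<dots> = (\<Sum>j\<in>{0, 1, 2}. if i < j then 0
        else int (f_num \<Delta> (int j - 1)) * coeff ([:1, -1:] ^ (d - j)) (i - j))"
      using assms(2) that by (intro sum.mono_neutral_right) auto
    finally show ?thesis .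
  qed
  from this[of 1] this[of 2]
  show "h_num \<Delta> 1 = int (f_num \<Delta> 0) - int d"
    and "h_num \<Delta> 2 = int (f_num \<Delta> 1) - (int d - 1) * int (f_num \<Delta> 0) + int (d choose 2)"
    using assms(2) by (simp_all add: f0 coeff_one_minus_x_power of_nat_diff algebra_simps)
qed

lemma two_cohen_macaulay_colored:
  fixes k :: "'k::idom itself"
  assumes sc: "simplicial_complex V \<Delta>" and dim: "complex_dim \<Delta> = int d - 1"
    and bal: "balanced V \<Delta>" and cm: "two_cohen_macaulay k V \<Delta>"
  obtains \<kappa> :: "'v \<Rightarrow> nat" where "colored_2cm k \<Delta> d \<kappa> {1..d}"
proof -
  have V: "\<Union>\<Delta> = V" using sc unfolding simplicial_complex_def by blast
  obtain \<kappa> :: "'v \<Rightarrow> nat" where \<kappa>: "\<kappa> ` V \<subseteq> {1..d}"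
    "\<And>F v w. F \<in> \<Delta> \<Longrightarrow> v \<in> F \<Longrightarrow> w \<in> F \<Longrightarrow> v \<noteq> w \<Longrightarrow> \<kappa> v \<noteq> \<kappa> w"
    using bal dim unfolding balanced_def by auto
  have "colored_2cm k \<Delta> d \<kappa> {1..d}"
  proof
    show "simplicial_complex (\<Union>\<Delta>) \<Delta>" using sc V by simp
    show "trivial_group (reduced_homology k {G \<in> \<Delta>. F \<union> G \<in> \<Delta> \<and> G \<inter> (F \<union> W) = {}} m)"
      if F: "F \<in> \<Delta>" and W: "finite W" "card W \<le> 1" "F \<inter> W = {}" and m: "m + 1 + int (card F) < int d" for F W m
    proof -
      \<comment> \<open>\<open>W\<close> may have a point outside \<open>V\<close>; intersecting
        with \<open>V\<close> makes it admissible for the deletion and leaves the link unchanged.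
        The deletion keeps the dimension, hence also the range of \<open>m\<close>.\<close>
      let ?D = "deletion V \<Delta> (W \<inter> V)"
      have "card (W \<inter> V) \<le> 1" using card_mono[OF W(1), of "W \<inter> V"] W(2) by auto
      then have D: "cohen_macaulay k ?D" "complex_dim ?D = int d - 1"
        using cm dim unfolding two_cohen_macaulay_def by auto
      have "F \<in> ?D" using F W(3) V by (auto simp: deletion_def)
      moreover have "m < complex_dim ?D - int (card F)" using m D(2) by simp
      ultimately have "trivial_group (reduced_homology k (link ?D F) m)"
        using D(1) unfolding cohen_macaulay_def by blast
      moreover have "link ?D F = {G \<in> \<Delta>. F \<union> G \<in> \<Delta> \<and> G \<inter> (F \<union> W) = {}}"
        using F W(3) V unfolding link_def deletion_def by blast
      ultimately show ?thesis by simp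
    qed
    show "inj_on \<kappa> F" if "F \<in> \<Delta>" for F using \<kappa>(2)[OF that] by (auto simp: inj_on_def)
  qed (use \<kappa>(1) V in auto)
  then show thesis by (rule that)
qed

lemma balanced_lower_bounds:
  fixes V :: "'v set" and \<Delta> :: "'v set set" and d :: nat and k :: "'k::idom itself"
  assumes sc: "simplicial_complex V \<Delta>" and dim: "complex_dim \<Delta> = int d - 1"
    and "balanced V \<Delta>" "two_cohen_macaulay k V \<Delta>"
  shows "(d \<ge> 3 \<longrightarrow> 2 * h_num \<Delta> 2 \<ge> (int d - 1) * h_num \<Delta> 1) \<and>
    (\<forall>n. d \<ge> 2 \<and> f_num \<Delta> 0 = n \<longrightarrow>
       (\<forall>j\<in>{2..d}. int j * int (f_num \<Delta> (int j - 1)) \<ge> psi (j - 1) n (d - 1)))"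
proof -
  obtain \<kappa> :: "'v \<Rightarrow> nat" where col: "colored_2cm k \<Delta> d \<kappa> {1..d}"
    using two_cohen_macaulay_colored[OF assms] .
  interpret colored_2cm k \<Delta> d \<kappa> "{1..d}" by (rule col)
  have f: "f_num \<Delta> (int j - 1) = card {F \<in> \<Delta>. card F = j}" for j
    by (simp add: f_num_def face_dim_def)
  have "{F \<in> \<Delta>. card F = 1} = (\<lambda>x. {x}) ` \<Union>\<Delta>"
    using vertex_face by (auto simp: card_1_singleton_iff)
  then have f0: "f_num \<Delta> 0 = card (\<Union>\<Delta>)"
    using f[of 1] by (simp add: card_image)
  have f1: "f_num \<Delta> 1 = card {F \<in> \<Delta>. card F = 2}" using f[of 2] by simp
  show ?thesis
  proof (intro conjI impI allI ballI)
    assume d: "d \<ge> 3"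
    have fin: "finite \<Delta>" by (rule finite_subset[of _ "Pow (\<Union>\<Delta>)"]) (use finV in auto)
    have two: "2 * int (d choose 2) = int d * (int d - 1)"
    proof -
      have "2 * (d choose 2) = d * (d - 1)"
        using times_binomial_minus1_eq[of 2 d] by simp
      then have "int (2 * (d choose 2)) = int (d * (d - 1))" by simp
      then show ?thesis using d by (simp add: of_nat_diff)
    qed
    have h: "h_num \<Delta> 1 = int (f_num \<Delta> 0) - int d"
      "h_num \<Delta> 2 = int (f_num \<Delta> 1) - (int d - 1) * int (f_num \<Delta> 0) + int (d choose 2)"
      using h_num_small[OF dim _ empty_face fin f face_finite] d by simp_all
    \<comment> \<open>The difference of the two sides is
      \<open>2 f_1 - 3 (d - 1) f_0 + 2 d (d - 1)\<close>, which is the edge bound.\<close>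
    show "(int d - 1) * h_num \<Delta> 1 \<le> 2 * h_num \<Delta> 2"
      unfolding h f0 f1 using edge_bound_int[OF d] two by (simp add: algebra_simps)
  next
    fix n j assume "d \<ge> 2 \<and> f_num \<Delta> 0 = n" "j \<in> {2..d}"
    then show "psi (j - 1) n (d - 1) \<le> int j * int (f_num \<Delta> (int j - 1))"
      using face_bound[OF col, of j] f f0 by simp
  qed
qed

text \<open>The argument runs over an arbitrary integral domain, of which both coefficient rings are
  instances.\<close>

theorem theorem5p3:
  fixes V :: "'v set" and \<Delta> :: "'v set set" and d :: nat
  assumes "simplicial_complex V \<Delta>"
    and "complex_dim \<Delta> = int d - 1"
    and "balanced V \<Delta>"
    and "two_cohen_macaulay TYPE('k::field) V \<Delta> \<or> two_cohen_macaulay TYPE(int) V \<Delta>"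
  shows "(d \<ge> 3 \<longrightarrow> 2 * h_num \<Delta> 2 \<ge> (int d - 1) * h_num \<Delta> 1) \<and>
    (\<forall>n. d \<ge> 2 \<and> f_num \<Delta> 0 = n \<longrightarrow>
       (\<forall>j\<in>{2..d}. int j * int (f_num \<Delta> (int j - 1)) \<ge> psi (j - 1) n (d - 1)))"
  using assms(4)
proof
  assume "two_cohen_macaulay TYPE('k) V \<Delta>"
  then show ?thesis by (rule balanced_lower_bounds[OF assms(1-3)])
next
  assume "two_cohen_macaulay TYPE(int) V \<Delta>"
  then show ?thesis by (rule balanced_lower_bounds[OF assms(1-3)])
qed

end
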